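(* Let $r\in\{3,5,7\}$ and let $q\in\mathbb{C}$ be a primitive $r$-th root of unity. The noncommutative de Rham cohomology $H^1$ of the 4-dimensional differential calculus on the reduced quantum group $\mathcal{A}=\mathbb{C}_q[SL_2]$ is 4-dimensional over $\mathbb{C}$, with basis given by the classes of $$\theta=e_a+e_d,\quad h_1=e_b\,ac^{r-1},\quad h_2=e_c\,a^{r-1}b^{r-1},\quad n=e_a+e_c\,a^{r-1}c.$$
   Context: Put $\mu=1-q^{-2}$. $\mathcal{A}$ is the unital $\mathbb{C}$-algebra generated by $a,b,c,d$ with relations $ba=qab$, $ca=qac$, $db=qbd$, $dc=qcd$, $cb=bc$, $da-ad=q\mu bc$, $ad-q^{-1}bc=1$, $a^r=d^r=1$, $b^r=c^r=0$. It has basis $\{a^mb^nc^k\}_{0\le m,n,k\le r-1}$. $\Lambda$ is the graded algebra generated by degree-1 elements $e_a,e_b,e_c,e_d$ with relations: $e_b,e_c,e_d$ pairwise anticommute and square to zero; $e_a\wedge e_a=\mu e_b\wedge e_c$; $e_a\wedge e_d+e_d\wedge e_a+\mu e_b\wedge e_c=0$; $e_a\wedge e_b+q^2e_b\wedge e_a-\mu e_b\wedge e_d=0$; $e_c\wedge e_a+q^2e_a\wedge e_c+\mu e_c\wedge e_d=0$. It has dimensions $1,4,6,4,1$ in degrees $0,\dots,4$. The exterior algebra $\Omega=\Lambda\otimes\mathcal{A}$ is the free right $\mathcal{A}$-module on $\Lambda$, with algebra structure given by those of $\Lambda$, $\mathcal{A}$ and the following cross relations, where $(u,v)$ is either $(a,c)$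 or $(b,d)$: $ve_b=e_bv$, $ue_c=e_cu$, $ue_d=q^{-1}e_du$, $ve_d=qe_dv$, $ue_b=e_bu+q\mu e_dv$, $ve_c=e_cv+q\mu e_du$, $ve_a=q^{-1}e_av+\mu e_bu$, $ue_a=qe_au+\mu e_cv+q\mu^2e_du$. The exterior derivative is $\mathrm{d}\omega=-(\theta\wedge\omega-(-1)^{|\omega|}\omega\wedge\theta)$ with $\theta=e_a+e_d$; it satisfies $\mathrm{d}^2=0$ and the graded Leibniz rule. $H^i$ is the degree-$i$ cohomology of $(\Omega,\mathrm{d})$. *)

theory Defs
  imports
    Complex_Main
    "HOL-Library.Poly_Mapping"
    "HOL-Algebra.QuotRing"
    "Jordan_Normal_Form.VS_Connect"
begin

hide_const (open) Modules.module

section \<open>The free complex algebra on eight generators\<close>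

datatype generator = Gen_a | Gen_b | Gen_c | Gen_d | Form_a | Form_b | Form_c | Form_d

text \<open>
  Words are wrapped in a type of their own so that concatenation can be the addition of a
  (noncommutative) \<^class>\<open>monoid_add\<close>; the convolution product of \<^type>\<open>poly_mapping\<close> is then
  the product of the free algebra.
\<close>

datatype 'a free_monoid = Free_Monoid (letters: "'a list")

instantiation free_monoid :: (type) monoid_add
begin

definition zero_free_monoid :: "'a free_monoid" where
  "0 = Free_Monoid []"

definition plus_free_monoid :: "'a free_monoid \<Rightarrow> 'a free_monoid \<Rightarrow> 'a free_monoid" where
  "v + w = Free_Monoid (letters v @ letters w)"

instance
  by standard (simp_all add: zero_free_monoid_def plus_free_monoid_def)

end

type_synonym free_algebra = "generator free_monoid \<Rightarrow>\<^sub>0 complex"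

definition gen :: "generator \<Rightarrow> free_algebra" where
  "gen x = Poly_Mapping.single (Free_Monoid [x]) 1"

definition scalar :: "complex \<Rightarrow> free_algebra" where
  "scalar z = Poly_Mapping.single 0 z"

abbreviation scale_free :: "complex \<Rightarrow> free_algebra \<Rightarrow> free_algebra"  (infixr \<open>\<star>\<close> 75) where
  "z \<star> x \<equiv> scalar z * x"

abbreviation x\<^sub>a :: free_algebra where "x\<^sub>a \<equiv> gen Gen_a"
abbreviation x\<^sub>b :: free_algebra where "x\<^sub>b \<equiv> gen Gen_b"
abbreviation x\<^sub>c :: free_algebra where "x\<^sub>c \<equiv> gen Gen_c"
abbreviation x\<^sub>d :: free_algebra where "x\<^sub>d \<equiv> gen Gen_d"

abbreviation e\<^sub>a :: free_algebra where "e\<^sub>a \<equiv> gen Form_a"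
abbreviation e\<^sub>b :: free_algebra where "e\<^sub>b \<equiv> gen Form_b"
abbreviation e\<^sub>c :: free_algebra where "e\<^sub>c \<equiv> gen Form_c"
abbreviation e\<^sub>d :: free_algebra where "e\<^sub>d \<equiv> gen Form_d"

section \<open>The relations\<close>

text \<open>A relation \<open>s = t\<close> is represented by the element \<open>s - t\<close>.\<close>

definition q_mu :: "complex \<Rightarrow> complex" where
  "q_mu q = 1 - inverse (q ^ 2)"

text \<open>The reduced quantum group \<open>\<A>\<close>.\<close>

definition function_relations :: "complex \<Rightarrow> nat \<Rightarrow> free_algebra set" where
  "function_relations q r =
    {x\<^sub>b * x\<^sub>a - q \<star> x\<^sub>a * x\<^sub>b,
     x\<^sub>c * x\<^sub>a - q \<star> x\<^sub>a * x\<^sub>c,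
     x\<^sub>d * x\<^sub>b - q \<star> x\<^sub>b * x\<^sub>d,
     x\<^sub>d * x\<^sub>c - q \<star> x\<^sub>c * x\<^sub>d,
     x\<^sub>c * x\<^sub>b - x\<^sub>b * x\<^sub>c,
     x\<^sub>d * x\<^sub>a - x\<^sub>a * x\<^sub>d - (q * q_mu q) \<star> x\<^sub>b * x\<^sub>c,
     x\<^sub>a * x\<^sub>d - inverse q \<star> x\<^sub>b * x\<^sub>c - 1,
     x\<^sub>a ^ r - 1,
     x\<^sub>d ^ r - 1,
     x\<^sub>b ^ r,
     x\<^sub>c ^ r}"

text \<open>In the algebra \<open>\<Lambda>\<close> of left-invariant forms, \<open>*\<close> is the wedge product.\<close>

definition form_relations :: "complex \<Rightarrow> free_algebra set" where
  "form_relations q =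
    {e\<^sub>b * e\<^sub>b,
     e\<^sub>c * e\<^sub>c,
     e\<^sub>d * e\<^sub>d,
     e\<^sub>b * e\<^sub>c + e\<^sub>c * e\<^sub>b,
     e\<^sub>b * e\<^sub>d + e\<^sub>d * e\<^sub>b,
     e\<^sub>c * e\<^sub>d + e\<^sub>d * e\<^sub>c,
     e\<^sub>a * e\<^sub>a - q_mu q \<star> e\<^sub>b * e\<^sub>c,
     e\<^sub>a * e\<^sub>d + e\<^sub>d * e\<^sub>a + q_mu q \<star> e\<^sub>b * e\<^sub>c,
     e\<^sub>a * e\<^sub>b + q ^ 2 \<star> e\<^sub>b * e\<^sub>a - q_mu q \<star> e\<^sub>b * e\<^sub>d,
     e\<^sub>c * e\<^sub>a + q ^ 2 \<star> e\<^sub>a * e\<^sub>c + q_mu q \<star> e\<^sub>c * e\<^sub>d}"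

definition cross_relations :: "complex \<Rightarrow> free_algebra set" where
  "cross_relations q = (\<Union>(u, v)\<in>{(x\<^sub>a, x\<^sub>c), (x\<^sub>b, x\<^sub>d)}.
    {v * e\<^sub>b - e\<^sub>b * v,
     u * e\<^sub>c - e\<^sub>c * u,
     u * e\<^sub>d - inverse q \<star> e\<^sub>d * u,
     v * e\<^sub>d - q \<star> e\<^sub>d * v,
     u * e\<^sub>b - (e\<^sub>b * u + (q * q_mu q) \<star> e\<^sub>d * v),
     v * e\<^sub>c - (e\<^sub>c * v + (q * q_mu q) \<star> e\<^sub>d * u),
     v * e\<^sub>a - (inverse q \<star> e\<^sub>a * v + q_mu q \<star> e\<^sub>b * u),
     u * e\<^sub>a - (q \<star> e\<^sub>a * u + q_mu q \<star> e\<^sub>c * v + (q * q_mu q ^ 2) \<star> e\<^sub>d * u)})"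

section \<open>The exterior algebra\<close>

definition relation_ideal :: "complex \<Rightarrow> nat \<Rightarrow> free_algebra set" where
  "relation_ideal q r =
    Idl\<^bsub>class_ring\<^esub> (function_relations q r \<union> form_relations q \<union> cross_relations q)"

text \<open>
  \<open>\<Omega>\<close> is presented by the generators of \<open>\<A>\<close> and \<open>\<Lambda>\<close>, their relations and the cross relations.
  This is the algebra \<open>\<Lambda> \<otimes> \<A>\<close>: the cross relations move every form generator to the left, so the
  multiplication map from \<open>\<Lambda> \<otimes> \<A>\<close> to the presented algebra is onto, and it is inverse to the
  homomorphism to the algebra \<open>\<Lambda> \<otimes> \<A>\<close> given by the universal property of the presentation.
\<close>

definition Omega :: "complex \<Rightarrow> nat \<Rightarrow> (complex, free_algebra set) module" where
  "Omega q r =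
    (let R = class_ring Quot relation_ideal q r
     in \<lparr>carrier = carrier R, mult = mult R, one = one R, zero = zero R, add = add R,
         smult = (\<lambda>z X. (relation_ideal q r +>\<^bsub>class_ring\<^esub> scalar z) \<otimes>\<^bsub>R\<^esub> X)\<rparr>)"

definition to_Omega :: "complex \<Rightarrow> nat \<Rightarrow> free_algebra \<Rightarrow> free_algebra set" where
  "to_Omega q r x = relation_ideal q r +>\<^bsub>class_ring\<^esub> x"

definition form_degree :: "generator free_monoid \<Rightarrow> nat" where
  "form_degree w = length (filter (\<lambda>x. x \<in> {Form_a, Form_b, Form_c, Form_d}) (letters w))"

definition Omega_deg :: "complex \<Rightarrow> nat \<Rightarrow> nat \<Rightarrow> free_algebra set set" where
  "Omega_deg q r i = to_Omega q r ` {x. \<forall>w\<in>Poly_Mapping.keys x. form_degree w = i}"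

definition theta :: "complex \<Rightarrow> nat \<Rightarrow> free_algebra set" where
  "theta q r = to_Omega q r (e\<^sub>a + e\<^sub>d)"

text \<open>The exterior derivative on forms of degree \<open>i\<close>.\<close>

definition ext_d :: "complex \<Rightarrow> nat \<Rightarrow> nat \<Rightarrow> free_algebra set \<Rightarrow> free_algebra set" where
  "ext_d q r i \<omega> =
    \<ominus>\<^bsub>Omega q r\<^esub> (theta q r \<otimes>\<^bsub>Omega q r\<^esub> \<omega>
      \<ominus>\<^bsub>Omega q r\<^esub> (-1) ^ i \<odot>\<^bsub>Omega q r\<^esub> (\<omega> \<otimes>\<^bsub>Omega q r\<^esub> theta q r))"

section \<open>Noncommutative de Rham cohomology\<close>

text \<open>
  The type \<^type>\<open>module\<close> extends that of rings; as usual for vector spaces, the fields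
  \<open>mult\<close> and \<open>one\<close> carry no meaning.
\<close>

definition quotient_space :: "('k, 'v, 'm) module_scheme \<Rightarrow> 'v set \<Rightarrow> ('k, 'v set) module" where
  "quotient_space V W =
    \<lparr>carrier = a_rcosets\<^bsub>V\<^esub> W, mult = (\<lambda>_ _. W), one = W, zero = W, add = set_add V,
     smult = (\<lambda>z X. \<Union>x\<in>X. W +>\<^bsub>V\<^esub> (z \<odot>\<^bsub>V\<^esub> x))\<rparr>"

definition closed_forms :: "complex \<Rightarrow> nat \<Rightarrow> nat \<Rightarrow> free_algebra set set" where
  "closed_forms q r i = {\<omega> \<in> Omega_deg q r i. ext_d q r i \<omega> = \<zero>\<^bsub>Omega q r\<^esub>}"

definition exact_forms :: "complex \<Rightarrow> nat \<Rightarrow> nat \<Rightarrow> free_algebra set set" where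
  "exact_forms q r i =
    (case i of 0 \<Rightarrow> {\<zero>\<^bsub>Omega q r\<^esub>} | Suc j \<Rightarrow> ext_d q r j ` Omega_deg q r j)"

definition de_Rham :: "complex \<Rightarrow> nat \<Rightarrow> nat \<Rightarrow> (complex, free_algebra set set) module" where
  "de_Rham q r i = quotient_space (Omega q r\<lparr>carrier := closed_forms q r i\<rparr>) (exact_forms q r i)"

text \<open>
  This coset lies in the carrier of \<^term>\<open>de_Rham q r i\<close> only if \<open>\<omega>\<close> is a closed form of degree \<open>i\<close>.
\<close>

definition de_Rham_class ::
    "complex \<Rightarrow> nat \<Rightarrow> nat \<Rightarrow> free_algebra set \<Rightarrow> free_algebra set set" where
  "de_Rham_class q r i \<omega> = exact_forms q r i +>\<^bsub>Omega q r\<^esub> \<omega>"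

end

theory Submission
  imports Defs "HOL-Library.Function_Algebras"
begin

text \<open>
  \<open>\<Omega>\<close> acts from the left on \<open>\<Lambda> \<otimes> \<A>\<close>. In form degrees at most two this representation is
  written down explicitly; it kills the relation ideal, and it is faithful in degrees zero and one, where
  the relations bring every element into normal form. This turns the differential into operators on
  coefficients: \<open>d f = e\<^sub>a (\<kappa> - 1) f + e\<^sub>b P f + e\<^sub>c Q f + e\<^sub>d (q\<^sup>2 \<kappa>\<^sup>-\<^sup>1 P Q + \<kappa>\<^sup>-\<^sup>1 - 1) f\<close>, where
  \<open>\<kappa>\<close> multiplies the functions of row degree \<open>s\<close> (\<open>a\<close>, \<open>b\<close> have row degree 1 and \<open>c\<close>, \<open>d\<close> have
  row degree \<open>-1\<close>) by \<open>q\<^sup>s\<close>, and \<open>P\<close>, \<open>Q\<close> map the monomials in \<open>a, b, c\<close> to combinations of at most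
  two monomials.

  Since \<open>\<kappa> - 1\<close> is invertible off row degree zero, a closed form can be changed by an exact one so that its
  \<open>e\<^sub>a\<close>-coefficient has row degree zero; closedness then makes this coefficient constant, and a multiple
  of \<open>n\<close> removes it. Dividing by \<open>P\<close> and then by \<open>Q\<close> on functions of row degree zero removes all of the
  \<open>e\<^sub>b\<close>- and \<open>e\<^sub>c\<close>-coefficients except where the factors \<open>q\<^sup>k - q\<^sup>-\<^sup>k\<close> of these operators vanish, which is
  where \<open>h\<^sub>1\<close> and \<open>h\<^sub>2\<close> live. What is left is a multiple of \<open>n - \<theta>\<close>.
\<close>

section \<open>The free algebra and its representations\<close>

text \<open>\<open>Omega\<close> is given by generators and relations, so proving that a form is
  nonzero or not exact requires a model in which the relations visibly hold. Left multiplication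
  never lowers the form degree; the part of degree three and above of the left regular
  representation is therefore stable and can be discarded.

  The operators \<kappa>, P, Q are coefficients of f \<theta> after moving the forms to the left. P
  and Q are twisted derivations: P replaces c, d by multiples of a, b, and Q replaces a, b by
  multiples of c, d, like raising and lowering operators of quantum sl_2. As r is odd, a factor q^k
  - q^(-k) vanishes only if r divides k. For P this puts the kernel at c^0 and the missing part of
  the image at c^(r-1). The same arithmetic makes the power relations compatible with the forms:
  corrections in moving a j-th power past a form have such factors, and they vanish for j =
  r.\<close>

lemma poly_mapping_single_induct [case_names single add]:
  fixes x :: "'a \<Rightarrow>\<^sub>0 'b::comm_monoid_add"
  assumes "\<And>w z. P (Poly_Mapping.single w z)" "\<And>x y. P x \<Longrightarrow> P y \<Longrightarrow> P (x + y)"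
  shows "P x"
proof -
  have "P (\<Sum>w\<in>A. Poly_Mapping.single w (Poly_Mapping.lookup x w))" if "finite A" for A
    using that
  proof (induction A rule: finite_induct)
    case empty
    show ?case using assms(1)[of undefined 0] by simp
  qed (simp add: assms)
  then have "P (\<Sum>w\<in>Poly_Mapping.keys x. Poly_Mapping.single w (Poly_Mapping.lookup x w))" by simp
  also have "(\<Sum>w\<in>Poly_Mapping.keys x. Poly_Mapping.single w (Poly_Mapping.lookup x w)) = x"
    by (rule poly_mapping_eqI)
      (auto simp: lookup_sum lookup_single when_def sum.If_cases in_keys_iff sum.delta)
  finally show ?thesis .
qed

lemma scalar_zero [simp]: "scalar 0 = 0"
  and scalar_one [simp]: "scalar 1 = 1"
  and scalar_add: "scalar (y + z) = scalar y + scalar z"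
  and scalar_mult: "scalar (y * z) = scalar y * scalar z"
  and scalar_uminus: "scalar (- z) = - scalar z"
  by (simp_all add: scalar_def single_add mult_single single_uminus)

lemma scalar_commute: "x * scalar z = scalar z * x"
proof (induction x rule: poly_mapping_single_induct)
  case (single w y)
  then show ?case by (simp add: scalar_def mult_single mult.commute)
qed (simp add: algebra_simps)

lemma scalar_left_commute: "x * (scalar z * y) = scalar z * (x * y)"
  by (metis mult.assoc scalar_commute)

lemma single_word_Cons:
  "Poly_Mapping.single (Free_Monoid (g # gs)) z = gen g * Poly_Mapping.single (Free_Monoid gs) z"
  by (simp add: gen_def mult_single plus_free_monoid_def)

lemma single_word_Nil: "Poly_Mapping.single (Free_Monoid []) z = scalar z"
  by (simp add: scalar_def zero_free_monoid_def)

text \<open>A representation of the free algebra is one linear operator per generator, with no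
  compatibility to check; the relations enter only later, when their action is shown to
  vanish.\<close>

locale free_action = vector_space scale
  for scale :: "complex \<Rightarrow> 'v::ab_group_add \<Rightarrow> 'v" (infixr \<open>*s\<close> 75) +
  fixes \<rho> :: "generator \<Rightarrow> 'v \<Rightarrow> 'v"
  assumes linear: "\<And>g. Vector_Spaces.linear scale scale (\<rho> g)"
begin

definition act_word :: "generator list \<Rightarrow> 'v \<Rightarrow> 'v" where
  "act_word gs v = foldr \<rho> gs v"

definition act :: "free_algebra \<Rightarrow> 'v \<Rightarrow> 'v" where
  "act x v = (\<Sum>w\<in>Poly_Mapping.keys x. Poly_Mapping.lookup x w *s act_word (letters w) v)"

lemma act_word_linear: "Vector_Spaces.linear scale scale (act_word gs)"
proof (induction gs)
  case Nil
  then show ?case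
    by (simp add: act_word_def[abs_def] linear_id[unfolded id_def])
next
  case (Cons g gs)
  then show ?case
    using Vector_Spaces.linear_compose[OF Cons linear[of g]] by (simp add: act_word_def o_def)
qed

interpretation act_word: module_hom scale scale "act_word gs" for gs
  using act_word_linear by (simp add: Vector_Spaces.linear_def)

text \<open>Keys can cancel in a sum, so additivity is proved over a common finite superset of the
  keys.\<close>

lemma act_superset:
  assumes "finite A" "Poly_Mapping.keys x \<subseteq> A"
  shows "act x v = (\<Sum>w\<in>A. Poly_Mapping.lookup x w *s act_word (letters w) v)"
  unfolding act_def
  by (rule sum.mono_neutral_left) (use assms in \<open>auto simp: in_keys_iff\<close>)

lemma act_single: "act (Poly_Mapping.single w z) v = z *s act_word (letters w) v"
  by (subst act_superset[of "{w}"]) auto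

lemma act_add: "act (x + y) v = act x v + act y v"
  by (simp add: act_superset[of "Poly_Mapping.keys x \<union> Poly_Mapping.keys y"] Poly_Mapping.keys_add
      lookup_add scale_left_distrib sum.distrib)

lemma act_zero [simp]: "act 0 v = 0"
  by (simp add: act_def)

lemma act_uminus: "act (- x) v = - act x v"
  using act_add[of x "- x" v] by (simp add: eq_neg_iff_add_eq_0 add.commute)

lemma act_diff: "act (x - y) v = act x v - act y v"
  using act_add[of x "- y" v] by (simp add: act_uminus)

lemma act_sum: "act (\<Sum>i\<in>A. f i) v = (\<Sum>i\<in>A. act (f i) v)"
  by (induction A rule: infinite_finite_induct) (simp_all add: act_add)

sublocale act: module_hom scale scale "act x" for x
proof unfold_locales
  show "act x (v + w) = act x v + act x w" for v w
    by (simp add: act_def act_word.add scale_right_distrib sum.distrib)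
  show "act x (z *s v) = z *s act x v" for z v
    by (simp add: act_def act_word.scale scale_sum_right mult.commute)
qed

lemma act_mult: "act (x * y) v = act x (act y v)"
proof (induction x rule: poly_mapping_single_induct)
  case (single w z)
  show ?case
  proof (induction y rule: poly_mapping_single_induct)
    case (single w' z')
    then show ?case
      by (simp add: mult_single act_single act_word.scale plus_free_monoid_def)
        (simp add: act_word_def)
  qed (simp_all add: distrib_left act_add act.add)
qed (simp_all add: distrib_right act_add)

lemma act_gen: "act (gen g) v = \<rho> g v"
  by (simp add: gen_def act_single act_word_def)

lemma act_scalar: "act (scalar z) v = z *s v"
  by (simp add: scalar_def act_single act_word_def zero_free_monoid_def)

lemma act_one: "act 1 v = v"
  using act_scalar[of 1] by simp

lemma act_power: "act (gen g ^ n) v = (\<rho> g ^^ n) v"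
  by (induction n) (simp_all add: act_one act_mult act_gen)

lemmas act_simps = act_add act_uminus act_diff act_mult act_gen act_scalar act_one act_power

lemma act_in_subspace:
  assumes "subspace S" "\<And>g v. v \<in> S \<Longrightarrow> \<rho> g v \<in> S" "v \<in> S"
  shows "act x v \<in> S"
proof -
  have "act_word gs v \<in> S" for gs
    by (induction gs) (use assms in \<open>simp_all add: act_word_def\<close>)
  then show ?thesis
    unfolding act_def by (intro subspace_sum subspace_scale assms(1))
qed

end

section \<open>The relation ideal\<close>

definition relations :: "complex \<Rightarrow> nat \<Rightarrow> free_algebra set" where
  "relations q r = function_relations q r \<union> form_relations q \<union> cross_relations q"

lemma relation_ideal_ideal: "ideal (relation_ideal q r) class_ring"
  unfolding relation_ideal_def by (rule ring.genideal_ideal[OF class_ring.ring_axioms]) simp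

lemma relations_subset: "relations q r \<subseteq> relation_ideal q r"
  unfolding relation_ideal_def relations_def by (rule ring.genideal_self[OF class_ring.ring_axioms]) simp

lemma relation_ideal_minimal:
  "ideal K class_ring \<Longrightarrow> relations q r \<subseteq> K \<Longrightarrow> relation_ideal q r \<subseteq> K"
  unfolding relation_ideal_def relations_def by (rule ring.genideal_minimal[OF class_ring.ring_axioms])

text \<open>Equality of the images in \<open>Omega\<close>, stated for representatives so that all
  rewriting takes place in the free algebra.\<close>

definition cong :: "complex \<Rightarrow> nat \<Rightarrow> free_algebra \<Rightarrow> free_algebra \<Rightarrow> bool" where
  "cong q r x y \<longleftrightarrow> x - y \<in> relation_ideal q r"

context
  fixes q :: complex and r :: nat
begin

interpretation ideal "relation_ideal q r" "class_ring :: free_algebra ring"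
  rewrites "carrier (class_ring :: free_algebra ring) = UNIV"
    and "mult (class_ring :: free_algebra ring) = (*)"
    and "add (class_ring :: free_algebra ring) = (+)"
    and "one (class_ring :: free_algebra ring) = 1"
    and "zero (class_ring :: free_algebra ring) = 0"
    and "a_inv (class_ring :: free_algebra ring) = uminus"
  using relation_ideal_ideal by (simp_all add: class_ring_simps)

lemma relation_ideal_zero: "0 \<in> relation_ideal q r"
  and relation_ideal_add:
    "x \<in> relation_ideal q r \<Longrightarrow> y \<in> relation_ideal q r \<Longrightarrow> x + y \<in> relation_ideal q r"
  and relation_ideal_uminus: "x \<in> relation_ideal q r \<Longrightarrow> - x \<in> relation_ideal q r"
  and relation_ideal_mult_left: "x \<in> relation_ideal q r \<Longrightarrow> y * x \<in> relation_ideal q r"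
  and relation_ideal_mult_right: "x \<in> relation_ideal q r \<Longrightarrow> x * y \<in> relation_ideal q r"
  using additive_subgroup.zero_closed[OF additive_subgroup_axioms]
    additive_subgroup.a_closed[OF additive_subgroup_axioms]
    additive_subgroup.a_inv_closed[OF additive_subgroup_axioms]
    I_l_closed I_r_closed by (simp_all add: class_ring_simps)

end

lemma cong_refl [simp]: "cong q r x x"
  by (simp add: cong_def relation_ideal_zero)

lemma cong_sym: "cong q r x y \<Longrightarrow> cong q r y x"
  unfolding cong_def using relation_ideal_uminus by fastforce

lemma cong_trans [trans]: "cong q r x y \<Longrightarrow> cong q r y z \<Longrightarrow> cong q r x z"
  unfolding cong_def using relation_ideal_add by fastforce

lemma cong_add: "cong q r x y \<Longrightarrow> cong q r x' y' \<Longrightarrow> cong q r (x + x') (y + y')"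
  unfolding cong_def using relation_ideal_add by (metis add_diff_add)

lemma cong_uminus: "cong q r x y \<Longrightarrow> cong q r (- x) (- y)"
  unfolding cong_def using relation_ideal_uminus by fastforce

lemma cong_diff: "cong q r x y \<Longrightarrow> cong q r x' y' \<Longrightarrow> cong q r (x - x') (y - y')"
  using cong_add[OF _ cong_uminus] by fastforce

lemma cong_mult: "cong q r x y \<Longrightarrow> cong q r x' y' \<Longrightarrow> cong q r (x * x') (y * y')"
proof -
  assume "cong q r x y" "cong q r x' y'"
  then have "(x - y) * x' + y * (x' - y') \<in> relation_ideal q r"
    unfolding cong_def
    by (intro relation_ideal_add relation_ideal_mult_left relation_ideal_mult_right)
  then show ?thesis by (simp add: cong_def algebra_simps)
qed

lemma cong_sum: "(\<And>i. i \<in> A \<Longrightarrow> cong q r (f i) (g i)) \<Longrightarrow> cong q r (sum f A) (sum g A)"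
  by (induction A rule: infinite_finite_induct) (simp_all add: cong_add)

lemma cong_relation: "x - y \<in> relations q r \<Longrightarrow> cong q r x y"
  using relations_subset by (auto simp: cong_def)

section \<open>The left regular representation in form degrees at most two\<close>

type_synonym coeffs = "int \<Rightarrow> int \<Rightarrow> int \<Rightarrow> complex"

text \<open>A basis of the invariant forms up to degree two. The letters give the order of the wedge
  factors: \<open>Fba\<close> is e_b e_a, and e_a always stands last.\<close>

datatype form = F1 | Fa | Fb | Fc | Fd | Fba | Fca | Fda | Fbc | Fbd | Fcd

definition scale_coeffs :: "complex \<Rightarrow> coeffs \<Rightarrow> coeffs" (infixr \<open>*\<^sub>A\<close> 75) where
  "z *\<^sub>A f = (\<lambda>m n k. z * f m n k)"

definition scale_vec :: "complex \<Rightarrow> (form \<Rightarrow> coeffs) \<Rightarrow> form \<Rightarrow> coeffs" (infixr \<open>*\<^sub>F\<close> 75) where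
  "z *\<^sub>F v = (\<lambda>i. z *\<^sub>A v i)"

lemma scale_coeffs_apply [simp]: "(z *\<^sub>A f) m n k = z * f m n k"
  by (simp add: scale_coeffs_def)

lemma scale_vec_apply [simp]: "(z *\<^sub>F v) i = z *\<^sub>A v i"
  by (simp add: scale_vec_def)

lemma coeffs_apply [simp]:
  fixes f g :: coeffs
  shows "(f - g) m n k = f m n k - g m n k" "(- f) m n k = - f m n k" "(0 :: coeffs) m n k = 0"
  by (simp_all add: fun_diff_def zero_fun_def)

lemma vec_apply [simp]:
  fixes f g :: "form \<Rightarrow> coeffs"
  shows "(f - g) i = f i - g i" "(- f) i = - f i" "(0 :: form \<Rightarrow> coeffs) i = 0"
  by (simp_all add: fun_diff_def zero_fun_def)

interpretation coeffs: vector_space scale_coeffs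
  by unfold_locales (auto simp: fun_eq_iff algebra_simps)

interpretation vec: vector_space scale_vec
  by unfold_locales (auto simp: fun_eq_iff algebra_simps)

interpretation coeffs_pair: vector_space_pair scale_coeffs scale_coeffs ..

abbreviation coeffs_linear :: "(coeffs \<Rightarrow> coeffs) \<Rightarrow> bool" where
  "coeffs_linear \<equiv> Vector_Spaces.linear scale_coeffs scale_coeffs"

lemma coeffs_linearD:
  assumes "coeffs_linear L"
  shows "L (f + g) = L f + L g" "L (f - g) = L f - L g" "L (- f) = - L f" "L (z *\<^sub>A f) = z *\<^sub>A L f"
    "L 0 = 0"
  using assms coeffs_pair.linear_add coeffs_pair.linear_diff coeffs_pair.linear_neg
    coeffs_pair.linear_scale coeffs_pair.linear_0 by blast+

lemma vec_eqI: "(\<And>i. v i = w i) \<Longrightarrow> v = (w :: form \<Rightarrow> coeffs)"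
  by (rule ext)

lemma coeffs_eqI: "(\<And>m n k. f m n k = g m n k) \<Longrightarrow> f = (g :: coeffs)"
  by (intro ext)

locale reduced_SL2 =
  fixes q :: complex and r :: nat
  assumes r_ge: "r \<ge> 3" and r_odd: "odd r" and q_power: "q ^ r = 1"
    and q_primitive: "0 < k \<Longrightarrow> k < r \<Longrightarrow> q ^ k \<noteq> 1"
begin

definition p :: complex where "p = inverse q"

abbreviation \<mu> :: complex where "\<mu> \<equiv> q_mu q"

lemma q_nonzero [simp]: "q \<noteq> 0"
  using q_power r_ge by (metis not_numeral_le_zero power_0_left zero_neq_one)

lemma inverse_q: "inverse q = p"
  by (simp add: p_def)

lemma q_p [simp]: "q * p = 1" "p * q = 1" "q * (p * z) = z" "p * (q * z) = z" "p \<noteq> 0"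
  by (simp_all add: p_def)

lemma mu_eq: "\<mu> = 1 - p * p"
  by (simp add: q_mu_def p_def power2_eq_square)

lemma powi_add: "q powi (m + n) = q powi m * q powi n"
  by (simp add: power_int_add)

text \<open>
  A pair \<open>(u, v)\<close> of generators of \<open>\<A>\<close> acts on \<open>\<Lambda>\<close> with coefficients in \<open>\<A>\<close>. The parameters
  \<open>U\<close> and \<open>V\<close> are the left multiplications by \<open>u\<close> and \<open>v\<close> on \<open>\<A>\<close>; degree two is
  the consequence of applying the cross relations twice.
\<close>

fun rep_u :: "(coeffs \<Rightarrow> coeffs) \<Rightarrow> (coeffs \<Rightarrow> coeffs) \<Rightarrow> (form \<Rightarrow> coeffs) \<Rightarrow> form \<Rightarrow> coeffs" where
  "rep_u U V v F1 = U (v F1)"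
| "rep_u U V v Fa = q *\<^sub>A U (v Fa)"
| "rep_u U V v Fb = U (v Fb)"
| "rep_u U V v Fc = U (v Fc) + \<mu> *\<^sub>A V (v Fa)"
| "rep_u U V v Fd = p *\<^sub>A U (v Fd) + (q * \<mu>) *\<^sub>A V (v Fb) + (q * \<mu> ^ 2) *\<^sub>A U (v Fa)"
| "rep_u U V v Fba = q *\<^sub>A U (v Fba)"
| "rep_u U V v Fca = q *\<^sub>A U (v Fca)"
| "rep_u U V v Fda = U (v Fda) + \<mu> *\<^sub>A V (v Fba)"
| "rep_u U V v Fbc = U (v Fbc) + \<mu> *\<^sub>A V (v Fba)"
| "rep_u U V v Fbd = p *\<^sub>A U (v Fbd)"
| "rep_u U V v Fcd =
    p *\<^sub>A U (v Fcd) + (q * \<mu> ^ 2) *\<^sub>A U (v Fca) - (p * \<mu>) *\<^sub>A V (v Fda) - (q * \<mu>) *\<^sub>A V (v Fbc)"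

fun rep_v :: "(coeffs \<Rightarrow> coeffs) \<Rightarrow> (coeffs \<Rightarrow> coeffs) \<Rightarrow> (form \<Rightarrow> coeffs) \<Rightarrow> form \<Rightarrow> coeffs" where
  "rep_v U V v F1 = V (v F1)"
| "rep_v U V v Fa = p *\<^sub>A V (v Fa)"
| "rep_v U V v Fb = V (v Fb) + \<mu> *\<^sub>A U (v Fa)"
| "rep_v U V v Fc = V (v Fc)"
| "rep_v U V v Fd = q *\<^sub>A V (v Fd) + (q * \<mu>) *\<^sub>A U (v Fc)"
| "rep_v U V v Fba = p *\<^sub>A V (v Fba)"
| "rep_v U V v Fca = p *\<^sub>A V (v Fca)"
| "rep_v U V v Fda = V (v Fda) + (q ^ 2 * \<mu>) *\<^sub>A U (v Fca)"
| "rep_v U V v Fbc = V (v Fbc) - \<mu> *\<^sub>A U (v Fca)"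
| "rep_v U V v Fbd = q *\<^sub>A V (v Fbd) - (q * \<mu>) *\<^sub>A U (v Fda) + (q * \<mu>) *\<^sub>A U (v Fbc)"
| "rep_v U V v Fcd = q *\<^sub>A V (v Fcd) - (q * \<mu> ^ 2) *\<^sub>A V (v Fca)"

fun wedge_a :: "(form \<Rightarrow> coeffs) \<Rightarrow> form \<Rightarrow> coeffs" where
  "wedge_a v Fa = v F1"
| "wedge_a v Fba = - (q ^ 2) *\<^sub>A v Fb"
| "wedge_a v Fca = - (p ^ 2) *\<^sub>A v Fc"
| "wedge_a v Fda = - v Fd"
| "wedge_a v Fbc = \<mu> *\<^sub>A v Fa - \<mu> *\<^sub>A v Fd"
| "wedge_a v Fbd = \<mu> *\<^sub>A v Fb"
| "wedge_a v Fcd = - (p ^ 2 * \<mu>) *\<^sub>A v Fc"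
| "wedge_a v _ = 0"

fun wedge_b :: "(form \<Rightarrow> coeffs) \<Rightarrow> form \<Rightarrow> coeffs" where
  "wedge_b v Fb = v F1"
| "wedge_b v Fba = v Fa"
| "wedge_b v Fbc = v Fc"
| "wedge_b v Fbd = v Fd"
| "wedge_b v _ = 0"

fun wedge_c :: "(form \<Rightarrow> coeffs) \<Rightarrow> form \<Rightarrow> coeffs" where
  "wedge_c v Fc = v F1"
| "wedge_c v Fca = v Fa"
| "wedge_c v Fbc = - v Fb"
| "wedge_c v Fcd = v Fd"
| "wedge_c v _ = 0"

fun wedge_d :: "(form \<Rightarrow> coeffs) \<Rightarrow> form \<Rightarrow> coeffs" where
  "wedge_d v Fd = v F1"
| "wedge_d v Fda = v Fa"
| "wedge_d v Fbd = - v Fb"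
| "wedge_d v Fcd = - v Fc"
| "wedge_d v _ = 0"

text \<open>
  A function \<open>f\<close> stands for the sum of the \<open>f m n k\<close> times \<open>a\<^sup>m b\<^sup>n c\<^sup>k\<close>. The exponent of the
  invertible element \<open>a\<close> is an integer, and \<open>f\<close> has to be periodic in it.
\<close>

definition La :: "coeffs \<Rightarrow> coeffs" where
  "La f = (\<lambda>m n k. f (m - 1) n k)"

text \<open>The factor comes from b a^m = q^m a^m b. Only the upper end of the exponents is cut off
  here; negative exponents are excluded by \<open>admissible\<close>.\<close>

definition Lb :: "coeffs \<Rightarrow> coeffs" where
  "Lb f = (\<lambda>m n k. if n < int r then q powi m * f m (n - 1) k else 0)"

definition Lc :: "coeffs \<Rightarrow> coeffs" where
  "Lc f = (\<lambda>m n k. if k < int r then q powi m * f m n (k - 1) else 0)"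

text \<open>The relations give d a = 1 + q b c, hence d a^(m+1) = a^m + q^(2m+1) a^m b c. In this
  way d acts on monomials in a, b, c although it is not a letter of the normal form.\<close>

definition Ld :: "coeffs \<Rightarrow> coeffs" where
  "Ld f = (\<lambda>m n k. f (m + 1) n k +
    (if n < int r \<and> k < int r then q powi (2 * m + 1) * f (m + 1) (n - 1) (k - 1) else 0))"

lemma L_linear: "coeffs_linear La" "coeffs_linear Lb" "coeffs_linear Lc" "coeffs_linear Ld"
  by (auto simp: Vector_Spaces.linear_iff coeffs.vector_space_axioms La_def Lb_def Lc_def Ld_def fun_eq_iff algebra_simps)

lemmas L_simps = L_linear[THEN coeffs_linearD(1)] L_linear[THEN coeffs_linearD(2)]
  L_linear[THEN coeffs_linearD(3)] L_linear[THEN coeffs_linearD(4)] L_linear[THEN coeffs_linearD(5)]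

lemma powi_arith: "q powi (m + 1) = q * q powi m" "q powi (1 + m) = q * q powi m"
  "q powi (m - 1) = p * q powi m"
  "q powi (2 * m) = q powi m * q powi m" "q powi (m * 2) = q powi m * q powi m"
  using power_int_add[of q m m] by (simp_all add: power_int_add power_int_diff p_def field_simps)

text \<open>These hold for arbitrary coefficient functions; periodicity and the range of exponents
  matter only for the four power relations.\<close>

lemma L_relations:
  "Lb (La f) = q *\<^sub>A La (Lb f)"
  "Lc (La f) = q *\<^sub>A La (Lc f)"
  "Ld (Lb f) = q *\<^sub>A Lb (Ld f)"
  "Ld (Lc f) = q *\<^sub>A Lc (Ld f)"
  "Lc (Lb f) = Lb (Lc f)"
  "Ld (La f) = f + q *\<^sub>A Lb (Lc f)"
  "La (Ld f) = f + p *\<^sub>A Lb (Lc f)"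
  by (rule coeffs_eqI; simp add: La_def Lb_def Lc_def Ld_def powi_arith algebra_simps)+

primrec rep :: "generator \<Rightarrow> (form \<Rightarrow> coeffs) \<Rightarrow> form \<Rightarrow> coeffs" where
  "rep Gen_a = rep_u La Lc"
| "rep Gen_b = rep_u Lb Ld"
| "rep Gen_c = rep_v La Lc"
| "rep Gen_d = rep_v Lb Ld"
| "rep Form_a = wedge_a"
| "rep Form_b = wedge_b"
| "rep Form_c = wedge_c"
| "rep Form_d = wedge_d"

lemma rep_u_linear:
  assumes "coeffs_linear U" "coeffs_linear V"
  shows "rep_u U V (v + w) = rep_u U V v + rep_u U V w" "rep_u U V (z *\<^sub>F v) = z *\<^sub>F rep_u U V v"
    "rep_v U V (v + w) = rep_v U V v + rep_v U V w" "rep_v U V (z *\<^sub>F v) = z *\<^sub>F rep_v U V v"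
  by (rule vec_eqI, rule coeffs_eqI, case_tac i;
    simp add: coeffs_linearD[OF assms(1)] coeffs_linearD[OF assms(2)] algebra_simps)+

lemma wedge_linear:
  "wedge_a (v + w) = wedge_a v + wedge_a w" "wedge_a (z *\<^sub>F v) = z *\<^sub>F wedge_a v"
  "wedge_b (v + w) = wedge_b v + wedge_b w" "wedge_b (z *\<^sub>F v) = z *\<^sub>F wedge_b v"
  "wedge_c (v + w) = wedge_c v + wedge_c w" "wedge_c (z *\<^sub>F v) = z *\<^sub>F wedge_c v"
  "wedge_d (v + w) = wedge_d v + wedge_d w" "wedge_d (z *\<^sub>F v) = z *\<^sub>F wedge_d v"
  by (rule vec_eqI, rule coeffs_eqI, case_tac i; simp add: algebra_simps)+

lemma rep_linear: "Vector_Spaces.linear scale_vec scale_vec (rep g)"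
  unfolding Vector_Spaces.linear_iff
  by (cases g) (simp_all add: vec.vector_space_axioms rep_u_linear wedge_linear L_linear)

sublocale free_action scale_vec rep
  by (intro free_action.intro free_action_axioms.intro vec.vector_space_axioms rep_linear)

text \<open>The cross relations involve no product inside \<A>, so linearity of \<open>U\<close> and
  \<open>V\<close> suffices and both pairs of generators are settled at once.\<close>

lemma rep_cross_relations:
  assumes UV: "coeffs_linear U" "coeffs_linear V"
  shows "rep_v U V (wedge_b w) = wedge_b (rep_v U V w)"
    "rep_u U V (wedge_c w) = wedge_c (rep_u U V w)"
    "rep_u U V (wedge_d w) = p *\<^sub>F wedge_d (rep_u U V w)"
    "rep_v U V (wedge_d w) = q *\<^sub>F wedge_d (rep_v U V w)"
    "rep_u U V (wedge_b w) = wedge_b (rep_u U V w) + (q * \<mu>) *\<^sub>F wedge_d (rep_v U V w)"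
    "rep_v U V (wedge_c w) = wedge_c (rep_v U V w) + (q * \<mu>) *\<^sub>F wedge_d (rep_u U V w)"
    "rep_v U V (wedge_a w) = p *\<^sub>F wedge_a (rep_v U V w) + \<mu> *\<^sub>F wedge_b (rep_u U V w)"
    "rep_u U V (wedge_a w) = q *\<^sub>F wedge_a (rep_u U V w) + \<mu> *\<^sub>F wedge_c (rep_v U V w)
      + (q * \<mu> ^ 2) *\<^sub>F wedge_d (rep_u U V w)"
  by (rule vec_eqI, rule coeffs_eqI, case_tac i;
    simp add: coeffs_linearD[OF UV(1)] coeffs_linearD[OF UV(2)];
    simp add: mu_eq power2_eq_square algebra_simps)+

lemma wedge_relations:
  "wedge_b (wedge_b w) = 0" "wedge_c (wedge_c w) = 0" "wedge_d (wedge_d w) = 0"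
  "wedge_b (wedge_c w) + wedge_c (wedge_b w) = 0"
  "wedge_b (wedge_d w) + wedge_d (wedge_b w) = 0"
  "wedge_c (wedge_d w) + wedge_d (wedge_c w) = 0"
  "wedge_a (wedge_a w) - \<mu> *\<^sub>F wedge_b (wedge_c w) = 0"
  "wedge_a (wedge_d w) + wedge_d (wedge_a w) + \<mu> *\<^sub>F wedge_b (wedge_c w) = 0"
  "wedge_a (wedge_b w) + q ^ 2 *\<^sub>F wedge_b (wedge_a w) - \<mu> *\<^sub>F wedge_b (wedge_d w) = 0"
  "wedge_c (wedge_a w) + q ^ 2 *\<^sub>F wedge_a (wedge_c w) + \<mu> *\<^sub>F wedge_c (wedge_d w) = 0"
  by (rule vec_eqI, rule coeffs_eqI, case_tac i;
    simp add: mu_eq power2_eq_square algebra_simps)+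

lemma act_form_relations: "x \<in> form_relations q \<Longrightarrow> act x w = 0"
  unfolding form_relations_def
  by (elim insertE emptyE; simp only: act_simps rep.simps wedge_relations)

lemma act_cross_relations:
  assumes "x \<in> cross_relations q"
  shows "act x w = 0"
  using assms unfolding cross_relations_def
  by (elim UN_E insertE emptyE;
    simp only: case_prod_conv prod.inject act_simps rep.simps L_linear rep_cross_relations diff_self inverse_q;
    elim insertE emptyE;
    simp only: case_prod_conv prod.inject act_simps rep.simps L_linear rep_cross_relations diff_self inverse_q)

section \<open>Exponents modulo r and the power relations\<close>

lemma p_power [simp]: "p ^ r = 1"
  by (simp add: p_def power_inverse q_power)

lemma powi_period: "q powi (m + int r) = q powi m" "q powi (m - int r) = q powi m"
  by (simp_all add: power_int_add power_int_diff q_power)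

text \<open>The span of the monomials with exponents in range. The power relations fail on arbitrary
  coefficient functions, so the relation ideal is shown to act by zero on these only.\<close>

definition admissible :: "coeffs set" where
  "admissible = {f. (\<forall>m n k. f (m + int r) n k = f m n k) \<and>
    (\<forall>m n k. f m n k \<noteq> 0 \<longrightarrow> 0 \<le> n \<and> n < int r \<and> 0 \<le> k \<and> k < int r)}"

lemma admissible_period: "f \<in> admissible \<Longrightarrow> f (m + int r) n k = f m n k"
  by (simp add: admissible_def)

lemma admissible_outside:
  "f \<in> admissible \<Longrightarrow> n < 0 \<or> n \<ge> int r \<or> k < 0 \<or> k \<ge> int r \<Longrightarrow> f m n k = 0"
  unfolding admissible_def by force

lemma admissibleI:
  assumes "\<And>m n k. f (m + int r) n k = f m n k"
    and "\<And>m n k. n < 0 \<or> n \<ge> int r \<or> k < 0 \<or> k \<ge> int r \<Longrightarrow> f m n k = 0"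
  shows "f \<in> admissible"
proof -
  have "0 \<le> n \<and> n < int r \<and> 0 \<le> k \<and> k < int r" if "f m n k \<noteq> 0" for m n k
    using assms(2)[of n k m] that by linarith
  then show ?thesis using assms(1) by (simp add: admissible_def)
qed

lemma admissible_period': "f \<in> admissible \<Longrightarrow> f (m - int r) n k = f m n k"
  using admissible_period[of f "m - int r"] by simp

lemma admissible_subspace: "coeffs.subspace admissible"
  unfolding coeffs.subspace_def
  by (auto intro!: admissibleI simp: admissible_period admissible_outside)

lemmas admissible_closed [simp] =
  coeffs.subspace_0[OF admissible_subspace] coeffs.subspace_add[OF admissible_subspace]
  coeffs.subspace_scale[OF admissible_subspace] coeffs.subspace_diff[OF admissible_subspace]
  coeffs.subspace_neg[OF admissible_subspace]

lemma powi_period_double: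
  "q powi (2 * m + 2 * int r + 1) = q powi (2 * m + 1)"
  using powi_period(1)[of "2 * m + 1"] powi_period(1)[of "2 * m + 1 + int r"]
  by (simp add: algebra_simps)

lemma L_admissible [simp]:
  assumes "f \<in> admissible"
  shows "La f \<in> admissible" "Lb f \<in> admissible" "Lc f \<in> admissible" "Ld f \<in> admissible"
proof -
  note simps = admissible_outside[OF assms] powi_period powi_period_double distrib_left
  have shift: "f (m + int r - 1) n k = f (m - 1) n k" "f (m + int r + 1) n k = f (m + 1) n k" for m n k
    using admissible_period[OF assms, of "m - 1"] admissible_period[OF assms, of "m + 1"]
    by (simp_all add: algebra_simps)
  show "La f \<in> admissible"
    by (rule admissibleI) (auto simp: La_def simps shift)
  show "Lb f \<in> admissible"
    by (rule admissibleI) (auto simp: Lb_def simps admissible_period[OF assms])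
  show "Lc f \<in> admissible"
    by (rule admissibleI) (auto simp: Lc_def simps admissible_period[OF assms])
  show "Ld f \<in> admissible"
    by (rule admissibleI) (auto simp: Ld_def simps shift)
qed

definition admissible_vec :: "(form \<Rightarrow> coeffs) set" where
  "admissible_vec = {v. \<forall>i. v i \<in> admissible}"

lemma admissible_vec_subspace: "vec.subspace admissible_vec"
  unfolding vec.subspace_def by (auto simp: admissible_vec_def)

lemma rep_admissible: "v \<in> admissible_vec \<Longrightarrow> rep g v \<in> admissible_vec"
  unfolding admissible_vec_def
  by (intro CollectI allI, case_tac i; cases g) auto

lemma act_admissible: "v \<in> admissible_vec \<Longrightarrow> act x v \<in> admissible_vec"
  by (rule act_in_subspace[OF admissible_vec_subspace]) (auto intro: rep_admissible)

lemma rep_quadratic_relations: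
  "rep Gen_b (rep Gen_a w) = q *\<^sub>F rep Gen_a (rep Gen_b w)"
  "rep Gen_c (rep Gen_a w) = q *\<^sub>F rep Gen_a (rep Gen_c w)"
  "rep Gen_d (rep Gen_b w) = q *\<^sub>F rep Gen_b (rep Gen_d w)"
  "rep Gen_d (rep Gen_c w) = q *\<^sub>F rep Gen_c (rep Gen_d w)"
  "rep Gen_c (rep Gen_b w) = rep Gen_b (rep Gen_c w)"
  "rep Gen_d (rep Gen_a w) = rep Gen_a (rep Gen_d w) + (q * \<mu>) *\<^sub>F rep Gen_b (rep Gen_c w)"
  "rep Gen_a (rep Gen_d w) = p *\<^sub>F rep Gen_b (rep Gen_c w) + w"
  by (rule vec_eqI, rule coeffs_eqI, case_tac i; simp add: L_simps L_relations;
    simp add: mu_eq power2_eq_square algebra_simps)+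

lemma coeffs_linear_L_cases: "(U, V) \<in> {(La, Lc), (Lb, Ld)} \<Longrightarrow> coeffs_linear U \<and> coeffs_linear V"
  by (auto simp: L_linear)

text \<open>A q-analogue of the power rule. Every correction carries q^j - p^j, 1 - p^(2j) or q^(2j)
  - 1, and all of these vanish at j = r, which is what \<open>power_r_wedge\<close> uses. The
  truncated \<open>j - 1\<close> is harmless: at j = 0 its coefficient is zero.\<close>

lemma wedge_power:
  assumes "(U, V) \<in> {(La, Lc), (Lb, Ld)}"
  defines "u \<equiv> rep_u U V" and "v \<equiv> rep_v U V"
  shows "(u ^^ j) (wedge_c w) = wedge_c ((u ^^ j) w)"
    and "(u ^^ j) (wedge_d w) = p ^ j *\<^sub>F wedge_d ((u ^^ j) w)"
    and "(u ^^ j) (wedge_b w) =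
      wedge_b ((u ^^ j) w) + (q * (1 - p ^ j * p ^ j)) *\<^sub>F wedge_d (v ((u ^^ (j - 1)) w))"
    and "(u ^^ j) (wedge_a w) = q ^ j *\<^sub>F wedge_a ((u ^^ j) w)
      + (p * (q ^ j - p ^ j)) *\<^sub>F wedge_c (v ((u ^^ (j - 1)) w))
      + (\<mu> * (q ^ j - p ^ j)) *\<^sub>F wedge_d ((u ^^ j) w)"
    and "(v ^^ j) (wedge_b w) = wedge_b ((v ^^ j) w)"
    and "(v ^^ j) (wedge_d w) = q ^ j *\<^sub>F wedge_d ((v ^^ j) w)"
    and "(v ^^ j) (wedge_c w) =
      wedge_c ((v ^^ j) w) + (p * (q ^ j * q ^ j - 1)) *\<^sub>F wedge_d (u ((v ^^ (j - 1)) w))"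
    and "(v ^^ j) (wedge_a w) = p ^ j *\<^sub>F wedge_a ((v ^^ j) w)
      + (p * (q ^ j - p ^ j)) *\<^sub>F wedge_b (u ((v ^^ (j - 1)) w))"
proof -
  have UV: "coeffs_linear U" "coeffs_linear V"
    using coeffs_linear_L_cases[OF assms(1)] by auto
  have vu: "v (u x) = q *\<^sub>F u (v x)" for x
    using assms(1) rep_quadratic_relations(2,3)[of x] by (auto simp: u_def v_def)
  have uv: "u (v x) = p *\<^sub>F v (u x)" for x
    by (simp add: vu)
  note cross = rep_cross_relations[OF UV, folded u_def v_def]
  note lin = rep_u_linear[OF UV, folded u_def v_def] wedge_linear
  note arith = mu_eq power2_eq_square algebra_simps
  show "(u ^^ j) (wedge_c w) = wedge_c ((u ^^ j) w)"
    by (induction j) (simp_all add: cross)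
  show "(v ^^ j) (wedge_b w) = wedge_b ((v ^^ j) w)"
    by (induction j) (simp_all add: cross)
  show "(u ^^ j) (wedge_d w) = p ^ j *\<^sub>F wedge_d ((u ^^ j) w)"
  proof (induction j)
    case (Suc j)
    show ?case
      by (simp only: funpow.simps o_apply Suc.IH lin cross vec.scale_scale power_Suc mult.commute)
  qed simp
  show "(v ^^ j) (wedge_d w) = q ^ j *\<^sub>F wedge_d ((v ^^ j) w)"
  proof (induction j)
    case (Suc j)
    show ?case
      by (simp only: funpow.simps o_apply Suc.IH lin cross vec.scale_scale power_Suc mult.commute)
  qed simp
  show "(u ^^ j) (wedge_b w) =
      wedge_b ((u ^^ j) w) + (q * (1 - p ^ j * p ^ j)) *\<^sub>F wedge_d (v ((u ^^ (j - 1)) w))"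
  proof (induction j)
    case (Suc j)
    show ?case
      unfolding funpow.simps o_apply Suc.IH
      by (cases j; simp add: cross lin uv; intro vec_eqI coeffs_eqI; simp add: arith)
  qed simp
  show "(u ^^ j) (wedge_a w) = q ^ j *\<^sub>F wedge_a ((u ^^ j) w)
      + (p * (q ^ j - p ^ j)) *\<^sub>F wedge_c (v ((u ^^ (j - 1)) w))
      + (\<mu> * (q ^ j - p ^ j)) *\<^sub>F wedge_d ((u ^^ j) w)"
  proof (induction j)
    case (Suc j)
    show ?case
      unfolding funpow.simps o_apply Suc.IH
      by (cases j; simp add: cross lin uv; intro vec_eqI coeffs_eqI; simp add: arith)
  qed simp
  show "(v ^^ j) (wedge_c w) =
      wedge_c ((v ^^ j) w) + (p * (q ^ j * q ^ j - 1)) *\<^sub>F wedge_d (u ((v ^^ (j - 1)) w))"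
  proof (induction j)
    case (Suc j)
    show ?case
      unfolding funpow.simps o_apply Suc.IH
      by (cases j; simp add: cross lin vu; intro vec_eqI coeffs_eqI; simp add: arith)
  qed simp
  show "(v ^^ j) (wedge_a w) = p ^ j *\<^sub>F wedge_a ((v ^^ j) w)
      + (p * (q ^ j - p ^ j)) *\<^sub>F wedge_b (u ((v ^^ (j - 1)) w))"
  proof (induction j)
    case (Suc j)
    show ?case
      unfolding funpow.simps o_apply Suc.IH
      by (cases j; simp add: cross lin vu; intro vec_eqI coeffs_eqI; simp add: arith)
  qed simp
qed

lemma power_r_wedge:
  assumes "g \<in> {Gen_a, Gen_b, Gen_c, Gen_d}" "h \<in> {Form_a, Form_b, Form_c, Form_d}"
  shows "(rep g ^^ r) (rep h w) = rep h ((rep g ^^ r) w)"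
  using assms wedge_power[of La Lc r w] wedge_power[of Lb Ld r w] by (auto simp: q_power)

definition of_coeffs :: "coeffs \<Rightarrow> form \<Rightarrow> coeffs" where
  "of_coeffs f = (\<lambda>i. if i = F1 then f else 0)"

lemma of_coeffs_simps [simp]: "of_coeffs f F1 = f" "i \<noteq> F1 \<Longrightarrow> of_coeffs f i = 0"
  by (simp_all add: of_coeffs_def)

lemma vec_decompose:
  "v = of_coeffs (v F1) + wedge_a (of_coeffs (v Fa)) + wedge_b (of_coeffs (v Fb))
    + wedge_c (of_coeffs (v Fc)) + wedge_d (of_coeffs (v Fd))
    + wedge_b (wedge_a (of_coeffs (v Fba))) + wedge_c (wedge_a (of_coeffs (v Fca)))
    + wedge_d (wedge_a (of_coeffs (v Fda))) + wedge_b (wedge_c (of_coeffs (v Fbc)))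
    + wedge_b (wedge_d (of_coeffs (v Fbd))) + wedge_c (wedge_d (of_coeffs (v Fcd)))"
  by (rule vec_eqI, rule coeffs_eqI, case_tac i; simp)

text \<open>Every vector is a sum of forms times functions, and r-th powers of the function
  generators commute with the forms. Hence the power relations have to be checked on functions
  only.\<close>

lemma power_r_eq_scale:
  assumes g: "g \<in> {Gen_a, Gen_b, Gen_c, Gen_d}"
    and base: "\<And>f. f \<in> admissible \<Longrightarrow> (rep g ^^ r) (of_coeffs f) = z *\<^sub>F of_coeffs f"
    and v: "v \<in> admissible_vec"
  shows "(rep g ^^ r) v = z *\<^sub>F v"
proof -
  have lin: "(rep g ^^ r) (x + y) = (rep g ^^ r) x + (rep g ^^ r) y" for x y
    using act.add[of "gen g ^ r" x y] by (simp add: act_power)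
  note comm = power_r_wedge[OF g, of Form_a, simplified] power_r_wedge[OF g, of Form_b, simplified]
    power_r_wedge[OF g, of Form_c, simplified] power_r_wedge[OF g, of Form_d, simplified]
  have "v i \<in> admissible" for i
    using v by (simp add: admissible_vec_def)
  then show ?thesis
    by (subst (1 2) vec_decompose[of v])
      (simp add: lin comm base wedge_linear vec.scale_right_distrib)
qed

lemma rep_power_of_coeffs:
  assumes "coeffs_linear U" "coeffs_linear V"
  shows "(rep_u U V ^^ j) (of_coeffs f) = of_coeffs ((U ^^ j) f)"
    "(rep_v U V ^^ j) (of_coeffs f) = of_coeffs ((V ^^ j) f)"
proof -
  note lin = coeffs_linearD[OF assms(1)] coeffs_linearD[OF assms(2)]
  have u: "rep_u U V (of_coeffs f) = of_coeffs (U f)"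
    and v: "rep_v U V (of_coeffs f) = of_coeffs (V f)" for f
    by (rule vec_eqI, rule coeffs_eqI, case_tac i; simp add: lin)+
  show "(rep_u U V ^^ j) (of_coeffs f) = of_coeffs ((U ^^ j) f)"
    "(rep_v U V ^^ j) (of_coeffs f) = of_coeffs ((V ^^ j) f)"
    by (induction j) (simp_all add: u v)
qed

lemma La_power: "(La ^^ j) f = (\<lambda>m n k. f (m - int j) n k)"
  by (induction j) (simp_all add: La_def algebra_simps)

lemma La_power_r: "f \<in> admissible \<Longrightarrow> (La ^^ r) f = f"
  by (simp add: La_power admissible_period')

text \<open>Multiplication by b^j pushes the support to n at least j, and for j = r no exponent in
  range is left.\<close>

lemma Lb_power_r:
  assumes "f \<in> admissible"
  shows "(Lb ^^ r) f = 0"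
proof -
  have adm: "(Lb ^^ j) f \<in> admissible" for j
    by (induction j) (simp_all add: assms)
  have "(Lb ^^ j) f m n k = 0" if "n < int j" for j m n k
    using that by (induction j arbitrary: n) (simp_all add: Lb_def admissible_outside[OF assms])
  then have "(Lb ^^ r) f m n k = 0" for m n k
    using admissible_outside[OF adm] by (cases "n < int r") auto
  then show ?thesis by (intro coeffs_eqI) simp
qed

lemma Lc_power_r:
  assumes "f \<in> admissible"
  shows "(Lc ^^ r) f = 0"
proof -
  have adm: "(Lc ^^ j) f \<in> admissible" for j
    by (induction j) (simp_all add: assms)
  have "(Lc ^^ j) f m n k = 0" if "k < int j" for j m n k
    using that by (induction j arbitrary: k) (simp_all add: Lc_def admissible_outside[OF assms])
  then have "(Lc ^^ r) f m n k = 0" for m n k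
    using admissible_outside[OF adm] by (cases "k < int r") auto
  then show ?thesis by (intro coeffs_eqI) simp
qed

text \<open>
  Up to a power of \<open>q\<close>, the coefficient of \<open>a\<^bsup>-j\<^esup> (b c)\<^sup>i\<close> in \<open>d\<^sup>j\<close>. Comparing left and right
  multiplication by \<open>d\<close> shows that it vanishes for \<open>j = r\<close> and \<open>0 < i < r\<close>.
\<close>

fun d_coeff :: "nat \<Rightarrow> nat \<Rightarrow> complex" where
  "d_coeff 0 i = (if i = 0 then 1 else 0)"
| "d_coeff (Suc j) 0 = d_coeff j 0"
| "d_coeff (Suc j) (Suc i) = q ^ (2 * i + 2) * d_coeff j (Suc i) + q ^ (2 * i + 1) * d_coeff j i"

text \<open>\<open>d_coeff j i\<close> is q^(i^2) times the Gaussian binomial coefficient of j over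
  i in the variable q^2. The defining recursion and this one are its two Pascal rules.\<close>

lemma d_coeff_right: "d_coeff (Suc j) (Suc i) = d_coeff j (Suc i) + q ^ (2 * j + 1) * d_coeff j i"
proof (induction j arbitrary: i)
  case 0
  then show ?case by simp
next
  case (Suc j)
  show ?case
  proof (cases i)
    case 0
    have "d_coeff (Suc (Suc j)) 1 = q * q * d_coeff (Suc j) 1 + q * d_coeff (Suc j) 0"
      by (simp add: power2_eq_square)
    also have "\<dots> = q * q * (d_coeff j 1 + q ^ (2 * j + 1) * d_coeff j 0) + q * d_coeff j 0"
      using Suc[of 0] by simp
    finally show ?thesis using 0 by (simp add: algebra_simps power2_eq_square)
  next
    case (Suc i')
    have "d_coeff (Suc (Suc j)) (Suc i) =
        q ^ (2 * i + 2) * d_coeff (Suc j) (Suc i) + q ^ (2 * i + 1) * d_coeff (Suc j) i"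
      by simp
    also have "\<dots> = q ^ (2 * i + 2) * (d_coeff j (Suc i) + q ^ (2 * j + 1) * d_coeff j i)
        + q ^ (2 * i + 1) * (d_coeff j i + q ^ (2 * j + 1) * d_coeff j i')"
      using Suc Suc.IH[of i] Suc.IH[of i'] by (simp del: d_coeff.simps)
    finally show ?thesis
      using Suc by (simp add: algebra_simps power_add power2_eq_square)
  qed
qed

lemma d_coeff_zero [simp]: "d_coeff j 0 = 1"
  by (induction j) simp_all

lemma d_coeff_above: "j < i \<Longrightarrow> d_coeff j i = 0"
proof (induction j arbitrary: i)
  case (Suc j)
  then show ?case by (cases i) simp_all
qed simp

text \<open>Oddness of r makes q^2 a primitive r-th root of unity again: one of 2i and 2i - r lies
  strictly between 0 and r.\<close>

lemma q_power_even: "0 < i \<Longrightarrow> i < r \<Longrightarrow> q ^ (2 * i) \<noteq> 1"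
proof
  assume i: "0 < i" "i < r" and q: "q ^ (2 * i) = 1"
  show False
  proof (cases "2 * i < r")
    case True
    then show ?thesis using q_primitive[of "2 * i"] i q by simp
  next
    case False
    then have "q ^ (2 * i) = q ^ (2 * i - r) * q ^ r"
      by (simp flip: power_add)
    moreover have "2 * i \<noteq> r" using r_odd by auto
    ultimately show ?thesis using q_primitive[of "2 * i - r"] i q q_power False by simp
  qed
qed

text \<open>At j = r the two Pascal rules have equal lower terms, by induction and because q^(2r+1)
  = q. They then differ only in the factor q^(2i+2) of the new coefficient, and this factor is not
  1.\<close>

lemma d_coeff_r: "0 < i \<Longrightarrow> i < r \<Longrightarrow> d_coeff r i = 0"
proof (induction i)
  case (Suc i)
  have "q ^ (2 * r + 1) = q"
    by (simp add: power_mult q_power power_add mult.commute[of 2])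
  then have "q ^ (2 * Suc i) * d_coeff r (Suc i) + q ^ (2 * i + 1) * d_coeff r i
      = d_coeff r (Suc i) + q * d_coeff r i"
    using d_coeff_right[of r i] by simp
  moreover have "q ^ (2 * i + 1) * d_coeff r i = q * d_coeff r i"
    using Suc by (cases "i = 0") simp_all
  moreover have "(x - 1) * y = 0" if "x * y + z = y + z'" "z = z'" for x y z z' :: complex
    using that by (simp add: algebra_simps)
  ultimately have "(q ^ (2 * Suc i) - 1) * d_coeff r (Suc i) = 0"
    by blast
  then show ?case using q_power_even[of "Suc i"] Suc.prems by auto
qed simp

text \<open>The power \<open>q powi (2 * m * int i)\<close> results from moving (b c)^i past a^m.
  The bounds on \<open>n\<close> and \<open>k\<close> persist along the recursion because these
  indices only decrease.\<close>

lemma Ld_power: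
  assumes f: "f \<in> admissible" and nk: "n < int r" "k < int r"
  shows "(Ld ^^ j) f m n k =
    (\<Sum>i\<le>j. q powi (2 * m * int i) * d_coeff j i * f (m + int j) (n - int i) (k - int i))"
  using nk
proof (induction j arbitrary: m n k)
  case (Suc j)
  define F where "F i = f (m + int (Suc j)) (n - int i) (k - int i)" for i
  define G where "G i = q powi (2 * m * int i) * d_coeff (Suc j) i * F i" for i
  have shift: "m + 1 + int j = m + int (Suc j)" "n - 1 - int i = n - int (Suc i)"
    "k - 1 - int i = k - int (Suc i)" for i by simp_all
  have e1: "q powi (2 * (m + 1) * int (Suc i)) = q powi (2 * m * int (Suc i)) * q ^ (2 * i + 2)" for i
  proof -
    have "2 * (m + 1) * int (Suc i) = 2 * m * int (Suc i) + int (2 * i + 2)"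
      by (simp add: algebra_simps)
    then show ?thesis by (simp only: powi_add power_int_of_nat)
  qed
  have e2: "q powi (2 * m + 1) * q powi (2 * (m + 1) * int i) =
      q powi (2 * m * int (Suc i)) * q ^ (2 * i + 1)" for i
  proof -
    have "2 * m + 1 + 2 * (m + 1) * int i = 2 * m * int (Suc i) + int (2 * i + 1)"
      by (simp add: algebra_simps)
    then show ?thesis by (simp only: powi_add[symmetric] power_int_of_nat[symmetric])
  qed
  \<comment> \<open>The recursion of \<open>d_coeff\<close>; its factors q^(2i+2) and q^(2i+1) arise
    from the shift of m to m + 1.\<close>
  have step: "q powi (2 * (m + 1) * int (Suc i)) * d_coeff j (Suc i) * F (Suc i)
      + q powi (2 * m + 1) * (q powi (2 * (m + 1) * int i) * d_coeff j i * F (Suc i)) = G (Suc i)" for i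
    unfolding G_def d_coeff.simps e1 mult.assoc[symmetric] e2 by (simp only: algebra_simps)
  have "(Ld ^^ j) f (m + 1) n k = (\<Sum>i\<le>j. q powi (2 * (m + 1) * int i) * d_coeff j i * F i)"
    using Suc.IH[of n k "m + 1"] Suc.prems by (simp only: F_def shift)
  also have "\<dots> = (\<Sum>i\<le>Suc j. q powi (2 * (m + 1) * int i) * d_coeff j i * F i)"
    unfolding sum.atMost_Suc by (simp only: d_coeff_above lessI mult_zero_left mult_zero_right add_0_right)
  also have "\<dots> = G 0 + (\<Sum>i\<le>j. q powi (2 * (m + 1) * int (Suc i)) * d_coeff j (Suc i) * F (Suc i))"
    unfolding sum.atMost_Suc_shift G_def by simp
  finally have 1: "(Ld ^^ j) f (m + 1) n k =
    G 0 + (\<Sum>i\<le>j. q powi (2 * (m + 1) * int (Suc i)) * d_coeff j (Suc i) * F (Suc i))" .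
  have "n - 1 < int r" "k - 1 < int r"
    using Suc.prems by simp_all
  then have 2: "q powi (2 * m + 1) * (Ld ^^ j) f (m + 1) (n - 1) (k - 1) =
      (\<Sum>i\<le>j. q powi (2 * m + 1) * (q powi (2 * (m + 1) * int i) * d_coeff j i * F (Suc i)))"
    using Suc.IH[of "n - 1" "k - 1" "m + 1"] by (simp only: F_def shift sum_distrib_left)
  have "(Ld ^^ Suc j) f m n k =
      (Ld ^^ j) f (m + 1) n k + q powi (2 * m + 1) * (Ld ^^ j) f (m + 1) (n - 1) (k - 1)"
    using Suc.prems by (simp add: Ld_def)
  also have "\<dots> = G 0 + (\<Sum>i\<le>j. G (Suc i))"
    unfolding 1 2 by (simp only: add.assoc sum.distrib[symmetric] step)
  also have "\<dots> = (\<Sum>i\<le>Suc j. G i)"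
    by (simp only: sum.atMost_Suc_shift)
  finally show ?case by (simp only: G_def F_def)
qed simp

lemma Ld_power_r:
  assumes f: "f \<in> admissible"
  shows "(Ld ^^ r) f = f"
proof (rule coeffs_eqI)
  fix m n k
  have adm: "(Ld ^^ j) f \<in> admissible" for j
    by (induction j) (simp_all add: f)
  show "(Ld ^^ r) f m n k = f m n k"
  proof (cases "n < int r \<and> k < int r")
    case True
    have "(Ld ^^ r) f m n k =
        (\<Sum>i\<le>r. q powi (2 * m * int i) * d_coeff r i * f (m + int r) (n - int i) (k - int i))"
      using True by (intro Ld_power f) auto
    \<comment> \<open>The terms with 0 < i < r vanish by \<open>d_coeff_r\<close>; for i = r the
      exponent n - r is negative.\<close>
    also have "\<dots> = (\<Sum>i\<in>{0}. q powi (2 * m * int i) * d_coeff r i * f (m + int r) (n - int i) (k - int i))"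
    proof (rule sum.mono_neutral_right)
      show "\<forall>i\<in>{..r} - {0}. q powi (2 * m * int i) * d_coeff r i * f (m + int r) (n - int i) (k - int i) = 0"
        using d_coeff_r admissible_outside[OF f] True by (auto simp: le_less)
    qed auto
    finally show ?thesis by (simp add: admissible_period[OF f])
  next
    case False
    then show ?thesis
      using admissible_outside[OF f] admissible_outside[OF adm] by auto
  qed
qed

lemma act_power_relations:
  assumes "v \<in> admissible_vec"
  shows "(rep Gen_a ^^ r) v = v" "(rep Gen_b ^^ r) v = 0" "(rep Gen_c ^^ r) v = 0"
    "(rep Gen_d ^^ r) v = v"
proof -
  have 0: "of_coeffs 0 = 0"
    by (rule ext) (simp add: of_coeffs_def)
  note base = rep_power_of_coeffs[OF L_linear(1,3)] rep_power_of_coeffs[OF L_linear(2,4)]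
  show "(rep Gen_a ^^ r) v = v"
    using power_r_eq_scale[of Gen_a 1 v] assms by (simp add: base La_power_r)
  show "(rep Gen_b ^^ r) v = 0"
    using power_r_eq_scale[of Gen_b 0 v] assms by (simp add: base Lb_power_r 0)
  show "(rep Gen_c ^^ r) v = 0"
    using power_r_eq_scale[of Gen_c 0 v] assms by (simp add: base Lc_power_r 0)
  show "(rep Gen_d ^^ r) v = v"
    using power_r_eq_scale[of Gen_d 1 v] assms by (simp add: base Ld_power_r)
qed

lemma act_function_relations:
  assumes "x \<in> function_relations q r" "v \<in> admissible_vec"
  shows "act x v = 0"
  using assms(1) unfolding function_relations_def
  by (elim insertE emptyE;
    simp only: act_simps rep_quadratic_relations act_power_relations[OF assms(2)] inverse_q; simp)

text \<open>The elements that kill \<open>admissible_vec\<close> form a two-sided ideal because this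
  space is stable under the action; it contains the relations, hence the ideal they
  generate.\<close>

lemma act_relation_ideal:
  assumes "x \<in> relation_ideal q r" "v \<in> admissible_vec"
  shows "act x v = 0"
proof -
  let ?K = "{x. \<forall>v\<in>admissible_vec. act x v = 0}"
  have inv: "inv\<^bsub>add_monoid (class_ring :: free_algebra ring)\<^esub> x = - x" for x
  proof -
    have "\<ominus>\<^bsub>class_ring :: free_algebra ring\<^esub> x = - x"
      by (simp add: class_ring_simps)
    then show ?thesis unfolding a_inv_def .
  qed
  have "subgroup ?K (add_monoid (class_ring :: free_algebra ring))"
  proof
    show "inv\<^bsub>add_monoid (class_ring :: free_algebra ring)\<^esub> x \<in> ?K" if "x \<in> ?K" for x
      unfolding inv using that by (simp add: act_uminus)
  qed (auto simp: act_simps)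
  then have "ideal ?K class_ring"
    by (intro idealI class_ring.ring_axioms) (auto simp: act_simps act_admissible)
  moreover have "relations q r \<subseteq> ?K"
    by (auto simp: relations_def act_function_relations act_form_relations act_cross_relations)
  ultimately show ?thesis
    using relation_ideal_minimal assms by blast
qed

lemma cong_act: "cong q r x y \<Longrightarrow> v \<in> admissible_vec \<Longrightarrow> act x v = act y v"
  using act_relation_ideal[of "x - y" v] by (simp add: cong_def act_diff)

section \<open>Normal forms\<close>

abbreviation congr :: "free_algebra \<Rightarrow> free_algebra \<Rightarrow> bool"  (infix \<open>\<approx>\<^sub>\<Omega>\<close> 50) where
  "x \<approx>\<^sub>\<Omega> y \<equiv> cong q r x y"

definition row :: "coeffs \<Rightarrow> int \<Rightarrow> free_algebra" where
  "row f m = (\<Sum>n<r. \<Sum>k<r. scalar (f m (int n) (int k)) * (x\<^sub>b ^ n * x\<^sub>c ^ k))"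

definition nf :: "coeffs \<Rightarrow> free_algebra" where
  "nf f = (\<Sum>m<r. x\<^sub>a ^ m * row f (int m))"

lemma row_add: "row (f + g) m = row f m + row g m"
  by (simp add: row_def scalar_add distrib_right sum.distrib)

lemma row_scale: "row (z *\<^sub>A f) m = scalar z * row f m"
  by (simp add: row_def scalar_mult sum_distrib_left mult.assoc)

lemma nf_add: "nf (f + g) = nf f + nf g"
  by (simp add: nf_def row_add distrib_left sum.distrib)

lemma nf_scale: "nf (z *\<^sub>A f) = scalar z * nf f"
  by (simp add: nf_def row_scale sum_distrib_left scalar_left_commute)

lemma nf_zero [simp]: "nf 0 = 0"
  using nf_scale[of 0 0] by simp

lemma nf_uminus: "nf (- f) = - nf f"
  using nf_scale[of "-1" f] by (simp add: scalar_uminus)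

lemma nf_diff: "nf (f - g) = nf f - nf g"
  using nf_add[of f "- g"] by (simp add: nf_uminus)

lemma function_congs:
  "x\<^sub>b * x\<^sub>a \<approx>\<^sub>\<Omega> scalar q * x\<^sub>a * x\<^sub>b"
  "x\<^sub>c * x\<^sub>a \<approx>\<^sub>\<Omega> scalar q * x\<^sub>a * x\<^sub>c"
  "x\<^sub>c * x\<^sub>b \<approx>\<^sub>\<Omega> x\<^sub>b * x\<^sub>c"
  "x\<^sub>a * x\<^sub>d \<approx>\<^sub>\<Omega> scalar p * x\<^sub>b * x\<^sub>c + 1"
  "x\<^sub>a ^ r \<approx>\<^sub>\<Omega> 1" "x\<^sub>b ^ r \<approx>\<^sub>\<Omega> 0" "x\<^sub>c ^ r \<approx>\<^sub>\<Omega> 0"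
  by (rule cong_relation, simp add: relations_def function_relations_def diff_diff_eq flip: inverse_q)+

lemma cross_congs:
  assumes "(u, v) \<in> {(x\<^sub>a, x\<^sub>c), (x\<^sub>b, x\<^sub>d)}"
  shows "v * e\<^sub>b \<approx>\<^sub>\<Omega> e\<^sub>b * v"
    "u * e\<^sub>c \<approx>\<^sub>\<Omega> e\<^sub>c * u"
    "u * e\<^sub>d \<approx>\<^sub>\<Omega> scalar p * e\<^sub>d * u"
    "v * e\<^sub>d \<approx>\<^sub>\<Omega> scalar q * e\<^sub>d * v"
    "u * e\<^sub>b \<approx>\<^sub>\<Omega> e\<^sub>b * u + scalar (q * \<mu>) * e\<^sub>d * v"
    "v * e\<^sub>c \<approx>\<^sub>\<Omega> e\<^sub>c * v + scalar (q * \<mu>) * e\<^sub>d * u"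
    "v * e\<^sub>a \<approx>\<^sub>\<Omega> scalar p * e\<^sub>a * v + scalar \<mu> * e\<^sub>b * u"
    "u * e\<^sub>a \<approx>\<^sub>\<Omega> scalar q * e\<^sub>a * u + scalar \<mu> * e\<^sub>c * v + scalar (q * \<mu> ^ 2) * e\<^sub>d * u"
  by (rule cong_relation, use assms in \<open>auto simp: relations_def cross_relations_def simp flip: inverse_q\<close>)+

lemma form_congs:
  "e\<^sub>b * e\<^sub>b \<approx>\<^sub>\<Omega> 0" "e\<^sub>c * e\<^sub>c \<approx>\<^sub>\<Omega> 0" "e\<^sub>d * e\<^sub>d \<approx>\<^sub>\<Omega> 0"
  "e\<^sub>c * e\<^sub>b \<approx>\<^sub>\<Omega> - (e\<^sub>b * e\<^sub>c)"
  "e\<^sub>d * e\<^sub>b \<approx>\<^sub>\<Omega> - (e\<^sub>b * e\<^sub>d)"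
  "e\<^sub>d * e\<^sub>c \<approx>\<^sub>\<Omega> - (e\<^sub>c * e\<^sub>d)"
  "e\<^sub>a * e\<^sub>a \<approx>\<^sub>\<Omega> scalar \<mu> * e\<^sub>b * e\<^sub>c"
  "e\<^sub>a * e\<^sub>d \<approx>\<^sub>\<Omega> - (e\<^sub>d * e\<^sub>a) - scalar \<mu> * e\<^sub>b * e\<^sub>c"
  "e\<^sub>a * e\<^sub>b \<approx>\<^sub>\<Omega> scalar \<mu> * e\<^sub>b * e\<^sub>d - scalar (q ^ 2) * e\<^sub>b * e\<^sub>a"
  "e\<^sub>a * e\<^sub>c \<approx>\<^sub>\<Omega> - (scalar (p ^ 2) * e\<^sub>c * e\<^sub>a) - scalar (p ^ 2 * \<mu>) * e\<^sub>c * e\<^sub>d"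
proof -
  show "e\<^sub>b * e\<^sub>b \<approx>\<^sub>\<Omega> 0" "e\<^sub>c * e\<^sub>c \<approx>\<^sub>\<Omega> 0" "e\<^sub>d * e\<^sub>d \<approx>\<^sub>\<Omega> 0"
    "e\<^sub>a * e\<^sub>a \<approx>\<^sub>\<Omega> scalar \<mu> * e\<^sub>b * e\<^sub>c"
    by (rule cong_relation, simp add: relations_def form_relations_def)+
  show "e\<^sub>c * e\<^sub>b \<approx>\<^sub>\<Omega> - (e\<^sub>b * e\<^sub>c)" "e\<^sub>d * e\<^sub>b \<approx>\<^sub>\<Omega> - (e\<^sub>b * e\<^sub>d)" "e\<^sub>d * e\<^sub>c \<approx>\<^sub>\<Omega> - (e\<^sub>c * e\<^sub>d)"
    "e\<^sub>a * e\<^sub>d \<approx>\<^sub>\<Omega> - (e\<^sub>d * e\<^sub>a) - scalar \<mu> * e\<^sub>b * e\<^sub>c"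
    by (rule cong_relation, simp add: relations_def form_relations_def add.commute)+
  show "e\<^sub>a * e\<^sub>b \<approx>\<^sub>\<Omega> scalar \<mu> * e\<^sub>b * e\<^sub>d - scalar (q ^ 2) * e\<^sub>b * e\<^sub>a"
    by (rule cong_relation) (simp add: relations_def form_relations_def algebra_simps)
  have "e\<^sub>c * e\<^sub>a + scalar (q ^ 2) * e\<^sub>a * e\<^sub>c + scalar \<mu> * e\<^sub>c * e\<^sub>d \<approx>\<^sub>\<Omega> 0"
    by (rule cong_relation) (simp add: relations_def form_relations_def)
  then have "scalar (p ^ 2) * (e\<^sub>c * e\<^sub>a + scalar (q ^ 2) * e\<^sub>a * e\<^sub>c + scalar \<mu> * e\<^sub>c * e\<^sub>d) \<approx>\<^sub>\<Omega> scalar (p ^ 2) * 0"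
    by (intro cong_mult cong_refl)
  moreover have "scalar (p ^ 2) * (scalar (q ^ 2) * e\<^sub>a * e\<^sub>c) = e\<^sub>a * e\<^sub>c"
  proof -
    have "p ^ 2 * q ^ 2 = 1"
      by (simp flip: power_mult_distrib)
    then have "scalar (p ^ 2) * scalar (q ^ 2) = 1"
      by (simp flip: scalar_mult)
    then show ?thesis by (simp flip: mult.assoc)
  qed
  ultimately show "e\<^sub>a * e\<^sub>c \<approx>\<^sub>\<Omega> - (scalar (p ^ 2) * e\<^sub>c * e\<^sub>a) - scalar (p ^ 2 * \<mu>) * e\<^sub>c * e\<^sub>d"
    by (simp add: cong_def distrib_left scalar_mult mult.assoc) (simp add: algebra_simps)
qed

lemma sum_top: "(\<Sum>m<r. g m) = (\<Sum>m<r - 1. g m) + (g (r - 1) :: free_algebra)"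
  using sum.lessThan_Suc[of g "r - 1"] r_ge by simp

lemma sum_bottom: "(\<Sum>m<r. g m) = g 0 + (\<Sum>m<r - 1. g (Suc m) :: free_algebra)"
  using sum.lessThan_Suc_shift[of g "r - 1"] r_ge by simp

lemma Suc_r: "Suc (r - 1) = r"
  using r_ge by simp

text \<open>Multiplication by a shifts the rows cyclically: a^r = 1 carries the top row to row zero,
  and periodicity of \<open>f\<close> identifies row -1 with row r - 1.\<close>

lemma nf_La:
  assumes "f \<in> admissible"
  shows "x\<^sub>a * nf f \<approx>\<^sub>\<Omega> nf (La f)"
proof -
  have row: "row (La f) m = row f (m - 1)" for m
    by (simp add: row_def La_def)
  have "f (- 1) = f (int (r - 1))"
    using admissible_period[OF assms, of "- 1"] r_ge by (intro ext) (simp add: of_nat_diff)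
  then have last: "row f (- 1) = row f (int (r - 1))"
    by (simp add: row_def)
  have "x\<^sub>a * nf f = (\<Sum>m<r. x\<^sub>a ^ Suc m * row f (int m))"
    by (simp add: nf_def sum_distrib_left mult.assoc)
  also have "\<dots> = (\<Sum>m<r - 1. x\<^sub>a ^ Suc m * row f (int m)) + x\<^sub>a ^ r * row f (int (r - 1))"
    by (simp only: sum_top Suc_r)
  also have "\<dots> \<approx>\<^sub>\<Omega> (\<Sum>m<r - 1. x\<^sub>a ^ Suc m * row f (int m)) + 1 * row f (int (r - 1))"
    by (intro cong_add cong_mult cong_refl function_congs)
  also have "\<dots> = nf (La f)"
    by (simp add: nf_def sum_bottom row last del: power_Suc)
  finally show ?thesis .
qed

lemma power_shift:
  assumes "y * x \<approx>\<^sub>\<Omega> scalar z * x * y"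
  shows "y * x ^ m \<approx>\<^sub>\<Omega> scalar (z ^ m) * (x ^ m * y)"
proof (induction m)
  case (Suc m)
  have "y * x ^ Suc m = (y * x) * x ^ m"
    by (simp add: mult.assoc)
  also have "\<dots> \<approx>\<^sub>\<Omega> (scalar z * x * y) * x ^ m"
    by (intro cong_mult cong_refl assms)
  also have "\<dots> = scalar z * (x * (y * x ^ m))"
    by (simp add: mult.assoc)
  also have "\<dots> \<approx>\<^sub>\<Omega> scalar z * (x * (scalar (z ^ m) * (x ^ m * y)))"
    by (intro cong_mult cong_refl Suc.IH)
  also have "\<dots> = scalar (z ^ Suc m) * (x ^ Suc m * y)"
    by (simp only: scalar_mult mult.assoc scalar_left_commute[of x "z ^ m"] power_Suc)
  finally show ?case .
qed simp

lemma row_Lb: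
  assumes "f \<in> admissible"
  shows "scalar (q ^ m) * (x\<^sub>b * row f (int m)) \<approx>\<^sub>\<Omega> row (Lb f) (int m)"
proof -
  define G where "G n = (\<Sum>k<r. scalar (f (int m) (int n) (int k)) * x\<^sub>c ^ k)" for n
  define H where "H n = (\<Sum>k<r. scalar (Lb f (int m) (int n) (int k)) * (x\<^sub>b ^ n * x\<^sub>c ^ k))" for n
  have H0: "H 0 = 0"
    by (simp add: H_def Lb_def admissible_outside[OF assms])
  have H_Suc: "H (Suc n) = scalar (q ^ m) * (x\<^sub>b ^ Suc n * G n)" if "n < r - 1" for n
  proof -
    have "int (Suc n) < int r" using that by linarith
    then show ?thesis
      by (simp add: H_def G_def Lb_def sum_distrib_left scalar_mult mult.assoc
          scalar_left_commute[of "_ ^ _"] scalar_left_commute[of "gen _"] del: power_Suc)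
  qed
  have "x\<^sub>b * row f (int m) = (\<Sum>n<r. x\<^sub>b ^ Suc n * G n)"
    by (simp add: row_def G_def sum_distrib_left mult.assoc scalar_left_commute)
  also have "\<dots> = (\<Sum>n<r - 1. x\<^sub>b ^ Suc n * G n) + x\<^sub>b ^ r * G (r - 1)"
    by (simp only: sum_top Suc_r)
  also have "\<dots> \<approx>\<^sub>\<Omega> (\<Sum>n<r - 1. x\<^sub>b ^ Suc n * G n) + 0 * G (r - 1)"
    by (intro cong_add cong_mult cong_refl function_congs)
  finally have "scalar (q ^ m) * (x\<^sub>b * row f (int m)) \<approx>\<^sub>\<Omega> scalar (q ^ m) * (\<Sum>n<r - 1. x\<^sub>b ^ Suc n * G n)"
    by (intro cong_mult cong_refl) simp
  also have "\<dots> = (\<Sum>n<r - 1. H (Suc n))"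
    unfolding sum_distrib_left by (intro sum.cong refl) (simp add: H_Suc del: power_Suc)
  also have "\<dots> = (\<Sum>n<r. H n)"
    by (simp add: sum_bottom H0)
  finally show ?thesis by (simp add: H_def row_def)
qed

lemma row_Lc:
  assumes "f \<in> admissible"
  shows "scalar (q ^ m) * (x\<^sub>c * row f (int m)) \<approx>\<^sub>\<Omega> row (Lc f) (int m)"
proof -
  define G where "G n k = scalar (f (int m) (int n) (int k)) * x\<^sub>b ^ n" for n k
  define H where "H n k = scalar (Lc f (int m) (int n) (int k)) * (x\<^sub>b ^ n * x\<^sub>c ^ k)" for n k
  have H0: "H n 0 = 0" for n
    by (simp add: H_def Lc_def admissible_outside[OF assms])
  have H_Suc: "H n (Suc k) = scalar (q ^ m) * (G n k * x\<^sub>c ^ Suc k)" if "k < r - 1" for n k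
  proof -
    have "int (Suc k) < int r" using that by linarith
    then show ?thesis by (simp add: H_def G_def Lc_def scalar_mult mult.assoc del: power_Suc)
  qed
  have cb: "x\<^sub>c * x\<^sub>b ^ n \<approx>\<^sub>\<Omega> x\<^sub>b ^ n * x\<^sub>c" for n
    using power_shift[of "x\<^sub>c" "x\<^sub>b" 1 n] function_congs(3) by simp
  have top: "(\<Sum>k<r. G n k * x\<^sub>c ^ Suc k) = (\<Sum>k<r - 1. G n k * x\<^sub>c ^ Suc k) + G n (r - 1) * x\<^sub>c ^ r" for n
    by (simp only: sum_top Suc_r)
  have bottom: "(\<Sum>k<r. H n k) = (\<Sum>k<r - 1. H n (Suc k))" for n
    by (simp only: sum_bottom H0 add_0_left)
  have "x\<^sub>c * row f (int m) =
      (\<Sum>n<r. \<Sum>k<r. scalar (f (int m) (int n) (int k)) * ((x\<^sub>c * x\<^sub>b ^ n) * x\<^sub>c ^ k))"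
    by (simp add: row_def sum_distrib_left mult.assoc scalar_left_commute)
  also have "\<dots> \<approx>\<^sub>\<Omega> (\<Sum>n<r. \<Sum>k<r. scalar (f (int m) (int n) (int k)) * ((x\<^sub>b ^ n * x\<^sub>c) * x\<^sub>c ^ k))"
    by (intro cong_sum cong_mult cong_refl cb)
  also have "\<dots> = (\<Sum>n<r. \<Sum>k<r. G n k * x\<^sub>c ^ Suc k)"
    by (simp add: G_def mult.assoc)
  also have "\<dots> = (\<Sum>n<r. (\<Sum>k<r - 1. G n k * x\<^sub>c ^ Suc k) + G n (r - 1) * x\<^sub>c ^ r)"
    by (simp only: top)
  also have "\<dots> \<approx>\<^sub>\<Omega> (\<Sum>n<r. (\<Sum>k<r - 1. G n k * x\<^sub>c ^ Suc k) + G n (r - 1) * 0)"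
    by (intro cong_sum cong_add cong_mult cong_refl function_congs)
  finally have "scalar (q ^ m) * (x\<^sub>c * row f (int m)) \<approx>\<^sub>\<Omega>
      scalar (q ^ m) * (\<Sum>n<r. \<Sum>k<r - 1. G n k * x\<^sub>c ^ Suc k)"
    by (intro cong_mult cong_refl) simp
  also have "\<dots> = (\<Sum>n<r. \<Sum>k<r - 1. H n (Suc k))"
    unfolding sum_distrib_left by (intro sum.cong refl) (simp add: H_Suc del: power_Suc)
  also have "\<dots> = (\<Sum>n<r. \<Sum>k<r. H n k)"
    by (simp only: bottom)
  finally show ?thesis by (simp add: H_def row_def)
qed

lemma nf_shift:
  assumes "y * x\<^sub>a \<approx>\<^sub>\<Omega> scalar q * x\<^sub>a * y"
    and "\<And>m. scalar (q ^ m) * (y * row f (int m)) \<approx>\<^sub>\<Omega> row g (int m)"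
  shows "y * nf f \<approx>\<^sub>\<Omega> nf g"
proof -
  have "y * nf f = (\<Sum>m<r. (y * x\<^sub>a ^ m) * row f (int m))"
    by (simp add: nf_def sum_distrib_left mult.assoc)
  also have "\<dots> \<approx>\<^sub>\<Omega> (\<Sum>m<r. (scalar (q ^ m) * (x\<^sub>a ^ m * y)) * row f (int m))"
    by (intro cong_sum cong_mult cong_refl power_shift assms)
  also have "\<dots> = (\<Sum>m<r. x\<^sub>a ^ m * (scalar (q ^ m) * (y * row f (int m))))"
    by (simp add: mult.assoc scalar_left_commute[of "_ ^ _"])
  also have "\<dots> \<approx>\<^sub>\<Omega> nf g"
    unfolding nf_def by (intro cong_sum cong_mult cong_refl assms)
  finally show ?thesis .
qed

lemma nf_Lb: "f \<in> admissible \<Longrightarrow> x\<^sub>b * nf f \<approx>\<^sub>\<Omega> nf (Lb f)"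
  and nf_Lc: "f \<in> admissible \<Longrightarrow> x\<^sub>c * nf f \<approx>\<^sub>\<Omega> nf (Lc f)"
  by (rule nf_shift; simp add: function_congs row_Lb row_Lc)+

text \<open>As a^r = 1, the generator d equals a^(r-1) (a d), and a d = 1 + p b c reduces the claim
  to the other three generators.\<close>

lemma nf_Ld:
  assumes f: "f \<in> admissible"
  shows "x\<^sub>d * nf f \<approx>\<^sub>\<Omega> nf (Ld f)"
proof -
  obtain s where s: "r = Suc s" using r_ge by (cases r) auto
  have La_s: "x\<^sub>a ^ j * nf g \<approx>\<^sub>\<Omega> nf ((La ^^ j) g) \<and> (La ^^ j) g \<in> admissible"
    if "g \<in> admissible" for j g
  proof (induction j)
    case (Suc j)
    have "x\<^sub>a ^ Suc j * nf g = x\<^sub>a * (x\<^sub>a ^ j * nf g)"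
      by (simp add: mult.assoc)
    also have "\<dots> \<approx>\<^sub>\<Omega> x\<^sub>a * nf ((La ^^ j) g)"
      using Suc by (intro cong_mult cong_refl) simp
    also have "\<dots> \<approx>\<^sub>\<Omega> nf (La ((La ^^ j) g))"
      using Suc by (intro nf_La) simp
    finally show ?case using Suc by simp
  qed (simp add: that)
  have "x\<^sub>b * (x\<^sub>c * nf f) \<approx>\<^sub>\<Omega> x\<^sub>b * nf (Lc f)"
    by (intro cong_mult cong_refl nf_Lc f)
  also have "\<dots> \<approx>\<^sub>\<Omega> nf (Lb (Lc f))"
    by (intro nf_Lb) (simp add: f)
  finally have bc: "x\<^sub>b * (x\<^sub>c * nf f) \<approx>\<^sub>\<Omega> nf (Lb (Lc f))" .
  have "x\<^sub>d * nf f = 1 * (x\<^sub>d * nf f)" by simp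
  also have "\<dots> \<approx>\<^sub>\<Omega> x\<^sub>a ^ r * (x\<^sub>d * nf f)"
    by (intro cong_mult cong_refl cong_sym[OF function_congs(5)])
  also have "\<dots> = x\<^sub>a ^ s * ((x\<^sub>a * x\<^sub>d) * nf f)"
    unfolding s power_Suc2 by (simp add: mult.assoc)
  also have "\<dots> \<approx>\<^sub>\<Omega> x\<^sub>a ^ s * ((scalar p * x\<^sub>b * x\<^sub>c + 1) * nf f)"
    by (intro cong_mult cong_refl function_congs)
  also have "\<dots> = x\<^sub>a ^ s * (nf f + scalar p * (x\<^sub>b * (x\<^sub>c * nf f)))"
    by (simp add: algebra_simps)
  also have "\<dots> \<approx>\<^sub>\<Omega> x\<^sub>a ^ s * (nf f + scalar p * nf (Lb (Lc f)))"
    by (intro cong_mult cong_add cong_refl bc)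
  also have "\<dots> = x\<^sub>a ^ s * nf (La (Ld f))"
    by (simp add: nf_add nf_scale L_relations)
  also have "\<dots> \<approx>\<^sub>\<Omega> nf ((La ^^ s) (La (Ld f)))"
    using La_s f by simp
  also have "(La ^^ s) (La (Ld f)) = (La ^^ r) (Ld f)"
    unfolding s funpow_Suc_right by simp
  also have "\<dots> = Ld f"
    by (simp add: La_power_r f)
  finally show ?thesis .
qed

definition NF :: "(form \<Rightarrow> coeffs) \<Rightarrow> free_algebra" where
  "NF v = nf (v F1) + e\<^sub>a * nf (v Fa) + e\<^sub>b * nf (v Fb) + e\<^sub>c * nf (v Fc) + e\<^sub>d * nf (v Fd)
    + e\<^sub>b * e\<^sub>a * nf (v Fba) + e\<^sub>c * e\<^sub>a * nf (v Fca) + e\<^sub>d * e\<^sub>a * nf (v Fda)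
    + e\<^sub>b * e\<^sub>c * nf (v Fbc) + e\<^sub>b * e\<^sub>d * nf (v Fbd) + e\<^sub>c * e\<^sub>d * nf (v Fcd)"

text \<open>Multiplying an element of degree at most one by any generator stays within the degrees
  that \<open>NF\<close> represents. In degree two the truncation would discard products with a
  further form.\<close>

definition low :: "(form \<Rightarrow> coeffs) set" where
  "low = {v. \<forall>i\<in>{Fba, Fca, Fda, Fbc, Fbd, Fcd}. v i = 0}"

lemma NF_low:
  "v \<in> low \<Longrightarrow> NF v = nf (v F1) + e\<^sub>a * nf (v Fa) + e\<^sub>b * nf (v Fb) + e\<^sub>c * nf (v Fc) + e\<^sub>d * nf (v Fd)"
  by (simp add: NF_def low_def)

lemma cong_mult_assoc: "x * e \<approx>\<^sub>\<Omega> s \<Longrightarrow> s * y \<approx>\<^sub>\<Omega> t \<Longrightarrow> x * (e * y) \<approx>\<^sub>\<Omega> t"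
  unfolding mult.assoc[symmetric] by (rule cong_trans[OF cong_mult[OF _ cong_refl]])

lemma cross_nf:
  assumes uv: "(u, v) \<in> {(x\<^sub>a, x\<^sub>c), (x\<^sub>b, x\<^sub>d)}"
    and U: "u * nf f \<approx>\<^sub>\<Omega> nf f\<^sub>u" and V: "v * nf f \<approx>\<^sub>\<Omega> nf f\<^sub>v"
  shows "v * (e\<^sub>b * nf f) \<approx>\<^sub>\<Omega> e\<^sub>b * nf f\<^sub>v"
    "u * (e\<^sub>c * nf f) \<approx>\<^sub>\<Omega> e\<^sub>c * nf f\<^sub>u"
    "u * (e\<^sub>d * nf f) \<approx>\<^sub>\<Omega> scalar p * (e\<^sub>d * nf f\<^sub>u)"
    "v * (e\<^sub>d * nf f) \<approx>\<^sub>\<Omega> scalar q * (e\<^sub>d * nf f\<^sub>v)"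
    "u * (e\<^sub>b * nf f) \<approx>\<^sub>\<Omega> e\<^sub>b * nf f\<^sub>u + scalar (q * \<mu>) * (e\<^sub>d * nf f\<^sub>v)"
    "v * (e\<^sub>c * nf f) \<approx>\<^sub>\<Omega> e\<^sub>c * nf f\<^sub>v + scalar (q * \<mu>) * (e\<^sub>d * nf f\<^sub>u)"
    "v * (e\<^sub>a * nf f) \<approx>\<^sub>\<Omega> scalar p * (e\<^sub>a * nf f\<^sub>v) + scalar \<mu> * (e\<^sub>b * nf f\<^sub>u)"
    "u * (e\<^sub>a * nf f) \<approx>\<^sub>\<Omega> scalar q * (e\<^sub>a * nf f\<^sub>u) + scalar \<mu> * (e\<^sub>c * nf f\<^sub>v)
      + scalar (q * \<mu> ^ 2) * (e\<^sub>d * nf f\<^sub>u)"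
  by (rule cong_mult_assoc, rule cross_congs[OF uv], unfold mult.assoc distrib_right,
    intro cong_add cong_mult cong_refl U V)+

lemma NF_rep_uv:
  assumes uv: "(u, v) \<in> {(x\<^sub>a, x\<^sub>c), (x\<^sub>b, x\<^sub>d)}"
    and UV: "coeffs_linear U" "coeffs_linear V"
    and U: "\<And>f. f \<in> admissible \<Longrightarrow> u * nf f \<approx>\<^sub>\<Omega> nf (U f)"
    and V: "\<And>f. f \<in> admissible \<Longrightarrow> v * nf f \<approx>\<^sub>\<Omega> nf (V f)"
    and w: "w \<in> admissible_vec" "w \<in> low"
  shows "u * NF w \<approx>\<^sub>\<Omega> NF (rep_u U V w)" "v * NF w \<approx>\<^sub>\<Omega> NF (rep_v U V w)"
    and "rep_u U V w \<in> low" "rep_v U V w \<in> low"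
proof -
  have adm: "w i \<in> admissible" for i
    using w by (simp add: admissible_vec_def)
  show low: "rep_u U V w \<in> low" "rep_v U V w \<in> low"
    using w(2) coeffs_linearD(5)[OF UV(1)] coeffs_linearD(5)[OF UV(2)] by (auto simp: low_def)
  note cross = cross_nf[OF uv U V]
  note simps = rep_u.simps rep_v.simps nf_add nf_scale scalar_left_commute[of "gen _"] distrib_left
    add.assoc add.commute add.left_commute
  have "u * NF w = u * nf (w F1) + u * (e\<^sub>a * nf (w Fa)) + u * (e\<^sub>b * nf (w Fb))
      + u * (e\<^sub>c * nf (w Fc)) + u * (e\<^sub>d * nf (w Fd))"
    by (simp add: NF_low w distrib_left)
  also have "\<dots> \<approx>\<^sub>\<Omega> nf (U (w F1)) + (scalar q * (e\<^sub>a * nf (U (w Fa))) + scalar \<mu> * (e\<^sub>c * nf (V (w Fa)))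
      + scalar (q * \<mu> ^ 2) * (e\<^sub>d * nf (U (w Fa))))
      + (e\<^sub>b * nf (U (w Fb)) + scalar (q * \<mu>) * (e\<^sub>d * nf (V (w Fb))))
      + e\<^sub>c * nf (U (w Fc)) + scalar p * (e\<^sub>d * nf (U (w Fd)))"
    by (intro cong_add cross adm U)
  also have "\<dots> = NF (rep_u U V w)"
    unfolding NF_low[OF low(1)] by (simp only: simps)
  finally show "u * NF w \<approx>\<^sub>\<Omega> NF (rep_u U V w)" .
  have "v * NF w = v * nf (w F1) + v * (e\<^sub>a * nf (w Fa)) + v * (e\<^sub>b * nf (w Fb))
      + v * (e\<^sub>c * nf (w Fc)) + v * (e\<^sub>d * nf (w Fd))"
    by (simp add: NF_low w distrib_left)
  also have "\<dots> \<approx>\<^sub>\<Omega> nf (V (w F1)) + (scalar p * (e\<^sub>a * nf (V (w Fa))) + scalar \<mu> * (e\<^sub>b * nf (U (w Fa))))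
      + e\<^sub>b * nf (V (w Fb))
      + (e\<^sub>c * nf (V (w Fc)) + scalar (q * \<mu>) * (e\<^sub>d * nf (U (w Fc)))) + scalar q * (e\<^sub>d * nf (V (w Fd)))"
    by (intro cong_add cross adm V)
  also have "\<dots> = NF (rep_v U V w)"
    unfolding NF_low[OF low(2)] by (simp only: simps)
  finally show "v * NF w \<approx>\<^sub>\<Omega> NF (rep_v U V w)" .
qed

lemma NF_wedge:
  assumes w: "w \<in> low"
  shows "e\<^sub>a * NF w \<approx>\<^sub>\<Omega> NF (wedge_a w)" "e\<^sub>b * NF w \<approx>\<^sub>\<Omega> NF (wedge_b w)"
    "e\<^sub>c * NF w \<approx>\<^sub>\<Omega> NF (wedge_c w)" "e\<^sub>d * NF w \<approx>\<^sub>\<Omega> NF (wedge_d w)"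
proof -
  define f where "f = w F1"
  define fa where "fa = nf (w Fa)"
  define fb where "fb = nf (w Fb)"
  define fc where "fc = nf (w Fc)"
  define fd where "fd = nf (w Fd)"
  have expand: "e * NF w = e * nf f + e * e\<^sub>a * fa + e * e\<^sub>b * fb + e * e\<^sub>c * fc + e * e\<^sub>d * fd" for e
    by (simp add: NF_low w distrib_left mult.assoc f_def fa_def fb_def fc_def fd_def)
  note intros = cong_add cong_mult cong_refl form_congs
  note simps = NF_def nf_add nf_scale nf_diff nf_uminus scalar_left_commute[of "gen _"] mult.assoc
    f_def fa_def fb_def fc_def fd_def
  have "e\<^sub>a * NF w \<approx>\<^sub>\<Omega> e\<^sub>a * nf f + (scalar \<mu> * e\<^sub>b * e\<^sub>c) * fa
      + (scalar \<mu> * e\<^sub>b * e\<^sub>d - scalar (q ^ 2) * e\<^sub>b * e\<^sub>a) * fb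
      + (- (scalar (p ^ 2) * e\<^sub>c * e\<^sub>a) - scalar (p ^ 2 * \<mu>) * e\<^sub>c * e\<^sub>d) * fc
      + (- (e\<^sub>d * e\<^sub>a) - scalar \<mu> * e\<^sub>b * e\<^sub>c) * fd"
    unfolding expand by (intro intros)
  also have "\<dots> = NF (wedge_a w)"
    by (simp add: simps scalar_uminus left_diff_distrib right_diff_distrib)
  finally show "e\<^sub>a * NF w \<approx>\<^sub>\<Omega> NF (wedge_a w)" .
  have "e\<^sub>b * NF w \<approx>\<^sub>\<Omega> e\<^sub>b * nf f + e\<^sub>b * e\<^sub>a * fa + 0 * fb + e\<^sub>b * e\<^sub>c * fc + e\<^sub>b * e\<^sub>d * fd"
    unfolding expand by (intro intros)
  also have "\<dots> = NF (wedge_b w)"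
    by (simp add: simps)
  finally show "e\<^sub>b * NF w \<approx>\<^sub>\<Omega> NF (wedge_b w)" .
  have "e\<^sub>c * NF w \<approx>\<^sub>\<Omega> e\<^sub>c * nf f + e\<^sub>c * e\<^sub>a * fa + - (e\<^sub>b * e\<^sub>c) * fb + 0 * fc + e\<^sub>c * e\<^sub>d * fd"
    unfolding expand by (intro intros)
  also have "\<dots> = NF (wedge_c w)"
    by (simp add: simps)
  finally show "e\<^sub>c * NF w \<approx>\<^sub>\<Omega> NF (wedge_c w)" .
  have "e\<^sub>d * NF w \<approx>\<^sub>\<Omega> e\<^sub>d * nf f + e\<^sub>d * e\<^sub>a * fa + - (e\<^sub>b * e\<^sub>d) * fb + - (e\<^sub>c * e\<^sub>d) * fc + 0 * fd"
    unfolding expand by (intro intros)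
  also have "\<dots> = NF (wedge_d w)"
    by (simp add: simps)
  finally show "e\<^sub>d * NF w \<approx>\<^sub>\<Omega> NF (wedge_d w)" .
qed

text \<open>The rules of the model are themselves consequences of the relations. This is the half of
  the comparison which shows that the model loses nothing in low degrees.\<close>

lemma NF_rep:
  assumes w: "w \<in> admissible_vec" "w \<in> low"
  shows "gen g * NF w \<approx>\<^sub>\<Omega> NF (rep g w)"
proof -
  note ac = NF_rep_uv[of x\<^sub>a x\<^sub>c, OF _ L_linear(1,3) nf_La nf_Lc w]
  note bd = NF_rep_uv[of x\<^sub>b x\<^sub>d, OF _ L_linear(2,4) nf_Lb nf_Ld w]
  show ?thesis
    using ac bd NF_wedge[OF w(2)] by (cases g) simp_all
qed

section \<open>The commutation of functions with forms\<close>

text \<open>The exponent of a counts modulo r, in accordance with a^r = 1. So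
  \<open>mono (- 1) n k\<close> stands for a^(r-1) b^n c^k, with a^(r-1) in the role of the inverse
  of a.\<close>

definition mono :: "int \<Rightarrow> int \<Rightarrow> int \<Rightarrow> coeffs" where
  "mono m\<^sub>0 n\<^sub>0 k\<^sub>0 = (\<lambda>m n k. if int r dvd m - m\<^sub>0 \<and> n = n\<^sub>0 \<and> k = k\<^sub>0 then 1 else 0)"

abbreviation unit_vec_A :: "form \<Rightarrow> coeffs" where
  "unit_vec_A \<equiv> of_coeffs (mono 0 0 0)"

lemma mono_admissible:
  "0 \<le> n\<^sub>0 \<Longrightarrow> n\<^sub>0 < int r \<Longrightarrow> 0 \<le> k\<^sub>0 \<Longrightarrow> k\<^sub>0 < int r \<Longrightarrow> mono m\<^sub>0 n\<^sub>0 k\<^sub>0 \<in> admissible"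
proof (rule admissibleI)
  fix m n k
  have "int r dvd m + int r - m\<^sub>0 \<longleftrightarrow> int r dvd m - m\<^sub>0"
    using dvd_add_left_iff[of "int r" "int r" "m - m\<^sub>0"] by (simp add: algebra_simps)
  then show "mono m\<^sub>0 n\<^sub>0 k\<^sub>0 (m + int r) n k = mono m\<^sub>0 n\<^sub>0 k\<^sub>0 m n k"
    by (simp add: mono_def)
qed (auto simp: mono_def)

lemma of_coeffs_admissible: "f \<in> admissible \<Longrightarrow> of_coeffs f \<in> admissible_vec"
  by (auto simp: admissible_vec_def of_coeffs_def)

lemma unit_admissible [simp]: "unit_vec_A \<in> admissible_vec"
  using r_ge by (intro of_coeffs_admissible mono_admissible) auto

lemma powi_dvd: "int r dvd m \<Longrightarrow> q powi m = 1"
  by (auto simp: dvd_def power_int_mult q_power)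

lemma Lc_power_mono: "k < r \<Longrightarrow> (Lc ^^ k) (mono 0 0 0) = mono 0 0 (int k)"
proof (induction k)
  case (Suc k)
  then show ?case
    by (intro coeffs_eqI) (auto simp: Lc_def mono_def powi_dvd)
qed simp

lemma Lb_power_mono: "n < r \<Longrightarrow> (Lb ^^ n) (mono 0 0 k) = mono 0 (int n) k"
proof (induction n)
  case (Suc n)
  then show ?case
    by (intro coeffs_eqI) (auto simp: Lb_def mono_def powi_dvd)
qed simp

lemma La_power_mono: "(La ^^ m) (mono 0 n k) = mono (int m) n k"
  by (simp add: La_power mono_def)

lemma act_monomial:
  assumes "n < r" "k < r"
  shows "act (x\<^sub>a ^ m * (x\<^sub>b ^ n * x\<^sub>c ^ k)) unit_vec_A = of_coeffs (mono (int m) (int n) (int k))"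
  using rep_power_of_coeffs[OF L_linear(1,3)] rep_power_of_coeffs[OF L_linear(2,4)] assms
  by (simp add: act_mult act_power Lc_power_mono Lb_power_mono La_power_mono)

lemma of_coeffs_add: "of_coeffs (f + g) = of_coeffs f + of_coeffs g"
  and of_coeffs_scale: "of_coeffs (z *\<^sub>A f) = z *\<^sub>F of_coeffs f"
  by (rule vec_eqI, rule coeffs_eqI, case_tac i; simp)+

lemma of_coeffs_zero: "of_coeffs 0 = 0"
  by (rule ext) (simp add: of_coeffs_def)

lemma of_coeffs_sum: "of_coeffs (sum f A) = (\<Sum>i\<in>A. of_coeffs (f i))"
  by (induction A rule: infinite_finite_induct) (simp_all only: sum.infinite sum.empty
      sum.insert of_coeffs_add of_coeffs_zero not_False_eq_True)

lemma sum_coeffs_apply: "(\<Sum>i\<in>A. f i) m n k = (\<Sum>i\<in>A. (f i :: coeffs) m n k)"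
  by (induction A rule: infinite_finite_induct) simp_all

lemma admissible_mod: "f \<in> admissible \<Longrightarrow> int r dvd m - m' \<Longrightarrow> f m n k = f m' n k"
proof -
  assume f: "f \<in> admissible" and "int r dvd m - m'"
  then obtain j where "m - m' = int r * j" by (auto simp: dvd_def)
  then have m: "m = m' + int r * j" by simp
  have "f (m' + int r * int i) n k = f m' n k" for m' i
  proof (induction i)
    case (Suc i)
    then show ?case
      using admissible_period[OF f, of "m' + int r * int i"] by (simp add: algebra_simps)
  qed simp
  from this[of m' "nat j"] this[of "m' + int r * j" "nat (- j)"] show ?thesis
    unfolding m by (cases "j \<ge> 0") simp_all
qed

lemma coeffs_as_sum:
  assumes f: "f \<in> admissible"
  shows "(\<Sum>m<r. \<Sum>n<r. \<Sum>k<r. f (int m) (int n) (int k) *\<^sub>A mono (int m) (int n) (int k)) = f"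
proof (rule coeffs_eqI)
  fix m n k
  let ?s = "\<lambda>m' n' k'. f (int m') (int n') (int k') * mono (int m') (int n') (int k') m n k"
  show "(\<Sum>m<r. \<Sum>n<r. \<Sum>k<r. f (int m) (int n) (int k) *\<^sub>A mono (int m) (int n) (int k)) m n k = f m n k"
  proof (cases "0 \<le> n \<and> n < int r \<and> 0 \<le> k \<and> k < int r")
    case True
    \<comment> \<open>The triple sum has one surviving term: the residue of m modulo r together with
      n and k.\<close>
    define m\<^sub>0 where "m\<^sub>0 = nat (m mod int r)"
    have r: "int r > 0" using r_ge by simp
    have m0: "m\<^sub>0 < r" "int m\<^sub>0 = m mod int r"
      using r by (simp_all add: m\<^sub>0_def nat_less_iff)
    have dvd: "int r dvd m - int m' \<longleftrightarrow> m' = m\<^sub>0" if "m' < r" for m'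
      using that m0 by (auto simp: mod_eq_dvd_iff[symmetric])
    have "(\<Sum>k'<r. ?s m' n' k') = ?s m' n' (nat k)" for m' n'
      using True by (subst sum.remove[of _ "nat k"]) (auto simp: mono_def split: if_splits intro!: sum.neutral)
    moreover have "(\<Sum>n'<r. ?s m' n' (nat k)) = ?s m' (nat n) (nat k)" for m'
      using True by (subst sum.remove[of _ "nat n"]) (auto simp: mono_def split: if_splits intro!: sum.neutral)
    moreover have "(\<Sum>m'<r. ?s m' (nat n) (nat k)) = ?s m\<^sub>0 (nat n) (nat k)"
      using m0 dvd by (subst sum.remove[of _ m\<^sub>0]) (auto simp: mono_def split: if_splits intro!: sum.neutral)
    ultimately have "(\<Sum>m'<r. \<Sum>n'<r. \<Sum>k'<r. ?s m' n' k') = ?s m\<^sub>0 (nat n) (nat k)"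
      by simp
    also have "\<dots> = f m n k"
      using True dvd[of m\<^sub>0] m0(1) admissible_mod[OF f, of m "int m\<^sub>0"] by (simp add: mono_def)
    finally show ?thesis by (simp add: sum_coeffs_apply)
  next
    case False
    then have "mono m' (int n') (int k') m n k = 0" if "n' < r" "k' < r" for m' n' k'
      using that by (auto simp: mono_def)
    then show ?thesis
      using False admissible_outside[OF f, of n k m] by (auto simp: sum_coeffs_apply intro!: sum.neutral)
  qed
qed

text \<open>Acting on 1 reads off the coefficients; together with \<open>cong_act\<close> this makes
  the normal form of a function unique.\<close>

lemma act_nf: "f \<in> admissible \<Longrightarrow> act (nf f) unit_vec_A = of_coeffs f"
proof -
  assume f: "f \<in> admissible"
  have "nf f = (\<Sum>m<r. \<Sum>n<r. \<Sum>k<r. scalar (f (int m) (int n) (int k)) * (x\<^sub>a ^ m * (x\<^sub>b ^ n * x\<^sub>c ^ k)))"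
    by (simp add: nf_def row_def sum_distrib_left scalar_left_commute[of "_ ^ _"])
  then have "act (nf f) unit_vec_A =
      of_coeffs (\<Sum>m<r. \<Sum>n<r. \<Sum>k<r. f (int m) (int n) (int k) *\<^sub>A mono (int m) (int n) (int k))"
    unfolding of_coeffs_sum of_coeffs_scale
    by (simp only: act_sum act_mult[of "scalar _"] act_scalar) (simp add: act_monomial)
  then show ?thesis by (simp add: coeffs_as_sum[OF f])
qed

section \<open>The grading by form degree and faithfulness in degrees zero and one\<close>

fun form_deg :: "form \<Rightarrow> nat" where
  "form_deg F1 = 0" | "form_deg Fa = 1" | "form_deg Fb = 1" | "form_deg Fc = 1" | "form_deg Fd = 1"
| "form_deg _ = 2"

fun gen_deg :: "generator \<Rightarrow> nat" where
  "gen_deg Form_a = 1" | "gen_deg Form_b = 1" | "gen_deg Form_c = 1" | "gen_deg Form_d = 1"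
| "gen_deg _ = 0"

definition grade :: "nat \<Rightarrow> (form \<Rightarrow> coeffs) set" where
  "grade j = {v. \<forall>i. form_deg i \<noteq> j \<longrightarrow> v i = 0}"

lemma grade_subspace: "vec.subspace (grade j)"
  unfolding vec.subspace_def grade_def by (auto intro!: coeffs_eqI)

lemma rep_grade:
  assumes "v \<in> grade j"
  shows "rep g v \<in> grade (j + gen_deg g)"
proof -
  have v: "j \<noteq> 0 \<Longrightarrow> v F1 = 0"
    "j \<noteq> 1 \<Longrightarrow> v Fa = 0" "j \<noteq> 1 \<Longrightarrow> v Fb = 0" "j \<noteq> 1 \<Longrightarrow> v Fc = 0" "j \<noteq> 1 \<Longrightarrow> v Fd = 0"
    "j \<noteq> 2 \<Longrightarrow> v Fba = 0" "j \<noteq> 2 \<Longrightarrow> v Fca = 0" "j \<noteq> 2 \<Longrightarrow> v Fda = 0"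
    "j \<noteq> 2 \<Longrightarrow> v Fbc = 0" "j \<noteq> 2 \<Longrightarrow> v Fbd = 0" "j \<noteq> 2 \<Longrightarrow> v Fcd = 0"
    using assms by (auto simp: grade_def)
  have "rep g v i = 0" if "form_deg i \<noteq> j + gen_deg g" for i
    using that by (cases g; cases i) (auto simp: v L_simps intro!: coeffs_eqI)
  then show ?thesis by (simp add: grade_def)
qed

lemma form_degree_Cons: "form_degree (Free_Monoid (g # gs)) = gen_deg g + form_degree (Free_Monoid gs)"
  by (cases g) (simp_all add: form_degree_def)

lemma form_degree_Nil: "form_degree (Free_Monoid []) = 0"
  by (simp add: form_degree_def)

lemma act_word_admissible: "v \<in> admissible_vec \<Longrightarrow> act_word gs v \<in> admissible_vec"
  by (induction gs) (simp_all add: act_word_def rep_admissible)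

lemma act_word_grade: "act_word gs unit_vec_A \<in> grade (form_degree (Free_Monoid gs))"
proof (induction gs)
  case Nil
  then show ?case by (simp add: act_word_def form_degree_Nil grade_def of_coeffs_def)
next
  case (Cons g gs)
  then show ?case
    using rep_grade[of "act_word gs unit_vec_A" _ g]
    by (simp add: act_word_def form_degree_Cons add.commute[of "gen_deg g"])
qed

definition homogeneous :: "nat \<Rightarrow> free_algebra set" where
  "homogeneous i = {x. \<forall>w\<in>Poly_Mapping.keys x. form_degree w = i}"

lemma form_degree_add: "form_degree (v + w) = form_degree v + form_degree w"
  by (simp add: form_degree_def plus_free_monoid_def)

lemma homogeneous_zero [simp]: "0 \<in> homogeneous i"
  and homogeneous_add: "x \<in> homogeneous i \<Longrightarrow> y \<in> homogeneous i \<Longrightarrow> x + y \<in> homogeneous i"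
  and homogeneous_uminus: "x \<in> homogeneous i \<Longrightarrow> - x \<in> homogeneous i"
  and homogeneous_gen: "gen g \<in> homogeneous (gen_deg g)"
  and homogeneous_scalar: "scalar z \<in> homogeneous 0"
  and homogeneous_one: "1 \<in> homogeneous 0"
proof -
  show "x + y \<in> homogeneous i" if "x \<in> homogeneous i" "y \<in> homogeneous i"
    using that Poly_Mapping.keys_add[of x y] by (auto simp: homogeneous_def)
  show "gen g \<in> homogeneous (gen_deg g)"
    by (cases g) (simp_all add: gen_def homogeneous_def form_degree_def)
  show scalar: "scalar z \<in> homogeneous 0" for z
    by (simp add: homogeneous_def scalar_def form_degree_def zero_free_monoid_def)
  show "1 \<in> homogeneous 0"
    using scalar[of 1] by simp
qed (simp_all add: homogeneous_def)

lemma homogeneous_mult: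
  "x \<in> homogeneous i \<Longrightarrow> y \<in> homogeneous j \<Longrightarrow> x * y \<in> homogeneous (i + j)"
  using Poly_Mapping.keys_mult[of x y] by (force simp: homogeneous_def form_degree_add)

lemma homogeneous_diff: "x \<in> homogeneous i \<Longrightarrow> y \<in> homogeneous i \<Longrightarrow> x - y \<in> homogeneous i"
  using homogeneous_add[of x i "- y"] by (simp add: homogeneous_uminus)

lemma homogeneous_scale: "x \<in> homogeneous i \<Longrightarrow> scalar z * x \<in> homogeneous i"
  using homogeneous_mult[OF homogeneous_scalar, of x i] by simp

lemma homogeneous_sum: "(\<And>i. i \<in> A \<Longrightarrow> f i \<in> homogeneous j) \<Longrightarrow> sum f A \<in> homogeneous j"
  by (induction A rule: infinite_finite_induct) (simp_all add: homogeneous_add)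

lemma homogeneous_power: "x \<in> homogeneous 0 \<Longrightarrow> x ^ n \<in> homogeneous 0"
  by (induction n) (use homogeneous_mult[of _ 0 _ 0] in \<open>auto simp: homogeneous_one\<close>)

lemma homogeneous_gens:
  "x\<^sub>a \<in> homogeneous 0" "x\<^sub>b \<in> homogeneous 0" "x\<^sub>c \<in> homogeneous 0" "x\<^sub>d \<in> homogeneous 0"
  "e\<^sub>a \<in> homogeneous 1" "e\<^sub>b \<in> homogeneous 1" "e\<^sub>c \<in> homogeneous 1" "e\<^sub>d \<in> homogeneous 1"
  using homogeneous_gen[of Gen_a] homogeneous_gen[of Gen_b] homogeneous_gen[of Gen_c]
    homogeneous_gen[of Gen_d] homogeneous_gen[of Form_a] homogeneous_gen[of Form_b]
    homogeneous_gen[of Form_c] homogeneous_gen[of Form_d] by simp_all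

lemma homogeneous_mult_1: "x \<in> homogeneous 1 \<Longrightarrow> y \<in> homogeneous 0 \<Longrightarrow> x * y \<in> homogeneous 1"
  "x \<in> homogeneous 0 \<Longrightarrow> y \<in> homogeneous 1 \<Longrightarrow> x * y \<in> homogeneous 1"
  "x \<in> homogeneous 0 \<Longrightarrow> y \<in> homogeneous 0 \<Longrightarrow> x * y \<in> homogeneous 0"
  using homogeneous_mult[of x 1 y 0] homogeneous_mult[of x 0 y 1] homogeneous_mult[of x 0 y 0] by auto

lemma nf_homogeneous: "nf f \<in> homogeneous 0"
  unfolding nf_def row_def
  by (intro homogeneous_sum homogeneous_mult_1 homogeneous_scale homogeneous_power homogeneous_gens)

lemma act_grade:
  assumes "x \<in> homogeneous i"
  shows "act x unit_vec_A \<in> grade i"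
proof -
  have "act_word (letters w) unit_vec_A \<in> grade i" if "w \<in> Poly_Mapping.keys x" for w
    using assms that act_word_grade[of "letters w"] by (simp add: homogeneous_def)
  then show ?thesis
    unfolding act_def by (intro vec.subspace_sum vec.subspace_scale grade_subspace)
qed

lemma grade_low: "v \<in> grade i \<Longrightarrow> i \<le> 1 \<Longrightarrow> v \<in> low"
  by (auto simp: grade_def low_def)

lemma NF_add: "NF (v + w) = NF v + NF w"
  by (simp add: NF_def nf_add distrib_left algebra_simps)

lemma NF_scale: "NF (z *\<^sub>F v) = scalar z * NF v"
  by (simp add: NF_def nf_scale distrib_left mult.assoc scalar_left_commute[of "gen _"])

lemma NF_zero: "NF 0 = 0"
  by (simp add: NF_def)

lemma NF_sum: "NF (sum f A) = (\<Sum>i\<in>A. NF (f i))"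
  by (induction A rule: infinite_finite_induct) (simp_all only: sum.infinite sum.empty
      sum.insert NF_add NF_zero not_False_eq_True)

lemma NF_unit: "NF unit_vec_A = 1"
proof -
  have "row (mono 0 0 0) (int m) = (if m = 0 then 1 else 0)" if "m < r" for m
  proof -
    have "int r dvd int m \<longleftrightarrow> m = 0"
      using that by (auto dest: zdvd_imp_le)
    then have "scalar (mono 0 0 0 (int m) (int n) (int k)) * (x\<^sub>b ^ n * x\<^sub>c ^ k) =
        (if k = 0 then if n = 0 then if m = 0 then 1 else 0 else 0 else 0)" for n k
      by (simp add: mono_def)
    then show ?thesis
      unfolding row_def using r_ge by simp
  qed
  then have "nf (mono 0 0 0) = (\<Sum>m<r. if m = 0 then 1 else 0)"
    unfolding nf_def by (intro sum.cong) auto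
  then show ?thesis
    using r_ge by (simp add: NF_def)
qed

lemma word_NF:
  assumes "form_degree (Free_Monoid gs) \<le> 1"
  shows "Poly_Mapping.single (Free_Monoid gs) 1 \<approx>\<^sub>\<Omega> NF (act_word gs unit_vec_A)"
  using assms
proof (induction gs)
  case Nil
  then show ?case by (simp add: single_word_Nil act_word_def NF_unit)
next
  case (Cons g gs)
  let ?v = "act_word gs unit_vec_A"
  have deg: "form_degree (Free_Monoid gs) \<le> 1"
    using Cons.prems by (simp add: form_degree_Cons)
  have "Poly_Mapping.single (Free_Monoid (g # gs)) 1 \<approx>\<^sub>\<Omega> gen g * NF ?v"
    unfolding single_word_Cons by (intro cong_mult cong_refl Cons.IH deg)
  also have "\<dots> \<approx>\<^sub>\<Omega> NF (rep g ?v)"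
    by (intro NF_rep act_word_admissible unit_admissible grade_low[OF act_word_grade] deg)
  also have "rep g ?v = act_word (g # gs) unit_vec_A"
    by (simp add: act_word_def)
  finally show ?case .
qed

text \<open>Words are built up letter by letter with \<open>NF_rep\<close>; the bound on the degree
  keeps every suffix of a word in \<open>low\<close>.\<close>

lemma NF_act:
  assumes x: "x \<in> homogeneous i" "i \<le> 1"
  shows "x \<approx>\<^sub>\<Omega> NF (act x unit_vec_A)"
proof -
  have "x = (\<Sum>w\<in>Poly_Mapping.keys x. scalar (Poly_Mapping.lookup x w) * Poly_Mapping.single w 1)"
  proof (rule poly_mapping_eqI)
    fix w
    have "Poly_Mapping.lookup (\<Sum>w\<in>Poly_Mapping.keys x. scalar (Poly_Mapping.lookup x w) * Poly_Mapping.single w 1) w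
      = (\<Sum>w'\<in>Poly_Mapping.keys x. if w' = w then Poly_Mapping.lookup x w' else 0)"
      by (simp add: scalar_def mult_single lookup_sum lookup_single when_def)
    also have "\<dots> = Poly_Mapping.lookup x w"
      by (simp add: in_keys_iff)
    finally show "Poly_Mapping.lookup x w = Poly_Mapping.lookup (\<Sum>w\<in>Poly_Mapping.keys x.
        scalar (Poly_Mapping.lookup x w) * Poly_Mapping.single w 1) w" by simp
  qed
  also have "\<dots> \<approx>\<^sub>\<Omega> (\<Sum>w\<in>Poly_Mapping.keys x.
      scalar (Poly_Mapping.lookup x w) * NF (act_word (letters w) unit_vec_A))"
  proof (intro cong_sum cong_mult cong_refl)
    fix w assume "w \<in> Poly_Mapping.keys x"
    then show "Poly_Mapping.single w 1 \<approx>\<^sub>\<Omega> NF (act_word (letters w) unit_vec_A)"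
      using word_NF[of "letters w"] x by (simp add: homogeneous_def)
  qed
  also have "\<dots> = NF (act x unit_vec_A)"
    by (simp add: act_def NF_sum NF_scale)
  finally show ?thesis .
qed

lemma cong_iff_act:
  assumes "x \<in> homogeneous i" "y \<in> homogeneous i" "i \<le> 1"
  shows "x \<approx>\<^sub>\<Omega> y \<longleftrightarrow> act x unit_vec_A = act y unit_vec_A"
proof
  assume "act x unit_vec_A = act y unit_vec_A"
  then show "x \<approx>\<^sub>\<Omega> y"
    using NF_act[OF assms(1,3)] NF_act[OF assms(2,3)] by (metis cong_sym cong_trans)
qed (simp add: cong_act)

section \<open>Moving the form theta past functions\<close>

definition kappa :: "coeffs \<Rightarrow> coeffs" where
  "kappa f = (\<lambda>m n k. q powi (m + n - k) * f m n k)"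

definition kappa_inv :: "coeffs \<Rightarrow> coeffs" where
  "kappa_inv f = (\<lambda>m n k. q powi (k - m - n) * f m n k)"

text \<open>The coefficient of e_b in f \<theta>: a twisted derivation that kills a and b and sends
  c to \<mu> a and d to \<mu> b. On monomials it lowers the power of c by one. The formula is
  indexed by the target monomial, hence the shifted arguments.\<close>

definition P :: "coeffs \<Rightarrow> coeffs" where
  "P f = (\<lambda>m n k. q powi (n - 1) * (q powi (k + 1) - q powi (- k - 1)) * f (m - 1) n (k + 1))"

text \<open>The coefficient of e_c in f \<theta>: the counterpart of P that sends a to \<mu> c and b
  to \<mu> d. Since d is a^(-1) (1 + p b c), a power of b contributes two monomials; the one with b
  c is merged with the contribution of a.\<close>

definition Q :: "coeffs \<Rightarrow> coeffs" where
  "Q f = (\<lambda>m n k. q powi (- 1 - k) *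
    ((if k < int r then (q powi (2 * m + 2 + n) - q powi (- n)) * f (m + 1) n (k - 1) else 0)
      + (q powi (n + 1) - q powi (- n - 1)) * f (m + 1) (n + 1) k))"

text \<open>Together with \<open>kappa_inv f\<close> this is the coefficient of e_d in f \<theta>.
  Expressing it through P and Q reduces its commutation rules \<open>X_L\<close> to those of P and
  Q.\<close>

definition X :: "coeffs \<Rightarrow> coeffs" where
  "X f = (q * q) *\<^sub>A kappa_inv (P (Q f))"

lemma PQ_linear: "coeffs_linear kappa" "coeffs_linear kappa_inv" "coeffs_linear P" "coeffs_linear Q"
  by (auto simp: Vector_Spaces.linear_iff coeffs.vector_space_axioms
      kappa_def kappa_inv_def P_def Q_def fun_eq_iff algebra_simps)

lemma powi_expand:
  "q powi (m + n) = q powi m * q powi n" "q powi (m - n) = q powi m * q powi (- n)"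
  "q powi (2 * m) = q powi m * q powi m" "q powi (- (2 * m)) = q powi (- m) * q powi (- m)"
  "q powi (m * 2) = q powi m * q powi m" "q powi (- (m * 2)) = q powi (- m) * q powi (- m)"
  "q powi (- 1) = p" "q powi 2 = q * q" "q powi (- 2) = p * p"
proof -
  show add: "q powi (m + n) = q powi m * q powi n" for m n
    by (simp add: power_int_add)
  show "q powi (m - n) = q powi m * q powi (- n)"
    using add[of m "- n"] by simp
  show double: "q powi (2 * m) = q powi m * q powi m" for m
    using add[of m m] by simp
  show "q powi (- (2 * m)) = q powi (- m) * q powi (- m)"
    using double[of "- m"] by simp
  show "q powi (m * 2) = q powi m * q powi m" "q powi (- (m * 2)) = q powi (- m) * q powi (- m)"
    using double[of m] double[of "- m"] by (simp_all add: mult.commute)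
  show "q powi (- 1) = p" "q powi 2 = q * q" "q powi (- 2) = p * p"
    by (simp_all add: power_int_minus power2_eq_square inverse_q)
qed

lemma powi_cancel: "q powi m * q powi (- m) = 1"
  using powi_expand(1)[of m "- m"] by simp

lemma powi_period_neg: "q powi (- int r) = 1"
  using powi_dvd[of "- int r"] by simp

lemma PQ_admissible [simp]:
  assumes f: "f \<in> admissible"
  shows "kappa f \<in> admissible" "kappa_inv f \<in> admissible" "P f \<in> admissible" "Q f \<in> admissible"
    "X f \<in> admissible"
proof -
  have shift: "g (m + int r + 1) n k = g (m + 1) n k" "g (m + int r - 1) n k = g (m - 1) n k"
    if "g \<in> admissible" for g m n k
    using admissible_period[OF that, of "m + 1"] admissible_period[OF that, of "m - 1"]
    by (simp_all add: algebra_simps)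
  note out = admissible_outside
  have powi_r: "q powi (int r) = 1"
    using powi_dvd[of "int r"] by simp
  have period: "q powi (m + int r + n - k) = q powi (m + n - k)" "q powi (k - (m + int r) - n) = q powi (k - m - n)"
      "q powi (2 * (m + int r) + 2 + n) = q powi (2 * m + 2 + n)" for m n k
  proof -
    have "m + int r + n - k = (m + n - k) + int r" "k - (m + int r) - n = (k - m - n) + - int r"
      "2 * (m + int r) + 2 + n = (2 * m + 2 + n) + int r + int r" by simp_all
    then show "q powi (m + int r + n - k) = q powi (m + n - k)"
      "q powi (k - (m + int r) - n) = q powi (k - m - n)"
      "q powi (2 * (m + int r) + 2 + n) = q powi (2 * m + 2 + n)"
      by (simp_all only: powi_add powi_r powi_period_neg mult_1_right)
  qed
  have K: "kappa g \<in> admissible" "kappa_inv g \<in> admissible" if "g \<in> admissible" for g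
    by (auto intro!: admissibleI simp: kappa_def kappa_inv_def admissible_period[OF that] out[OF that] period)
  \<comment> \<open>Outside the range the shifted argument is outside as well, except for k = -1,
    where the factor is q^0 - q^0.\<close>
  have edge: "g m n (k + 1) = 0 \<or> q powi (k + 1) - q powi (- k - 1) = 0"
    "g m (k + 1) n = 0 \<or> q powi (k + 1) - q powi (- k - 1) = 0"
    if "g \<in> admissible" "k < 0 \<or> int r \<le> k" for g m n k
    using that by (cases "k = - 1"; auto simp: out)+
  have P: "P g \<in> admissible" if g: "g \<in> admissible" for g
  proof (rule admissibleI)
    show "P g (m + int r) n k = P g m n k" for m n k
      by (simp add: P_def shift[OF g])
    show "P g m n k = 0" if "n < 0 \<or> int r \<le> n \<or> k < 0 \<or> int r \<le> k" for m n k
      using that edge(1)[OF g, of k "m - 1" n] out[OF g, of n "k + 1" "m - 1"] by (auto simp: P_def)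
  qed
  have Q: "Q g \<in> admissible" if g: "g \<in> admissible" for g
  proof (rule admissibleI)
    show "Q g (m + int r) n k = Q g m n k" for m n k
      by (simp only: Q_def shift[OF g] period)
    show "Q g m n k = 0" if "n < 0 \<or> int r \<le> n \<or> k < 0 \<or> int r \<le> k" for m n k
      using that edge(2)[OF g, of n "m + 1" k] out[OF g, of n "k - 1" "m + 1"] out[OF g, of "n + 1" k "m + 1"]
      by (auto simp: Q_def)
  qed
  show "kappa f \<in> admissible" "kappa_inv f \<in> admissible" "P f \<in> admissible" "Q f \<in> admissible"
    "X f \<in> admissible"
    unfolding X_def by (intro admissible_closed K P Q f)+
qed

text \<open>
  The factor \<open>q\<^bsup>k + 1\<^esup> - q\<^bsup>- k - 1\<^esup>\<close> in \<open>P\<close> and its counterpart in \<open>Q\<close> vanish at the end of the range of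
  exponents, where multiplication by \<open>c\<close> or \<open>b\<close> is truncated.
\<close>

lemma powi_edge: "\<not> k + 1 < int r \<Longrightarrow> k < int r \<Longrightarrow> q powi k = p" "\<not> k + 1 < int r \<Longrightarrow> k < int r \<Longrightarrow> q powi (- k) = q"
proof -
  assume "\<not> k + 1 < int r" "k < int r"
  then have k: "k = int r - 1" by simp
  show "q powi k = p" "q powi (- k) = q"
    unfolding k using powi_expand(2)[of "int r" 1] powi_expand(1)[of "- int r" 1] powi_dvd[of "int r"] powi_expand(7) powi_period_neg
    by (simp_all add: algebra_simps)
qed

lemma coeffs_eqI_admissible:
  assumes "f \<in> admissible" "g \<in> admissible"
    and "\<And>m n k. 0 \<le> n \<Longrightarrow> n < int r \<Longrightarrow> 0 \<le> k \<Longrightarrow> k < int r \<Longrightarrow> f m n k = g m n k"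
  shows "f = g"
proof (rule coeffs_eqI)
  show "f m n k = g m n k" for m n k
    using assms(3)[of n k m] admissible_outside[OF assms(1), of n k m] admissible_outside[OF assms(2), of n k m]
    by (cases "0 \<le> n \<and> n < int r \<and> 0 \<le> k \<and> k < int r") auto
qed

lemmas powi_simps = powi_expand minus_add_distrib minus_diff_eq

lemma kappa_L:
  "kappa (La f) = q *\<^sub>A La (kappa f)" "kappa (Lb f) = q *\<^sub>A Lb (kappa f)"
  "kappa (Lc f) = p *\<^sub>A Lc (kappa f)" "kappa (Ld f) = p *\<^sub>A Ld (kappa f)"
  "kappa_inv (La f) = p *\<^sub>A La (kappa_inv f)" "kappa_inv (Lb f) = p *\<^sub>A Lb (kappa_inv f)"
  "kappa_inv (Lc f) = q *\<^sub>A Lc (kappa_inv f)" "kappa_inv (Ld f) = q *\<^sub>A Ld (kappa_inv f)"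
proof -
  note defs = kappa_def kappa_inv_def La_def Lb_def Lc_def Ld_def
  have "kappa (La f) m n k = (q *\<^sub>A La (kappa f)) m n k \<and>
    kappa (Lb f) m n k = (q *\<^sub>A Lb (kappa f)) m n k \<and>
    kappa (Lc f) m n k = (p *\<^sub>A Lc (kappa f)) m n k \<and>
    kappa (Ld f) m n k = (p *\<^sub>A Ld (kappa f)) m n k \<and>
    kappa_inv (La f) m n k = (p *\<^sub>A La (kappa_inv f)) m n k \<and>
    kappa_inv (Lb f) m n k = (p *\<^sub>A Lb (kappa_inv f)) m n k \<and>
    kappa_inv (Lc f) m n k = (q *\<^sub>A Lc (kappa_inv f)) m n k \<and>
    kappa_inv (Ld f) m n k = (q *\<^sub>A Ld (kappa_inv f)) m n k" for m n k
  proof -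
    define qi where "qi = p"
    have q_qi: "q * qi = 1" "\<And>t. q * (qi * t) = t"
      by (simp_all add: qi_def)
    define x xi where "x = q powi m" and "xi = q powi (- m)"
    define y yi where "y = q powi n" and "yi = q powi (- n)"
    define z zi where "z = q powi k" and "zi = q powi (- k)"
    note vars = x_def[symmetric] y_def[symmetric] z_def[symmetric] xi_def[symmetric] yi_def[symmetric] zi_def[symmetric]
      qi_def[symmetric] inverse_q power2_eq_square mu_eq
    show ?thesis
      by (intro conjI; simp add: defs powi_simps vars; simp add: q_qi algebra_simps)
  qed
  then show "kappa (La f) = q *\<^sub>A La (kappa f)" "kappa (Lb f) = q *\<^sub>A Lb (kappa f)"
    "kappa (Lc f) = p *\<^sub>A Lc (kappa f)" "kappa (Ld f) = p *\<^sub>A Ld (kappa f)"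
    "kappa_inv (La f) = p *\<^sub>A La (kappa_inv f)" "kappa_inv (Lb f) = p *\<^sub>A Lb (kappa_inv f)"
    "kappa_inv (Lc f) = q *\<^sub>A Lc (kappa_inv f)" "kappa_inv (Ld f) = q *\<^sub>A Ld (kappa_inv f)"
    by (intro coeffs_eqI, blast)+
qed

lemma kappa_PQ: "kappa (P f) = (q * q) *\<^sub>A P (kappa f)" "kappa_inv (P f) = (p * p) *\<^sub>A P (kappa_inv f)"
  "kappa (Q f) = (p * p) *\<^sub>A Q (kappa f)" "kappa_inv (kappa f) = f"
proof -
  note defs = kappa_def kappa_inv_def P_def Q_def
  have "kappa (P f) m n k = ((q * q) *\<^sub>A P (kappa f)) m n k \<and>
    kappa_inv (P f) m n k = ((p * p) *\<^sub>A P (kappa_inv f)) m n k \<and>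
    kappa (Q f) m n k = ((p * p) *\<^sub>A Q (kappa f)) m n k \<and>
    kappa_inv (kappa f) m n k = f m n k" for m n k
  proof -
    define qi where "qi = p"
    have q_qi: "q * qi = 1" "\<And>t. q * (qi * t) = t"
      by (simp_all add: qi_def)
    define x xi where "x = q powi m" and "xi = q powi (- m)"
    define y yi where "y = q powi n" and "yi = q powi (- n)"
    define z zi where "z = q powi k" and "zi = q powi (- k)"
    note vars = x_def[symmetric] y_def[symmetric] z_def[symmetric] xi_def[symmetric] yi_def[symmetric] zi_def[symmetric]
      qi_def[symmetric] inverse_q power2_eq_square mu_eq
    have inv: "x * xi = 1" "y * yi = 1" "z * zi = 1"
      "\<And>t. x * (xi * t) = t" "\<And>t. y * (yi * t) = t" "\<And>t. z * (zi * t) = t"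
      unfolding x_def xi_def y_def yi_def z_def zi_def mult.assoc[symmetric] powi_cancel by simp_all
    show ?thesis
      by (intro conjI; simp add: defs powi_simps vars; simp add: q_qi inv algebra_simps)
  qed
  then show "kappa (P f) = (q * q) *\<^sub>A P (kappa f)" "kappa_inv (P f) = (p * p) *\<^sub>A P (kappa_inv f)"
    "kappa (Q f) = (p * p) *\<^sub>A Q (kappa f)" "kappa_inv (kappa f) = f"
    by (intro coeffs_eqI, blast)+
qed

text \<open>Twisted Leibniz rules. The extra terms are those of the cross relations for e_a, where v
  e_a contains \<mu> e_b u and u e_a contains \<mu> e_c v. At the top exponents the truncation
  removes only terms whose factor is zero anyway.\<close>

lemma PQ_L:
  assumes f: "f \<in> admissible"
  shows "P (La f) = La (P f)" "P (Lb f) = Lb (P f)"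
    "P (Lc f) = Lc (P f) + \<mu> *\<^sub>A La (kappa f)" "P (Ld f) = Ld (P f) + \<mu> *\<^sub>A Lb (kappa f)"
    "Q (La f) = La (Q f) + \<mu> *\<^sub>A Lc (kappa f)" "Q (Lb f) = Lb (Q f) + \<mu> *\<^sub>A Ld (kappa f)"
    "Q (Lc f) = Lc (Q f)" "Q (Ld f) = Ld (Q f)"
proof -
  note defs = kappa_def P_def Q_def La_def Lb_def Lc_def Ld_def
  have "P (La f) m n k = La (P f) m n k \<and> P (Lb f) m n k = Lb (P f) m n k \<and>
    P (Lc f) m n k = (Lc (P f) + \<mu> *\<^sub>A La (kappa f)) m n k \<and>
    P (Ld f) m n k = (Ld (P f) + \<mu> *\<^sub>A Lb (kappa f)) m n k \<and>
    Q (La f) m n k = (La (Q f) + \<mu> *\<^sub>A Lc (kappa f)) m n k \<and>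
    Q (Lb f) m n k = (Lb (Q f) + \<mu> *\<^sub>A Ld (kappa f)) m n k \<and>
    Q (Lc f) m n k = Lc (Q f) m n k \<and> Q (Ld f) m n k = Ld (Q f) m n k"
    if nk: "n < int r" "k < int r" for m n k
  proof -
    \<comment> \<open>The powers of q become opaque variables with inverses, which turns each rule
      into a polynomial identity. At a top exponent the variable takes the value p, and that case is
      treated apart.\<close>
    define qi where "qi = p"
    have q_qi: "q * qi = 1" "\<And>t. q * (qi * t) = t"
      by (simp_all add: qi_def)
    define x xi where "x = q powi m" and "xi = q powi (- m)"
    define y yi where "y = q powi n" and "yi = q powi (- n)"
    define z zi where "z = q powi k" and "zi = q powi (- k)"
    note vars = x_def[symmetric] y_def[symmetric] z_def[symmetric] xi_def[symmetric] yi_def[symmetric] zi_def[symmetric]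
      qi_def[symmetric] inverse_q power2_eq_square mu_eq
    have inv: "x * xi = 1" "y * yi = 1" "z * zi = 1"
      "\<And>t. x * (xi * t) = t" "\<And>t. y * (yi * t) = t" "\<And>t. z * (zi * t) = t"
      unfolding x_def xi_def y_def yi_def z_def zi_def mult.assoc[symmetric] powi_cancel by simp_all
    have powers: "q ^ 3 = q * (q * q)" "q ^ 4 = q * (q * (q * q))" and nk': "k < 1 + int r" "n < 1 + int r"
      using nk by (simp_all add: eval_nat_numeral)
    have y_edge: "y = p" "yi = q" if "\<not> n + 1 < int r"
      using powi_edge[OF that nk(1)] by (simp_all add: y_def yi_def)
    have z_edge: "z = p" "zi = q" if "\<not> k + 1 < int r"
      using powi_edge[OF that nk(2)] by (simp_all add: z_def zi_def)
    show ?thesis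
      by (cases "n + 1 < int r"; cases "k + 1 < int r"; intro conjI;
        simp add: defs nk nk' powi_simps vars y_edge z_edge; simp add: powers q_qi inv algebra_simps)
  qed
  note pointwise = this
  show "P (La f) = La (P f)" "P (Lb f) = Lb (P f)"
    "P (Lc f) = Lc (P f) + \<mu> *\<^sub>A La (kappa f)" "P (Ld f) = Ld (P f) + \<mu> *\<^sub>A Lb (kappa f)"
    "Q (La f) = La (Q f) + \<mu> *\<^sub>A Lc (kappa f)" "Q (Lb f) = Lb (Q f) + \<mu> *\<^sub>A Ld (kappa f)"
    "Q (Lc f) = Lc (Q f)" "Q (Ld f) = Ld (Q f)"
    by (rule coeffs_eqI_admissible; (intro admissible_closed PQ_admissible L_admissible f | use pointwise in blast))+
qed

section \<open>Closed and exact forms\<close>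

lemmas PQ_simps = PQ_linear[THEN coeffs_linearD(1)] PQ_linear[THEN coeffs_linearD(2)]
  PQ_linear[THEN coeffs_linearD(3)] PQ_linear[THEN coeffs_linearD(4)] PQ_linear[THEN coeffs_linearD(5)]

lemma X_linear: "coeffs_linear X"
  unfolding Vector_Spaces.linear_iff X_def
  by (auto simp: coeffs.vector_space_axioms PQ_simps coeffs.scale_right_distrib mult.commute)

lemmas X_simps = X_linear[THEN coeffs_linearD(1)] X_linear[THEN coeffs_linearD(2)]
  X_linear[THEN coeffs_linearD(3)] X_linear[THEN coeffs_linearD(4)] X_linear[THEN coeffs_linearD(5)]

lemma kappa_kappa_inv: "kappa (kappa_inv f) = f"
proof (rule coeffs_eqI)
  show "kappa (kappa_inv f) m n k = f m n k" for m n k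
    using powi_add[of "m + n - k" "k - m - n"] by (simp add: kappa_def kappa_inv_def)
qed

lemma kappa_inv_Q: "kappa_inv (Q f) = (q * q) *\<^sub>A Q (kappa_inv f)"
proof -
  have "Q (kappa h) = (q * q) *\<^sub>A kappa (Q h)" for h
    by (simp only: kappa_PQ coeffs.scale_scale) (simp add: mult.assoc)
  from this[of "kappa_inv f"] show ?thesis
    by (simp only: kappa_kappa_inv PQ_simps kappa_PQ(4))
qed

lemma X_L:
  assumes f: "f \<in> admissible"
  shows "X (La f) = p *\<^sub>A La (X f) + (q * \<mu>) *\<^sub>A Lc (P f) + (q * \<mu> ^ 2) *\<^sub>A La (kappa f)"
    "X (Lb f) = p *\<^sub>A Lb (X f) + (q * \<mu>) *\<^sub>A Ld (P f) + (q * \<mu> ^ 2) *\<^sub>A Lb (kappa f)"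
    "X (Lc f) = q *\<^sub>A Lc (X f) + (q * \<mu>) *\<^sub>A La (Q f)"
    "X (Ld f) = q *\<^sub>A Ld (X f) + (q * \<mu>) *\<^sub>A Lb (Q f)"
  by (rule coeffs_eqI; simp add: X_def f PQ_L PQ_simps L_simps kappa_L kappa_PQ kappa_inv_Q;
    simp add: power2_eq_square algebra_simps)+

text \<open>The coefficients of f \<theta> with the forms on the left. It is determined by its value
  \<theta> at f = 1 (\<open>act_theta_unit\<close>) and by commuting with left multiplication
  (\<open>rep_twist\<close>).\<close>

fun twist :: "coeffs \<Rightarrow> form \<Rightarrow> coeffs" where
  "twist f Fa = kappa f"
| "twist f Fb = P f"
| "twist f Fc = Q f"
| "twist f Fd = X f + kappa_inv f"
| "twist f _ = 0"

lemma twist_grade: "twist f \<in> grade 1"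
proof -
  have "twist f i = 0" if "form_deg i \<noteq> 1" for i
    using that by (cases i) simp_all
  then show ?thesis by (simp add: grade_def)
qed

lemma twist_add: "twist (f + g) = twist f + twist g"
  and twist_scale: "twist (z *\<^sub>A f) = z *\<^sub>F twist f"
  by (rule vec_eqI, rule coeffs_eqI, case_tac i; simp add: PQ_simps X_simps algebra_simps)+

fun left_mult :: "generator \<Rightarrow> coeffs \<Rightarrow> coeffs" where
  "left_mult Gen_a = La" | "left_mult Gen_b = Lb" | "left_mult Gen_c = Lc" | "left_mult Gen_d = Ld"
| "left_mult _ = id"

lemma left_mult_admissible: "f \<in> admissible \<Longrightarrow> left_mult g f \<in> admissible"
  by (cases g) simp_all

lemma rep_of_coeffs: "gen_deg g = 0 \<Longrightarrow> rep g (of_coeffs f) = of_coeffs (left_mult g f)"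
  using rep_power_of_coeffs[OF L_linear(1,3), of 1 f] rep_power_of_coeffs[OF L_linear(2,4), of 1 f]
  by (cases g) simp_all

lemma rep_twist:
  assumes "gen_deg g = 0" "f \<in> admissible"
  shows "rep g (twist f) = twist (left_mult g f)"
proof (rule vec_eqI, rule coeffs_eqI)
  fix i m n k
  show "rep g (twist f) i m n k = twist (left_mult g f) i m n k"
    using assms(1)
    by (cases g; cases i; simp add: assms(2) PQ_L X_L kappa_L L_simps; simp add: algebra_simps)
qed

definition theta_free :: free_algebra where
  "theta_free = e\<^sub>a + e\<^sub>d"

lemma theta_homogeneous: "theta_free \<in> homogeneous 1"
  unfolding theta_free_def by (intro homogeneous_add homogeneous_gens)

lemma act_theta: "act theta_free v = wedge_a v + wedge_d v"
  by (simp add: theta_free_def act_add act_gen)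

lemma act_theta_unit: "act theta_free unit_vec_A = twist (mono 0 0 0)"
proof -
  have "kappa (mono 0 0 0) = mono 0 0 0" "kappa_inv (mono 0 0 0) = mono 0 0 0"
    by (rule coeffs_eqI; simp add: kappa_def kappa_inv_def mono_def powi_dvd dvd_minus_iff)+
  moreover have "P (mono 0 0 0) = 0"
    by (rule coeffs_eqI, case_tac "k = - 1") (auto simp: P_def mono_def)
  moreover have "Q (mono 0 0 0) = 0"
  proof (rule coeffs_eqI)
    fix m n k
    have "q powi (2 * m + 2) = 1" if "int r dvd m + 1"
    proof -
      have "2 * m + 2 = (m + 1) + (m + 1)" by simp
      then show ?thesis by (simp only: powi_add[of "m + 1" "m + 1"] powi_dvd[OF that] mult_1)
    qed
    then show "Q (mono 0 0 0) m n k = (0 :: coeffs) m n k"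
      by (cases "n = - 1") (auto simp: Q_def mono_def)
  qed
  ultimately show ?thesis
    unfolding act_theta
    by (intro vec_eqI coeffs_eqI, case_tac i) (simp_all add: X_def PQ_simps)
qed

text \<open>A word of functions is followed on 1 and on \<theta> at the same time; equivariance of
  \<open>twist\<close> keeps the two results related as f and f \<theta>.\<close>

lemma act_word_twist:
  assumes "form_degree (Free_Monoid gs) = 0"
  shows "\<exists>f\<in>admissible. act_word gs unit_vec_A = of_coeffs f \<and> act_word gs (twist (mono 0 0 0)) = twist f"
  using assms
proof (induction gs)
  case Nil
  have "mono 0 0 0 \<in> admissible" using r_ge by (intro mono_admissible) auto
  then show ?case by (auto simp: act_word_def)
next
  case (Cons g gs)
  then have g: "gen_deg g = 0" "form_degree (Free_Monoid gs) = 0"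
    by (simp_all add: form_degree_Cons)
  then obtain f where "f \<in> admissible" "act_word gs unit_vec_A = of_coeffs f"
      "act_word gs (twist (mono 0 0 0)) = twist f"
    using Cons.IH by blast
  then show ?case
    using rep_twist[OF g(1)] rep_of_coeffs[OF g(1)] left_mult_admissible
    by (auto simp: act_word_def)
qed

lemma act_twist:
  assumes "x \<in> homogeneous 0"
  shows "act x (twist (mono 0 0 0)) = twist (act x unit_vec_A F1)"
proof -
  have word: "act_word (letters w) (twist (mono 0 0 0)) = twist (act_word (letters w) unit_vec_A F1)"
    if "w \<in> Poly_Mapping.keys x" for w
    using assms that act_word_twist[of "letters w"] by (auto simp: homogeneous_def)
  have zero: "twist 0 = 0"
    using twist_scale[of 0 0] by (simp only: coeffs.scale_zero_left vec.scale_zero_left)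
  have sum: "twist (sum f A) = (\<Sum>i\<in>A. twist (f i))" for f :: "generator free_monoid \<Rightarrow> coeffs" and A
    by (induction A rule: infinite_finite_induct)
      (simp_all only: sum.infinite sum.empty sum.insert twist_add zero not_False_eq_True)
  have apply_F1: "(\<Sum>i\<in>A. f i) F1 = (\<Sum>i\<in>A. f i F1)" for f :: "generator free_monoid \<Rightarrow> form \<Rightarrow> coeffs" and A
    by (induction A rule: infinite_finite_induct)
      (simp_all only: sum.infinite sum.empty sum.insert not_False_eq_True plus_fun_apply zero_fun_apply)
  show ?thesis
    unfolding act_def apply_F1 sum
    by (intro sum.cong refl) (simp only: word scale_vec_apply[of _ _ F1] twist_scale)
qed

section \<open>The differential in coordinates\<close>

definition vec_d0 :: "coeffs \<Rightarrow> form \<Rightarrow> coeffs" where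
  "vec_d0 f = twist f - (wedge_a (of_coeffs f) + wedge_d (of_coeffs f))"

text \<open>The first two summands are \<theta> x, the bracket is x \<theta>. The overall sign of
  \<open>ext_d\<close> is dropped, which does not change the kernel.\<close>

definition vec_d1 :: "(form \<Rightarrow> coeffs) \<Rightarrow> form \<Rightarrow> coeffs" where
  "vec_d1 v = wedge_a v + wedge_d v + (wedge_a (twist (v Fa)) + wedge_b (twist (v Fb))
    + wedge_c (twist (v Fc)) + wedge_d (twist (v Fd)))"

lemma grade_1_admissible:
  assumes "x \<in> homogeneous 1"
  shows "act x unit_vec_A \<in> admissible_vec" "act x unit_vec_A \<in> grade 1" "act x unit_vec_A \<in> low"
  using act_grade[OF assms] act_admissible[OF unit_admissible] grade_low by auto

lemma grade_0_of_coeffs: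
  assumes "x \<in> homogeneous 0"
  shows "act x unit_vec_A = of_coeffs (act x unit_vec_A F1)"
proof (rule vec_eqI)
  fix i
  have "form_deg i \<noteq> 0" if "i \<noteq> F1"
    using that by (cases i) simp_all
  then show "act x unit_vec_A i = of_coeffs (act x unit_vec_A F1) i"
    using act_grade[OF assms] by (cases "i = F1") (simp_all add: grade_def)
qed

lemma act_d0:
  assumes "y \<in> homogeneous 0"
  shows "act (y * theta_free - theta_free * y) unit_vec_A = vec_d0 (act y unit_vec_A F1)"
  using act_twist[OF assms] grade_0_of_coeffs[OF assms]
  by (simp only: act_diff act_mult act_theta_unit vec_d0_def act_theta[of "act y _"])

text \<open>This takes the place of faithfulness in degree two: with \<theta> x + x \<theta> in
  normal form, a vanishing \<open>vec_d1\<close> forces it to vanish in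
  \<open>Omega\<close>.\<close>

lemma NF_d1:
  assumes x: "x \<in> homogeneous 1"
  shows "theta_free * x + x * theta_free \<approx>\<^sub>\<Omega> NF (vec_d1 (act x unit_vec_A))"
proof -
  define v where "v = act x unit_vec_A"
  have v: "v \<in> admissible_vec" "v \<in> grade 1" "v \<in> low"
    using grade_1_admissible[OF x] by (simp_all add: v_def)
  have adm: "v i \<in> admissible" for i
    using v by (simp add: admissible_vec_def)
  have xv: "x \<approx>\<^sub>\<Omega> NF v"
    using NF_act[OF x] by (simp add: v_def)
  have "NF v = e\<^sub>a * nf (v Fa) + e\<^sub>b * nf (v Fb) + e\<^sub>c * nf (v Fc) + e\<^sub>d * nf (v Fd)"
    using v by (simp add: NF_low grade_def)
  then have NF_theta: "NF v * theta_free = e\<^sub>a * (nf (v Fa) * theta_free) + e\<^sub>b * (nf (v Fb) * theta_free)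
      + e\<^sub>c * (nf (v Fc) * theta_free) + e\<^sub>d * (nf (v Fd) * theta_free)"
    by (simp add: distrib_right mult.assoc)
  have nf_theta: "nf f * theta_free \<approx>\<^sub>\<Omega> NF (twist f)" if f: "f \<in> admissible" for f
  proof -
    have "nf f * theta_free \<approx>\<^sub>\<Omega> NF (act (nf f * theta_free) unit_vec_A)"
      by (intro NF_act[of _ 1] homogeneous_mult_1 nf_homogeneous theta_homogeneous order_refl)
    also have "act (nf f * theta_free) unit_vec_A = twist f"
      by (simp only: act_mult act_theta_unit act_twist[OF nf_homogeneous] act_nf[OF f] of_coeffs_simps)
    finally show ?thesis .
  qed
  have low: "twist f \<in> low" for f
    using grade_low[OF twist_grade] by simp
  have wedge: "e * (nf f * theta_free) \<approx>\<^sub>\<Omega> NF w"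
    if "f \<in> admissible" "e * NF (twist f) \<approx>\<^sub>\<Omega> NF w" for e f w
    using cong_mult[OF cong_refl[of _ _ e] nf_theta[OF that(1)]] that(2) cong_trans by blast
  have "theta_free * x + x * theta_free \<approx>\<^sub>\<Omega> theta_free * NF v + NF v * theta_free"
    by (intro cong_add cong_mult cong_refl xv)
  also have "\<dots> = (e\<^sub>a * NF v + e\<^sub>d * NF v) + NF v * theta_free"
    by (simp add: theta_free_def distrib_right)
  also have "\<dots> \<approx>\<^sub>\<Omega> (NF (wedge_a v) + NF (wedge_d v)) +
      (NF (wedge_a (twist (v Fa))) + NF (wedge_b (twist (v Fb))) + NF (wedge_c (twist (v Fc)))
      + NF (wedge_d (twist (v Fd))))"
    unfolding NF_theta by (intro cong_add NF_wedge wedge adm low v)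
  also have "\<dots> = NF (vec_d1 v)"
    by (simp only: vec_d1_def NF_add)
  finally show ?thesis by (simp add: v_def)
qed

lemma act_d1:
  assumes x: "x \<in> homogeneous 1"
  shows "act (theta_free * x + x * theta_free) unit_vec_A = vec_d1 (act x unit_vec_A)"
proof -
  define v where "v = act x unit_vec_A"
  have v: "v \<in> admissible_vec" "v \<in> grade 1" "v \<in> low"
    using grade_1_admissible[OF x] by (simp_all add: v_def)
  have adm: "v i \<in> admissible" for i
    using v by (simp add: admissible_vec_def)
  have "x \<approx>\<^sub>\<Omega> NF v"
    using NF_act[OF x] by (simp add: v_def)
  moreover have "NF v = e\<^sub>a * nf (v Fa) + e\<^sub>b * nf (v Fb) + e\<^sub>c * nf (v Fc) + e\<^sub>d * nf (v Fd)"
    using v by (simp add: NF_low grade_def)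
  ultimately have x': "x \<approx>\<^sub>\<Omega> e\<^sub>a * nf (v Fa) + e\<^sub>b * nf (v Fb) + e\<^sub>c * nf (v Fc) + e\<^sub>d * nf (v Fd)"
    by simp
  have tw: "act (nf f) (twist (mono 0 0 0)) = twist f" if "f \<in> admissible" for f
    by (simp only: act_twist[OF nf_homogeneous] act_nf[OF that] of_coeffs_simps)
  have "act x (twist (mono 0 0 0)) = wedge_a (twist (v Fa)) + wedge_b (twist (v Fb))
      + wedge_c (twist (v Fc)) + wedge_d (twist (v Fd))"
    by (subst cong_act[OF x' act_admissible[OF unit_admissible, of theta_free, unfolded act_theta_unit]])
      (simp only: act_add act_mult act_gen rep.simps tw[OF adm])
  then show ?thesis
    by (simp only: act_add act_mult act_theta_unit vec_d1_def v_def[symmetric] act_theta[of v])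
qed

lemma closed_iff:
  assumes x: "x \<in> homogeneous 1"
  shows "theta_free * x + x * theta_free \<approx>\<^sub>\<Omega> 0 \<longleftrightarrow> vec_d1 (act x unit_vec_A) = 0"
proof
  assume "theta_free * x + x * theta_free \<approx>\<^sub>\<Omega> 0"
  then show "vec_d1 (act x unit_vec_A) = 0"
    using cong_act[OF _ unit_admissible] act_d1[OF x] act_zero by metis
next
  assume "vec_d1 (act x unit_vec_A) = 0"
  then show "theta_free * x + x * theta_free \<approx>\<^sub>\<Omega> 0"
    using NF_d1[OF x] by (simp add: NF_zero)
qed

lemma theta_square: "theta_free * theta_free \<approx>\<^sub>\<Omega> 0"
proof -
  have "theta_free * theta_free = e\<^sub>a * e\<^sub>a + e\<^sub>a * e\<^sub>d + e\<^sub>d * e\<^sub>a + e\<^sub>d * e\<^sub>d"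
    by (simp add: theta_free_def algebra_simps)
  also have "\<dots> \<approx>\<^sub>\<Omega> scalar \<mu> * e\<^sub>b * e\<^sub>c + (- (e\<^sub>d * e\<^sub>a) - scalar \<mu> * e\<^sub>b * e\<^sub>c) + e\<^sub>d * e\<^sub>a + 0"
    by (intro cong_add cong_refl form_congs)
  finally show ?thesis by simp
qed

lemma exact_closed:
  "theta_free * (y * theta_free - theta_free * y) + (y * theta_free - theta_free * y) * theta_free \<approx>\<^sub>\<Omega> 0"
proof -
  have "theta_free * (y * theta_free - theta_free * y) + (y * theta_free - theta_free * y) * theta_free
      = y * (theta_free * theta_free) - (theta_free * theta_free) * y"
    by (simp add: algebra_simps)
  also have "\<dots> \<approx>\<^sub>\<Omega> y * 0 - 0 * y"
    by (intro cong_diff cong_mult cong_refl theta_square)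
  finally show ?thesis by simp
qed

text \<open>Deduced from \<theta> \<theta> = 0 in \<open>Omega\<close>, which avoids checking
  commutation identities between \<kappa>, P and Q.\<close>

lemma vec_d1_d0:
  assumes f: "f \<in> admissible"
  shows "vec_d1 (vec_d0 f) = 0"
proof -
  let ?x = "nf f * theta_free - theta_free * nf f"
  have "?x \<in> homogeneous 1"
    by (intro homogeneous_diff homogeneous_mult_1 nf_homogeneous theta_homogeneous)
  moreover have "act ?x unit_vec_A = vec_d0 f"
    by (simp only: act_d0[OF nf_homogeneous] act_nf[OF f] of_coeffs_simps)
  ultimately show ?thesis
    using closed_iff[of ?x] exact_closed by simp
qed

lemma vec_d0_simps: "vec_d0 f Fa = kappa f - f" "vec_d0 f Fb = P f" "vec_d0 f Fc = Q f"
  "vec_d0 f Fd = X f + kappa_inv f - f"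
  by (rule coeffs_eqI; simp add: vec_d0_def)+

lemma vec_d0_grade: "vec_d0 f \<in> grade 1"
proof -
  have "vec_d0 f i = 0" if "form_deg i \<noteq> 1" for i
    using that by (cases i) (auto simp: vec_d0_def intro!: coeffs_eqI)
  then show ?thesis by (simp add: grade_def)
qed

lemma vec_d1_linear:
  "vec_d1 (v + w) = vec_d1 v + vec_d1 w" "vec_d1 (z *\<^sub>F v) = z *\<^sub>F vec_d1 v"
  "vec_d1 (v - w) = vec_d1 v - vec_d1 w"
proof -
  show add: "vec_d1 (v + w) = vec_d1 v + vec_d1 w" for v w
    by (simp only: vec_d1_def plus_fun_apply[of v w Fa] plus_fun_apply[of v w Fb] plus_fun_apply[of v w Fc]
        plus_fun_apply[of v w Fd] twist_add wedge_linear ac_simps)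
  show scale: "vec_d1 (z *\<^sub>F v) = z *\<^sub>F vec_d1 v" for z v
    by (simp only: vec_d1_def scale_vec_apply[of z v Fa] scale_vec_apply[of z v Fb]
        scale_vec_apply[of z v Fc] scale_vec_apply[of z v Fd] twist_scale wedge_linear vec.scale_right_distrib)
  show "vec_d1 (v - w) = vec_d1 v - vec_d1 w"
    using add[of v "(-1) *\<^sub>F w"] scale[of "-1" w]
    by (simp only: vec.scale_minus_left vec.scale_one add_uminus_conv_diff)
qed

text \<open>The components along e_b e_a, e_c e_a, e_d e_a, e_b e_c, e_b e_d, e_c e_d, in this
  order. The first three are inhomogeneous eigenvalue equations for \<open>kappa\<close> and control
  the row degrees; the others link the coefficients through P and Q.\<close>

lemma vec_d1_equations:
  assumes "vec_d1 v = 0"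
  shows "kappa (v Fb) - (q * q) *\<^sub>A v Fb - (q * q) *\<^sub>A P (v Fa) = 0"
    "kappa (v Fc) - (p * p) *\<^sub>A v Fc - (p * p) *\<^sub>A Q (v Fa) = 0"
    "kappa (v Fd) - v Fd + v Fa - kappa_inv (v Fa) - X (v Fa) = 0"
    "\<mu> *\<^sub>A v Fa - \<mu> *\<^sub>A v Fd + \<mu> *\<^sub>A kappa (v Fa) - \<mu> *\<^sub>A (X (v Fa) + kappa_inv (v Fa))
      + Q (v Fb) - P (v Fc) = 0"
    "(\<mu> - 1) *\<^sub>A v Fb + \<mu> *\<^sub>A P (v Fa) + X (v Fb) + kappa_inv (v Fb) - P (v Fd) = 0"
    "- (p ^ 2 * \<mu>) *\<^sub>A v Fc - v Fc - (p ^ 2 * \<mu>) *\<^sub>A Q (v Fa) + X (v Fc) + kappa_inv (v Fc) - Q (v Fd) = 0"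
proof -
  have eqs: "f = 0" if "\<And>m n k. f m n k = vec_d1 v i m n k" for f :: coeffs and i
    using that assms by (intro coeffs_eqI) simp
  note simps = power2_eq_square left_diff_distrib right_diff_distrib distrib_left distrib_right
  show "kappa (v Fb) - (q * q) *\<^sub>A v Fb - (q * q) *\<^sub>A P (v Fa) = 0"
    by (rule eqs[of _ Fba]) (simp add: vec_d1_def; simp add: simps)
  show "kappa (v Fc) - (p * p) *\<^sub>A v Fc - (p * p) *\<^sub>A Q (v Fa) = 0"
    by (rule eqs[of _ Fca]) (simp add: vec_d1_def; simp add: simps)
  show "kappa (v Fd) - v Fd + v Fa - kappa_inv (v Fa) - X (v Fa) = 0"
    by (rule eqs[of _ Fda]) (simp add: vec_d1_def; simp add: simps)
  show "\<mu> *\<^sub>A v Fa - \<mu> *\<^sub>A v Fd + \<mu> *\<^sub>A kappa (v Fa) - \<mu> *\<^sub>A (X (v Fa) + kappa_inv (v Fa))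
      + Q (v Fb) - P (v Fc) = 0"
    by (rule eqs[of _ Fbc]) (simp add: vec_d1_def; simp add: simps)
  show "(\<mu> - 1) *\<^sub>A v Fb + \<mu> *\<^sub>A P (v Fa) + X (v Fb) + kappa_inv (v Fb) - P (v Fd) = 0"
    by (rule eqs[of _ Fbd]) (simp add: vec_d1_def; simp add: simps)
  show "- (p ^ 2 * \<mu>) *\<^sub>A v Fc - v Fc - (p ^ 2 * \<mu>) *\<^sub>A Q (v Fa) + X (v Fc) + kappa_inv (v Fc) - Q (v Fd) = 0"
      proof -
    define A where "A = p ^ 2 * \<mu>"
    show ?thesis
      by (rule eqs[of _ Fcd])
        (simp only: vec_d1_def plus_fun_apply wedge_a.simps wedge_b.simps wedge_c.simps wedge_d.simps
          twist.simps scale_coeffs_apply coeffs_apply A_def[symmetric]; simp)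
  qed
qed

section \<open>The first cohomology\<close>

lemma powi_cong: "int r dvd m - n \<Longrightarrow> q powi m = q powi n"
  using powi_add[of "m - n" n] powi_dvd[of "m - n"] by simp

lemma mono_eq_iff: "mono m n k m' n' k' = (if int r dvd m' - m \<and> n' = n \<and> k' = k then 1 else 0)"
  by (simp add: mono_def)

lemma mono_period:
  assumes "int r dvd m - m'"
  shows "mono m n k = mono m' n k"
proof -
  have "int r dvd x - m \<longleftrightarrow> int r dvd x - m'" for x
  proof -
    have "x - m' = (m - m') + (x - m)" by simp
    then show ?thesis by (simp only: dvd_add_right_iff[OF assms])
  qed
  then show ?thesis by (simp add: mono_def)
qed

lemma kappa_mono: "kappa (mono m n k) = q powi (m + n - k) *\<^sub>A mono m n k"
  "kappa_inv (mono m n k) = q powi (k - m - n) *\<^sub>A mono m n k"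
proof -
  have "kappa (mono m n k) m' n' k' = (q powi (m + n - k) *\<^sub>A mono m n k) m' n' k' \<and>
    kappa_inv (mono m n k) m' n' k' = (q powi (k - m - n) *\<^sub>A mono m n k) m' n' k'" for m' n' k'
  proof (cases "int r dvd m' - m")
    case True
    then have "int r dvd m - m'"
      using dvd_minus_iff[of "int r" "m' - m"] by simp
    then have "q powi (m' + n - k) = q powi (m + n - k)" "q powi (k - m' - n) = q powi (k - m - n)"
      using True by (intro powi_cong; simp)+
    then show ?thesis by (auto simp: kappa_def kappa_inv_def mono_eq_iff)
  qed (simp add: kappa_def kappa_inv_def mono_eq_iff)
  then show "kappa (mono m n k) = q powi (m + n - k) *\<^sub>A mono m n k"
    "kappa_inv (mono m n k) = q powi (k - m - n) *\<^sub>A mono m n k"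
    by (intro coeffs_eqI, blast)+
qed

lemma P_mono: "P (mono m n k) = (q powi (n - 1) * (q powi k - q powi (- k))) *\<^sub>A mono (m + 1) n (k - 1)"
proof (rule coeffs_eqI)
  fix m' n' k'
  have "int r dvd m' - 1 - m \<longleftrightarrow> int r dvd m' - (m + 1)"
    by (simp add: algebra_simps)
  then show "P (mono m n k) m' n' k' =
      ((q powi (n - 1) * (q powi k - q powi (- k))) *\<^sub>A mono (m + 1) n (k - 1)) m' n' k'"
    by (auto simp: P_def mono_eq_iff)
qed

lemma Q_mono:
  assumes "k < int r"
  shows "Q (mono m n k) =
    (if k + 1 < int r then q powi (- 2 - k) * (q powi (2 * m + n) - q powi (- n)) else 0) *\<^sub>A mono (m - 1) n (k + 1)
    + (q powi (- 1 - k) * (q powi n - q powi (- n))) *\<^sub>A mono (m - 1) (n - 1) k"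
proof (rule coeffs_eqI)
  fix m' n' k'
  have m: "m' + 1 - m = m' - (m - 1)" by simp
  have "q powi (2 * m' + 2 + n) = q powi (2 * m + n)" if "int r dvd m' - (m - 1)"
  proof (rule powi_cong)
    have "2 * m' + 2 + n - (2 * m + n) = 2 * (m' - (m - 1))" by simp
    then show "int r dvd 2 * m' + 2 + n - (2 * m + n)"
      using that by (metis dvd_mult)
  qed
  then show "Q (mono m n k) m' n' k' =
    ((if k + 1 < int r then q powi (- 2 - k) * (q powi (2 * m + n) - q powi (- n)) else 0) *\<^sub>A mono (m - 1) n (k + 1)
    + (q powi (- 1 - k) * (q powi n - q powi (- n))) *\<^sub>A mono (m - 1) (n - 1) k) m' n' k'"
    using assms by (cases "k' = k + 1"; cases "n' = n - 1") (auto simp: Q_def mono_eq_iff m)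
qed

definition one_form :: "coeffs \<Rightarrow> coeffs \<Rightarrow> coeffs \<Rightarrow> coeffs \<Rightarrow> form \<Rightarrow> coeffs" where
  "one_form fa fb fc fd = (\<lambda>i. case i of Fa \<Rightarrow> fa | Fb \<Rightarrow> fb | Fc \<Rightarrow> fc | Fd \<Rightarrow> fd | _ \<Rightarrow> 0)"

lemma one_form_simps [simp]: "one_form fa fb fc fd F1 = 0" "one_form fa fb fc fd Fa = fa"
  "one_form fa fb fc fd Fb = fb" "one_form fa fb fc fd Fc = fc" "one_form fa fb fc fd Fd = fd"
  "one_form fa fb fc fd Fba = 0" "one_form fa fb fc fd Fca = 0" "one_form fa fb fc fd Fda = 0"
  "one_form fa fb fc fd Fbc = 0" "one_form fa fb fc fd Fbd = 0" "one_form fa fb fc fd Fcd = 0"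
  by (simp_all add: one_form_def)

definition theta_vec :: "form \<Rightarrow> coeffs" where
  "theta_vec = one_form (mono 0 0 0) 0 0 (mono 0 0 0)"

definition h1_vec :: "form \<Rightarrow> coeffs" where
  "h1_vec = one_form 0 (mono 1 0 (int r - 1)) 0 0"

definition h2_vec :: "form \<Rightarrow> coeffs" where
  "h2_vec = one_form 0 0 (mono (- 1) (int r - 1) 0) 0"

definition n_vec :: "form \<Rightarrow> coeffs" where
  "n_vec = one_form (mono 0 0 0) 0 (mono (- 1) 0 1) 0"

definition closed_vecs :: "(form \<Rightarrow> coeffs) set" where
  "closed_vecs = {v \<in> admissible_vec \<inter> grade 1. vec_d1 v = 0}"

lemma one_form_grade: "one_form fa fb fc fd \<in> grade 1"
proof -
  have "one_form fa fb fc fd i = 0" if "form_deg i \<noteq> 1" for i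
    using that by (cases i) simp_all
  then show ?thesis by (simp add: grade_def)
qed

lemma class_vecs_grade: "theta_vec \<in> grade 1" "h1_vec \<in> grade 1" "h2_vec \<in> grade 1" "n_vec \<in> grade 1"
  by (simp_all only: theta_vec_def h1_vec_def h2_vec_def n_vec_def one_form_grade)

lemma one_form_admissible:
  "fa \<in> admissible \<Longrightarrow> fb \<in> admissible \<Longrightarrow> fc \<in> admissible \<Longrightarrow> fd \<in> admissible \<Longrightarrow>
    one_form fa fb fc fd \<in> admissible_vec"
  unfolding admissible_vec_def by (intro CollectI allI, case_tac i) simp_all

lemma r_bounds: "(0::int) < int r - 1" "(2::int) < int r" "(1::int) < int r" "(0::int) \<le> int r - 1"
  using r_ge by simp_all

lemma powi_r: "q powi (int r - 1) = p" "q powi (1 - int r) = q" "q powi (2 - int r) = q * q"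
  "q powi (int r - 2) = p * p"
  using powi_expand(2)[of "int r" 1] powi_expand(2)[of "int r" 2] powi_expand(2)[of 1 "int r"]
    powi_expand(2)[of 2 "int r"] powi_dvd[of "int r"] powi_period_neg powi_expand(7-9)
  by simp_all

lemma powi_r': "q powi (int r - 3) = p * (p * p)" "q powi (- 3) = p * (p * p)"
  using powi_expand(2)[of "int r" 3] powi_expand(1)[of "- 1" "- 2"] powi_dvd[of "int r"] powi_expand(7-9)
  by simp_all

lemma PQ_zero: "kappa 0 = 0" "kappa_inv 0 = 0" "P 0 = 0" "Q 0 = 0" "X 0 = 0"
  by (rule PQ_simps X_simps)+

lemma PQ_unit: "kappa (mono 0 0 0) = mono 0 0 0" "kappa_inv (mono 0 0 0) = mono 0 0 0"
  "P (mono 0 0 0) = 0" "Q (mono 0 0 0) = 0" "X (mono 0 0 0) = 0"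
proof -
  show "kappa (mono 0 0 0) = mono 0 0 0" "kappa_inv (mono 0 0 0) = mono 0 0 0" "P (mono 0 0 0) = 0"
    by (simp_all add: kappa_mono P_mono)
  show Q: "Q (mono 0 0 0) = 0"
    using r_bounds by (simp add: Q_mono)
  show "X (mono 0 0 0) = 0"
    by (simp only: X_def Q PQ_zero coeffs.scale_zero_right)
qed

lemma h1_closed: "h1_vec \<in> closed_vecs"
proof -
  let ?h = "mono 1 0 (int r - 1)"
  have K: "kappa ?h = (q * q) *\<^sub>A ?h" "kappa_inv ?h = (p * p) *\<^sub>A ?h"
    by (simp_all add: kappa_mono powi_r)
  \<comment> \<open>The first term of Q is cut off by c^r = 0, the second has the factor q^0 - q^0
    because there is no b.\<close>
  have Q: "Q ?h = 0"
    by (simp add: Q_mono)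
  have X: "X ?h = 0"
    by (simp only: X_def Q PQ_zero coeffs.scale_zero_right)
  have "vec_d1 h1_vec i m n k = 0" for i m n k
    by (cases i; simp add: vec_d1_def h1_vec_def PQ_zero K Q X; simp add: mu_eq power2_eq_square algebra_simps)
  then have "vec_d1 h1_vec = 0"
    by (intro vec_eqI coeffs_eqI) simp
  moreover have "h1_vec \<in> admissible_vec"
    unfolding h1_vec_def using r_bounds by (intro one_form_admissible mono_admissible admissible_closed) auto
  ultimately show ?thesis
    using class_vecs_grade by (simp add: closed_vecs_def)
qed

lemma h2_closed: "h2_vec \<in> closed_vecs"
proof -
  let ?h = "mono (- 1) (int r - 1) 0"
  have K: "kappa ?h = (p * p) *\<^sub>A ?h" "kappa_inv ?h = (q * q) *\<^sub>A ?h"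
    by (simp_all add: kappa_mono powi_r)
  have P: "P ?h = 0"
    by (simp add: P_mono)
  \<comment> \<open>Of the two terms of Q h, P kills the one without c and turns the other back into
    a multiple of h. So h is an eigenvector of X.\<close>
  have "P (Q ?h) = (p * p * (p * (p * p) - q) * (p * p * (q - p))) *\<^sub>A ?h"
    using r_bounds
    by (simp add: Q_mono P_mono PQ_simps powi_r powi_r' powi_expand(9) powi_expand(7) inverse_q)
  then have X: "X ?h = ((p * (p * p) - q) * (q - p)) *\<^sub>A ?h"
    by (simp add: X_def PQ_simps K; simp add: algebra_simps)
  have "vec_d1 h2_vec i m n k = 0" for i m n k
    by (cases i; simp add: vec_d1_def h2_vec_def PQ_zero K P X; simp add: mu_eq power2_eq_square algebra_simps)
  then have "vec_d1 h2_vec = 0"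
    by (intro vec_eqI coeffs_eqI) simp
  moreover have "h2_vec \<in> admissible_vec"
    unfolding h2_vec_def using r_bounds by (intro one_form_admissible mono_admissible admissible_closed) auto
  ultimately show ?thesis
    using class_vecs_grade by (simp add: closed_vecs_def)
qed

lemma n_closed: "n_vec \<in> closed_vecs"
proof -
  let ?h = "mono (- 1) 0 1"
  have K: "kappa ?h = (p * p) *\<^sub>A ?h" "kappa_inv ?h = (q * q) *\<^sub>A ?h"
    by (simp_all add: kappa_mono powi_expand(8,9) power2_eq_square)
  have P: "P ?h = (p * (q - p)) *\<^sub>A mono 0 0 0"
    by (simp add: P_mono powi_expand(7) inverse_q)
  \<comment> \<open>Here Q h is a multiple of a^(-2) c^2, which is not truncated as r > 2, and P
    returns it to a multiple of h.\<close>
  have "P (Q ?h) = (p * (p * p) * (p * p - 1) * (p * (q * q - p * p))) *\<^sub>A ?h"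
    using r_bounds
    by (simp add: Q_mono P_mono PQ_simps powi_r' powi_expand(8) powi_expand(9) powi_expand(7)
        inverse_q power2_eq_square)
  then have X: "X ?h = ((p * p - 1) * (q * q - p * p)) *\<^sub>A ?h"
    by (simp add: X_def PQ_simps K; simp add: algebra_simps)
  have "vec_d1 n_vec i m n k = 0" for i m n k
    by (cases i; simp add: vec_d1_def n_vec_def PQ_zero PQ_unit K P X; simp add: mu_eq power2_eq_square algebra_simps)
  then have "vec_d1 n_vec = 0"
    by (intro vec_eqI coeffs_eqI) simp
  moreover have "n_vec \<in> admissible_vec"
    unfolding n_vec_def using r_bounds by (intro one_form_admissible mono_admissible admissible_closed) auto
  ultimately show ?thesis
    using class_vecs_grade by (simp add: closed_vecs_def)
qed

section \<open>Normalizing closed one-forms by exact ones\<close>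

lemma powi_diff_nonzero: "0 < k \<Longrightarrow> k < int r \<Longrightarrow> q powi k - q powi (- k) \<noteq> 0"
proof
  assume k: "0 < k" "k < int r" and eq: "q powi k - q powi (- k) = 0"
  then have "q powi k * q powi k = 1"
    using powi_cancel[of k] by simp
  then have "q powi (int (2 * nat k)) = 1"
    using powi_expand(3)[of k] k by simp
  then have "q ^ (2 * nat k) = 1"
    by (simp only: power_int_of_nat)
  then show False
    using q_power_even[of "nat k"] k by simp
qed

lemma P_at: "P f (m + 1) n (k - 1) = q powi (n - 1) * (q powi k - q powi (- k)) * f m n k"
  by (simp add: P_def)

lemma Q_at:
  assumes "k < int r"
  shows "Q f (m - 1) n k = q powi (- 1 - k) * ((q powi (2 * m + n) - q powi (- n)) * f m n (k - 1)
    + (q powi (n + 1) - q powi (- n - 1)) * f m (n + 1) k)"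
proof -
  have "2 * (m - 1) + 2 + n = 2 * m + n" "m - 1 + 1 = m" by simp_all
  then show ?thesis by (simp only: Q_def assms if_True)
qed

lemma P_zero_support:
  assumes f: "f \<in> admissible" and P: "P f = 0" and k: "k \<noteq> 0"
  shows "f m n k = 0"
proof (cases "0 < k \<and> k < int r")
  case True
  have "P f (m + 1) n (k - 1) = 0" using P by simp
  then show ?thesis
    using powi_diff_nonzero[of k] True by (simp add: P_at)
next
  case False
  then show ?thesis using admissible_outside[OF f] k by auto
qed

lemma kappa_eigen_inv: "kappa f = z *\<^sub>A f \<Longrightarrow> w * z = 1 \<Longrightarrow> kappa_inv f = w *\<^sub>A f"
proof -
  assume f: "kappa f = z *\<^sub>A f" and w: "w * z = 1"
  have "f = kappa_inv (z *\<^sub>A f)"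
    by (simp only: f[symmetric] kappa_PQ(4))
  then have "f = z *\<^sub>A kappa_inv f"
    by (simp only: PQ_simps)
  then have "w *\<^sub>A f = w *\<^sub>A (z *\<^sub>A kappa_inv f)"
    by (rule arg_cong)
  then show ?thesis by (simp only: w coeffs.scale_scale coeffs.scale_one)
qed

lemma kappa_eigen_support: "kappa f = z *\<^sub>A f \<Longrightarrow> f m n k \<noteq> 0 \<Longrightarrow> q powi (m + n - k) = z"
proof -
  assume "kappa f = z *\<^sub>A f" "f m n k \<noteq> 0"
  moreover have "kappa f m n k = q powi (m + n - k) * f m n k"
    by (simp add: kappa_def)
  ultimately show ?thesis by simp
qed

lemma kappa_eigenI: "(\<And>m n k. f m n k \<noteq> 0 \<Longrightarrow> q powi (m + n - k) = z) \<Longrightarrow> kappa f = z *\<^sub>A f"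
  by (rule coeffs_eqI) (auto simp: kappa_def)

lemma powi_eq_one_dvd: "q powi m = 1 \<Longrightarrow> int r dvd m"
proof -
  assume m: "q powi m = 1"
  have "q powi m = q powi (m mod int r)"
    by (rule powi_cong) (simp add: minus_mod_eq_mult_div)
  also have "\<dots> = q ^ nat (m mod int r)"
    using r_ge by (subst power_int_of_nat[symmetric]) simp
  finally have "q ^ nat (m mod int r) = 1" using m by simp
  moreover have "nat (m mod int r) < r"
    using r_ge by (simp add: nat_less_iff)
  ultimately have "nat (m mod int r) = 0"
    using q_primitive[of "nat (m mod int r)"] by (metis neq0_conv)
  moreover have "0 \<le> m mod int r"
    using r_ge by simp
  ultimately have "m mod int r = 0"
    by linarith
  then show ?thesis by auto
qed

lemma closedD:
  assumes "v \<in> closed_vecs"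
  shows "v i \<in> admissible" "v \<in> grade 1" "vec_d1 v = 0" "v \<in> admissible_vec"
  using assms by (auto simp: closed_vecs_def admissible_vec_def)

lemma closed_vecs_diff: "v \<in> closed_vecs \<Longrightarrow> w \<in> closed_vecs \<Longrightarrow> v - w \<in> closed_vecs"
  using vec.subspace_diff[OF admissible_vec_subspace] vec.subspace_diff[OF grade_subspace]
  by (auto simp: closed_vecs_def vec_d1_linear)

lemma closed_vecs_scale: "v \<in> closed_vecs \<Longrightarrow> z *\<^sub>F v \<in> closed_vecs"
  using vec.subspace_scale[OF admissible_vec_subspace] vec.subspace_scale[OF grade_subspace]
  by (auto simp: closed_vecs_def vec_d1_linear)

lemma vec_d0_closed:
  assumes f: "f \<in> admissible"
  shows "vec_d0 f \<in> closed_vecs"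
proof -
  have "vec_d0 f i \<in> admissible" for i
    using f vec_d0_grade[of f]
    by (cases "form_deg i = 1"; cases i) (simp_all add: vec_d0_simps grade_def)
  then show ?thesis
    using vec_d1_d0[OF f] vec_d0_grade by (simp add: closed_vecs_def admissible_vec_def)
qed

lemma vec_grade_1_eqI:
  assumes "v \<in> grade 1" "w \<in> grade 1" "v Fa = w Fa" "v Fb = w Fb" "v Fc = w Fc" "v Fd = w Fd"
  shows "v = w"
proof (rule vec_eqI)
  fix i
  show "v i = w i"
  proof (cases "form_deg i = 1")
    case True
    then have "i = Fa \<or> i = Fb \<or> i = Fc \<or> i = Fd" by (cases i) simp_all
    then show ?thesis using assms(3-6) by blast
  next
    case False
    then have "v i = 0" "w i = 0" using assms(1,2) unfolding grade_def by blast+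
    then show ?thesis by (simp only:)
  qed
qed

lemma gauge_a:
  assumes v: "v \<in> closed_vecs"
  obtains f where "f \<in> admissible" "kappa ((v - vec_d0 f) Fa) = (v - vec_d0 f) Fa"
proof
  define f where "f = (\<lambda>m n k. if q powi (m + n - k) = 1 then 0 else v Fa m n k / (q powi (m + n - k) - 1))"
  have per: "q powi (m + int r + n - k) = q powi (m + n - k)" for m n k
    by (rule powi_cong) simp
  show "f \<in> admissible"
    by (rule admissibleI)
      (simp_all add: f_def per admissible_period[OF closedD(1)[OF v]] admissible_outside[OF closedD(1)[OF v]])
  have "(v - vec_d0 f) Fa m n k = (if q powi (m + n - k) = 1 then v Fa m n k else 0)" for m n k
    by (simp add: vec_d0_simps kappa_def f_def field_simps)
  then show "kappa ((v - vec_d0 f) Fa) = (v - vec_d0 f) Fa"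
    by (intro coeffs_eqI) (simp add: kappa_def)
qed

text \<open>The e_b e_a equation puts P of the coefficient into the image of \<kappa> - q^2, while
  row degree zero puts it into the kernel; as \<kappa> is diagonal, it is zero. The e_c e_a equation
  gives the same for Q. Now P = 0 leaves only k = 0, then Q = 0 leaves only n = 0, and the row
  degree forces r to divide m.\<close>

lemma closed_a:
  assumes v: "v \<in> closed_vecs" and ka: "kappa (v Fa) = v Fa"
  shows "v Fa = v Fa 0 0 0 *\<^sub>A mono 0 0 0"
proof -
  note eqs = vec_d1_equations[OF closedD(3)[OF v]]
  note adm = closedD(1)[OF v]
  have ka': "kappa (v Fa) = 1 *\<^sub>A v Fa" using ka by (simp only: coeffs.scale_one)
  have zero: "w = 0" if "kappa u - z *\<^sub>A u - z *\<^sub>A w = 0" "kappa w = z *\<^sub>A w" "z \<noteq> 0" for u w :: coeffs and z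
  proof (rule coeffs_eqI)
    fix m n k
    have "(kappa u - z *\<^sub>A u - z *\<^sub>A w) m n k = 0" "kappa w m n k = (z *\<^sub>A w) m n k"
      by (simp_all only: that coeffs_apply)
    then have "(q powi (m + n - k) - z) * u m n k = z * w m n k" "(q powi (m + n - k) - z) * w m n k = 0"
      by (simp_all add: kappa_def algebra_simps)
    then show "w m n k = (0 :: coeffs) m n k"
      using that(3) by (cases "q powi (m + n - k) = z") auto
  qed
  have P: "P (v Fa) = 0"
    by (rule zero[OF eqs(1)]) (simp_all only: kappa_PQ ka coeffs.scale_one, simp)
  have Q: "Q (v Fa) = 0"
    by (rule zero[OF eqs(2)]) (simp_all only: kappa_PQ ka coeffs.scale_one, simp)
  show ?thesis
  proof (rule coeffs_eqI)
    fix m n k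
    show "v Fa m n k = (v Fa 0 0 0 *\<^sub>A mono 0 0 0) m n k"
    proof (cases "v Fa m n k = 0")
      case True
      then show ?thesis
        using admissible_mod[OF adm, of m 0 Fa n k] by (auto simp: mono_eq_iff)
    next
      case False
      then have k: "k = 0" using P_zero_support[OF adm P] by blast
      have n: "n = 0"
      proof (rule ccontr)
        assume "n \<noteq> 0"
        then have n: "0 < n" "n < int r"
          using admissible_outside[OF adm, of n k Fa m] False by force+
        have "Q (v Fa) (m - 1) (n - 1) 0 = 0" using Q by simp
        then have "v Fa m n 0 = 0"
          using powi_diff_nonzero[OF n] admissible_outside[OF adm, of "n - 1" "-1" Fa m] r_bounds
          by (simp add: Q_at)
        then show False using False k by simp
      qed
      have "int r dvd m"
        using kappa_eigen_support[OF ka' False] n k powi_eq_one_dvd[of m] by simp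
      then show ?thesis
        using n k admissible_mod[OF adm, of m 0 Fa 0 0] by (simp add: mono_eq_iff)
    qed
  qed
qed

text \<open>Without an e_a-coefficient, those of e_b, e_c, e_d have row degrees 2, -2, 0 modulo r.
  On the first two, \<open>kappa_inv\<close> is then a scalar, which turns X into a multiple of P
  Q.\<close>

lemma kappa_rows:
  assumes v: "v \<in> closed_vecs" and a: "v Fa = 0"
  shows "kappa (v Fb) = (q * q) *\<^sub>A v Fb" "kappa (v Fc) = (p * p) *\<^sub>A v Fc" "kappa (v Fd) = v Fd"
    and "\<And>m n k. \<mu> * v Fd m n k = Q (v Fb) m n k - P (v Fc) m n k"
    and "P (v Fd) = P (Q (v Fb))"
    and "\<And>m n k. (q * q - 1 - p * p * \<mu>) * v Fc m n k + q * q * (q * q) * P (Q (v Fc)) m n k = Q (v Fd) m n k"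
proof -
  note eqs = vec_d1_equations[OF closedD(3)[OF v], unfolded a PQ_zero]
  have at: "f m n k = 0" if "f = 0" for f :: coeffs and m n k
    by (simp only: that coeffs_apply)
  show kb: "kappa (v Fb) = (q * q) *\<^sub>A v Fb"
    by (rule coeffs_eqI) (use at[OF eqs(1)] in \<open>simp add: algebra_simps\<close>)
  show kc: "kappa (v Fc) = (p * p) *\<^sub>A v Fc"
    by (rule coeffs_eqI) (use at[OF eqs(2)] in \<open>simp add: algebra_simps\<close>)
  show "kappa (v Fd) = v Fd"
    by (rule coeffs_eqI) (use at[OF eqs(3)] in \<open>simp add: algebra_simps\<close>)
  show "\<mu> * v Fd m n k = Q (v Fb) m n k - P (v Fc) m n k" for m n k
    using at[OF eqs(4), of m n k] by (simp add: algebra_simps)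
  have kb': "kappa_inv (v Fb) = (p * p) *\<^sub>A v Fb"
    by (rule kappa_eigen_inv[OF kb]) (simp add: mult.assoc)
  have kc': "kappa_inv (v Fc) = (q * q) *\<^sub>A v Fc"
    by (rule kappa_eigen_inv[OF kc]) (simp add: mult.assoc)
  have Xb: "X (v Fb) m n k = P (Q (v Fb)) m n k" for m n k
    by (simp add: X_def kappa_PQ kappa_inv_Q kb' PQ_simps) (simp add: algebra_simps)
  have Xc: "X (v Fc) m n k = q * q * (q * q) * P (Q (v Fc)) m n k" for m n k
    by (simp add: X_def kappa_PQ kappa_inv_Q kc' PQ_simps) (simp add: algebra_simps)?
  show "P (v Fd) = P (Q (v Fb))"
    by (rule coeffs_eqI) (use at[OF eqs(5)] in \<open>simp add: Xb kb' mu_eq algebra_simps\<close>)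
  show "(q * q - 1 - p * p * \<mu>) * v Fc m n k + q * q * (q * q) * P (Q (v Fc)) m n k = Q (v Fd) m n k" for m n k
    using at[OF eqs(6), of m n k] by (simp add: Xc kc' power2_eq_square algebra_simps)
qed

lemma vec_d0_Fa_eigen: "kappa f = f \<Longrightarrow> vec_d0 f Fa = 0"
  by (simp only: vec_d0_simps diff_self)

text \<open>P f = v_b is solved monomial by monomial. Only c^(r-1) cannot be reached, as its factor
  would be q^r - q^(-r) = 0. P raises the row degree by 2, so \<open>f\<close> has row degree zero
  and subtracting \<open>vec_d0 f\<close> leaves the e_a-coefficient at zero.\<close>

lemma gauge_b:
  assumes v: "v \<in> closed_vecs" and a: "v Fa = 0"
  obtains f where "f \<in> admissible" "kappa f = f" "\<And>m n k. k \<noteq> int r - 1 \<Longrightarrow> (v - vec_d0 f) Fb m n k = 0"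
proof
  note adm = closedD(1)[OF v]
  define f where "f = (\<lambda>m n k. if 0 < k \<and> k < int r
    then v Fb (m + 1) n (k - 1) / (q powi (n - 1) * (q powi k - q powi (- k))) else 0)"
  have shift: "v Fb (m + int r + 1) n k = v Fb (m + 1) n k" for m n k
    using admissible_period[OF adm, of Fb "m + 1"] by (simp add: algebra_simps)
  show f: "f \<in> admissible"
    by (rule admissibleI) (auto simp: f_def shift admissible_outside[OF adm])
  show "kappa f = f"
  proof -
    have "kappa f = 1 *\<^sub>A f"
    proof (rule kappa_eigenI)
      fix m n k assume "f m n k \<noteq> 0"
      then have "v Fb (m + 1) n (k - 1) \<noteq> 0" by (auto simp: f_def split: if_splits)
      then have "q powi (m + 1 + n - (k - 1)) = q * q"
        by (rule kappa_eigen_support[OF kappa_rows(1)[OF v a]])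
      moreover have "m + 1 + n - (k - 1) = (m + n - k) + 2" by simp
      ultimately have "q powi (m + n - k) * (q * q) = 1 * (q * q)"
        by (simp only: powi_add powi_expand(8) mult_1)
      then show "q powi (m + n - k) = 1" by simp
    qed
    then show ?thesis by (simp only: coeffs.scale_one)
  qed
  fix m n k assume k: "k \<noteq> int r - 1"
  show "(v - vec_d0 f) Fb m n k = 0"
  proof (cases "0 \<le> k \<and> k < int r")
    case True
    then have "P f m n k = v Fb m n k"
      using k powi_diff_nonzero[of "k + 1"] P_at[of f "m - 1" n "k + 1"] by (simp add: f_def)
    then show ?thesis by (simp add: vec_d0_simps)
  next
    case False
    then have "v Fb m n k = 0" "P f m n k = 0"
      using admissible_outside[OF adm] admissible_outside[OF PQ_admissible(3)[OF f]] by auto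
    then show ?thesis by (simp add: vec_d0_simps)
  qed
qed

text \<open>Applying P to \<mu> v_d = Q v_b - P v_c yields P P v_c = p^2 P Q v_b. At c^(r-2) the
  left side vanishes, and the right side is a nonzero multiple of Q v_b at c^(r-1), that is, of the
  terms of v_b with a positive power of b. Row degree 2 leaves a c^(r-1) alone.\<close>

lemma closed_b:
  assumes v: "v \<in> closed_vecs" and a: "v Fa = 0" and b: "\<And>m n k. k \<noteq> int r - 1 \<Longrightarrow> v Fb m n k = 0"
  shows "v Fb = v Fb 1 0 (int r - 1) *\<^sub>A mono 1 0 (int r - 1)"
proof -
  note adm = closedD(1)[OF v]
  note rows = kappa_rows[OF v a]
  have r1: "int r - 1 < int r" "int r - 2 < int r" by simp_all
  have PP: "P (P (v Fc)) m n k = p * p * P (Q (v Fb)) m n k" for m n k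
  proof -
    have "\<mu> *\<^sub>A v Fd = Q (v Fb) - P (v Fc)"
      by (rule coeffs_eqI) (simp add: rows(4))
    then have "\<mu> *\<^sub>A P (v Fd) = P (Q (v Fb)) - P (P (v Fc))"
      by (simp only: PQ_simps[symmetric])
    then have "(\<mu> *\<^sub>A P (v Fd)) m n k = (P (Q (v Fb)) - P (P (v Fc))) m n k"
      by (simp only:)
    then show ?thesis by (simp add: rows(5) mu_eq algebra_simps)
  qed
  have zero: "v Fb m (n + 1) (int r - 1) = 0" if n: "0 \<le> n" "n + 1 < int r" for m n
  proof -
    \<comment> \<open>The factor of P at the target exponent r - 1 is q^r - q^(-r), which is
      zero.\<close>
    have "P (v Fc) m' n (int r - 1) = 0" for m'
      using P_at[of "v Fc" "m' - 1" n "int r"] powi_dvd[of "int r"] powi_period_neg by simp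
    then have PP_zero: "P (P (v Fc)) m' n (int r - 2) = 0" for m'
      using P_at[of "P (v Fc)" "m' - 1" n "int r - 1"] by simp
    have PQ_zero: "P (Q (v Fb)) m' n (int r - 2) = 0" for m'
      using PP[of m' n "int r - 2"] PP_zero[of m'] by simp
    have "Q (v Fb) (m - 1) n (int r - 1) = 0"
      using P_at[of "Q (v Fb)" "m - 1" n "int r - 1"] PQ_zero[of m]
        powi_diff_nonzero[of "int r - 1"] r_bounds by simp
    then have "(q powi (n + 1) - q powi (- n - 1)) * v Fb m (n + 1) (int r - 1) = 0"
      using b[of "int r - 1 - 1" m n] unfolding Q_at[OF r1(1)] by simp
    moreover have "q powi (n + 1) - q powi (- n - 1) \<noteq> 0"
      using powi_diff_nonzero[of "n + 1"] n by simp
    ultimately show ?thesis by simp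
  qed
  show ?thesis
  proof (rule coeffs_eqI)
    fix m n k
    show "v Fb m n k = (v Fb 1 0 (int r - 1) *\<^sub>A mono 1 0 (int r - 1)) m n k"
    proof (cases "v Fb m n k = 0")
      case True
      then show ?thesis
        using admissible_mod[OF adm, of m 1 Fb n k] by (auto simp: mono_eq_iff)
    next
      case False
      then have k: "k = int r - 1" using b by blast
      have n: "n = 0"
        using zero[of "n - 1" m] admissible_outside[OF adm, of n k Fb m] False k by force
      have "q powi (m + 0 - (int r - 1)) = q * q"
        using kappa_eigen_support[OF rows(1) False] n k by simp
      moreover have "m + 0 - (int r - 1) = (m - 1) + (2 - int r)" by simp
      ultimately have "q powi (m - 1) * (q * q) = 1 * (q * q)"
        by (simp only: powi_add powi_r mult_1)
      then have "int r dvd m - 1"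
        by (intro powi_eq_one_dvd) simp
      then show ?thesis
        using n k admissible_mod[OF adm, of m 1 Fb 0 "int r - 1"] by (simp add: mono_eq_iff)
    qed
  qed
qed

text \<open>Here \<mu> v_d = - P v_c and P v_d = 0 give P P v_c = 0, and the factors of P for k and
  k - 1 are both nonzero when 2 \<le> k < r.\<close>

lemma closed_c_support:
  assumes v: "v \<in> closed_vecs" and a: "v Fa = 0" and b: "v Fb = 0"
  shows "k \<noteq> 0 \<Longrightarrow> k \<noteq> 1 \<Longrightarrow> v Fc m n k = 0"
    and "\<mu> *\<^sub>A v Fd = - P (v Fc)"
proof -
  note adm = closedD(1)[OF v]
  note rows = kappa_rows[OF v a, unfolded b PQ_zero]
  show d: "\<mu> *\<^sub>A v Fd = - P (v Fc)"
    by (rule coeffs_eqI) (simp add: rows(4))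
  have "P (- P (v Fc)) = 0"
    by (simp only: d[symmetric] PQ_simps rows(5) coeffs.scale_zero_right)
  then have PP: "P (P (v Fc)) m n k = 0" for m n k
    by (metis PQ_simps(11) coeffs_apply(2,3) neg_equal_0_iff_equal)
  assume k: "k \<noteq> 0" "k \<noteq> 1"
  show "v Fc m n k = 0"
  proof (cases "0 \<le> k \<and> k < int r")
    case True
    then have "P (v Fc) (m + 1) n (k - 1) = 0"
      using P_at[of "P (v Fc)" "m + 1" n "k - 1"] PP powi_diff_nonzero[of "k - 1"] k by simp
    then show ?thesis
      using P_at[of "v Fc" m n k] powi_diff_nonzero[of k] True k by simp
  next
    case False
    then show ?thesis using admissible_outside[OF adm] by auto
  qed
qed

text \<open>A function without c has P f = 0, so the e_b-coefficient remains zero; at k = 0 only the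
  second term of Q contributes, and the denominator is its factor. The other term of Q f alters v_c
  at k = 1 only.\<close>

lemma gauge_c:
  assumes v: "v \<in> closed_vecs" and a: "v Fa = 0" and b: "v Fb = 0"
  obtains f where "f \<in> admissible" "kappa f = f" "P f = 0"
    "\<And>m n. n \<noteq> int r - 1 \<Longrightarrow> (v - vec_d0 f) Fc m n 0 = 0"
proof
  note adm = closedD(1)[OF v]
  define f :: coeffs where "f = (\<lambda>m n k. if k = 0 \<and> 0 < n \<and> n < int r
    then v Fc (m - 1) (n - 1) 0 / (p * (q powi n - q powi (- n))) else 0)"
  have shift: "v Fc (m + int r - 1) n k = v Fc (m - 1) n k" for m n k
    using admissible_period[OF adm, of Fc "m - 1"] by (simp add: algebra_simps)
  show f: "f \<in> admissible"
    using r_bounds by (intro admissibleI) (auto simp: f_def shift)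
  show "kappa f = f"
  proof -
    have "kappa f = 1 *\<^sub>A f"
    proof (rule kappa_eigenI)
      fix m n k assume *: "f m n k \<noteq> 0"
      then have "v Fc (m - 1) (n - 1) 0 \<noteq> 0" by (auto simp: f_def split: if_splits)
      then have "q powi (m - 1 + (n - 1) - 0) = p * p"
        by (rule kappa_eigen_support[OF kappa_rows(2)[OF v a]])
      moreover have "m - 1 + (n - 1) - 0 = (m + n) + - 2" by simp
      ultimately have "q powi (m + n) * (p * p) = 1 * (p * p)"
        by (simp only: powi_add powi_expand(9) mult_1)
      then have "q powi (m + n) = 1" by simp
      then show "q powi (m + n - k) = 1"
        using * by (auto simp: f_def split: if_splits)
    qed
    then show ?thesis by (simp only: coeffs.scale_one)
  qed
  show "P f = 0"
    by (rule coeffs_eqI, case_tac "k = - 1") (auto simp: P_def f_def)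
  fix m n assume n: "n \<noteq> int r - 1"
  show "(v - vec_d0 f) Fc m n 0 = 0"
  proof (cases "0 \<le> n \<and> n < int r")
    case True
    then have "Q f m n 0 = v Fc m n 0"
      using n powi_diff_nonzero[of "n + 1"] Q_at[of 0 f "m + 1" n] r_bounds by (simp add: f_def powi_expand(7) inverse_q)
    then show ?thesis by (simp add: vec_d0_simps)
  next
    case False
    then have "v Fc m n 0 = 0" "Q f m n 0 = 0"
      using admissible_outside[OF adm] admissible_outside[OF PQ_admissible(4)[OF f]] by auto
    then show ?thesis by (simp add: vec_d0_simps)
  qed
qed

text \<open>At b^(r-1) the row degree -2 fixes the power of a modulo r, so a single coefficient is
  left, and \<open>h2_vec\<close> removes it.\<close>

lemma closed_c:
  assumes v: "v \<in> closed_vecs" and a: "v Fa = 0" and c: "\<And>m n. n \<noteq> int r - 1 \<Longrightarrow> v Fc m n 0 = 0"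
  shows "(v - v Fc (- 1) (int r - 1) 0 *\<^sub>F h2_vec) Fc m n 0 = 0"
proof -
  note adm = closedD(1)[OF v]
  have "int r dvd m + 1" if "v Fc m (int r - 1) 0 \<noteq> 0"
  proof -
    have "q powi (m + (int r - 1) - 0) = p * p"
      by (rule kappa_eigen_support[OF kappa_rows(2)[OF v a] that])
    moreover have "m + (int r - 1) - 0 = (m + 1) + (int r - 2)" by simp
    ultimately have "q powi (m + 1) * (p * p) = 1 * (p * p)"
      by (simp only: powi_add powi_r mult_1)
    then show ?thesis
      by (intro powi_eq_one_dvd) simp
  qed
  moreover have "v Fc m (int r - 1) 0 = v Fc (- 1) (int r - 1) 0" if "int r dvd m + 1"
    using that by (intro admissible_mod adm) simp
  ultimately have "v Fc m (int r - 1) 0 = v Fc (- 1) (int r - 1) 0 * mono (- 1) (int r - 1) 0 m (int r - 1) 0"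
    by (auto simp: mono_eq_iff)
  then show ?thesis
    using c[of n m] by (cases "n = int r - 1") (simp_all add: h2_vec_def mono_eq_iff)
qed

lemma mu_eq': "\<mu> = p * (q - p)"
  by (simp add: mu_eq right_diff_distrib)

lemma q_minus_p: "q - p \<noteq> 0"
  using powi_diff_nonzero[of 1] r_bounds powi_expand(7) by simp

lemma mu_nonzero: "\<mu> \<noteq> 0"
  using q_minus_p by (simp add: mu_eq')

text \<open>At c^0 the e_c e_d equation compares q^4 P Q v_c with Q v_d, where \<mu> v_d = - P v_c.
  On terms b^(n+1) c both sides are multiples of the same coefficient, and their difference carries
  \<mu> q^2 + 1 = q^2, which is nonzero. So b does not occur, v_c is a multiple of a^(-1) c, and v_d
  is the opposite multiple of 1.\<close>

lemma closed_d:
  assumes v: "v \<in> closed_vecs" and a: "v Fa = 0" and b: "v Fb = 0"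
    and c: "\<And>m n k. k \<noteq> 1 \<Longrightarrow> v Fc m n k = 0"
  shows "v = v Fc (- 1) 0 1 *\<^sub>F (n_vec - theta_vec)"
proof -
  note adm = closedD(1)[OF v]
  note rows = kappa_rows[OF v a]
  note d = closed_c_support(2)[OF v a b]
  define \<epsilon> where "\<epsilon> = v Fc (- 1) 0 1"
  have zero: "v Fc m (n + 1) 1 = 0" if n: "0 \<le> n" "n + 1 < int r" for m n
  proof -
    define F where "F = v Fc m (n + 1) 1"
    define C where "C = q powi (n + 1) - q powi (- n - 1)"
    have C: "C \<noteq> 0"
      using powi_diff_nonzero[of "n + 1"] n by (simp add: C_def)
    have Qc: "Q (v Fc) (m - 1) n 1 = p * p * (C * F)"
      using Q_at[of 1 "v Fc" m n] r_bounds c[of 0 m n] powi_expand(9) by (simp add: C_def F_def)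
    have PQc: "P (Q (v Fc)) m n 0 = p * q powi n * (q - p) * (p * p * (C * F))"
      using P_at[of "Q (v Fc)" "m - 1" n 1] Qc powi_expand(7) powi_expand(2)[of n 1] by simp
    have Qd: "Q (v Fd) m n 0 = p * (C * v Fd (m + 1) (n + 1) 0)"
      using Q_at[of 0 "v Fd" "m + 1" n] r_bounds admissible_outside[OF adm, of n "- 1" Fd "m + 1"] powi_expand(7)
      by (simp add: C_def)
    have "(\<mu> *\<^sub>A v Fd) (m + 1) (n + 1) 0 = (- P (v Fc)) (m + 1) (n + 1) 0"
      by (simp only: d)
    then have Fd: "\<mu> * v Fd (m + 1) (n + 1) 0 = - (q powi n * (q - p) * F)"
      using P_at[of "v Fc" m "n + 1" 1] powi_expand(7) by (simp add: F_def)
    have "q * q * (q * q) * P (Q (v Fc)) m n 0 = Q (v Fd) m n 0"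
      using rows(6)[of m n 0] c[of 0 m n] by simp
    then have "q * q * (q * q) * (p * q powi n * (q - p) * (p * p * (C * F))) = p * (C * v Fd (m + 1) (n + 1) 0)"
      by (simp only: PQc Qd)
    \<comment> \<open>Multiplying by \<mu> allows v_d to be replaced by means of \<open>Fd\<close>
      without a division.\<close>
    then have "\<mu> * (q * q * (q * q) * (p * q powi n * (q - p) * (p * p * (C * F)))) = \<mu> * (p * (C * v Fd (m + 1) (n + 1) 0))"
      by (rule arg_cong)
    then have "\<mu> * (q * q * (q * q) * (p * q powi n * (q - p) * (p * p * (C * F)))) =
        p * (C * (\<mu> * v Fd (m + 1) (n + 1) 0))"
      by (simp only: ac_simps)
    then have "p * q powi n * (q - p) * C * F * (\<mu> * (q * q) + 1) = 0"
      unfolding Fd by (simp add: algebra_simps)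
    moreover have "\<mu> * (q * q) + 1 = q * q"
      by (simp add: mu_eq algebra_simps)
    ultimately have "F = 0"
      using C q_minus_p by simp
    then show ?thesis by (simp add: F_def)
  qed
  have Fc: "v Fc = \<epsilon> *\<^sub>A mono (- 1) 0 1"
  proof (rule coeffs_eqI)
    fix m n k
    show "v Fc m n k = (\<epsilon> *\<^sub>A mono (- 1) 0 1) m n k"
    proof (cases "v Fc m n k = 0")
      case True
      then show ?thesis
        using admissible_mod[OF adm, of m "- 1" Fc n k] by (auto simp: mono_eq_iff \<epsilon>_def)
    next
      case False
      then have k: "k = 1" using c by blast
      have n: "n = 0"
        using zero[of "n - 1" m] admissible_outside[OF adm, of n k Fc m] False k by force
      have "q powi (m + 0 - 1) = p * p"
        using kappa_eigen_support[OF rows(2) False] n k by simp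
      moreover have "m + 0 - 1 = (m + 1) + - 2" by simp
      ultimately have "q powi (m + 1) * (p * p) = 1 * (p * p)"
        by (simp only: powi_add powi_expand(9) mult_1)
      then have "int r dvd m + 1"
        by (intro powi_eq_one_dvd) simp
      then show ?thesis
        using n k admissible_mod[OF adm, of m "- 1" Fc 0 1] by (simp add: mono_eq_iff \<epsilon>_def)
    qed
  qed
  have Fd: "v Fd = - (\<epsilon> *\<^sub>A mono 0 0 0)"
  proof (rule coeffs_eqI)
    fix m n k
    have "(\<mu> *\<^sub>A v Fd) m n k = (- P (\<epsilon> *\<^sub>A mono (- 1) 0 1)) m n k"
      by (simp only: d Fc)
    then have "\<mu> * v Fd m n k = \<mu> * - (\<epsilon> * mono 0 0 0 m n k)"
      using powi_expand(7) by (simp add: PQ_simps P_mono mu_eq' inverse_q algebra_simps)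
    then show "v Fd m n k = (- (\<epsilon> *\<^sub>A mono 0 0 0)) m n k"
      by (simp only: mult_left_cancel[OF mu_nonzero] coeffs_apply scale_coeffs_apply)
  qed
  have "v = \<epsilon> *\<^sub>F (n_vec - theta_vec)"
  proof (rule vec_grade_1_eqI[OF closedD(2)[OF v]])
    show "\<epsilon> *\<^sub>F (n_vec - theta_vec) \<in> grade 1"
      by (intro vec.subspace_scale vec.subspace_diff grade_subspace class_vecs_grade)
  qed (unfold a b Fc Fd; rule coeffs_eqI; simp add: n_vec_def theta_vec_def)+
  then show ?thesis by (simp only: \<epsilon>_def)
qed

lemma vec_d0_add: "vec_d0 (f + g) = vec_d0 f + vec_d0 g"
  by (simp only: vec_d0_def twist_add of_coeffs_add wedge_linear) (simp only: algebra_simps)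

text \<open>No coefficient removed earlier comes back: the later gauge functions have row degree
  zero, the last one also lies in the kernel of P, and h_1 and h_2 each have a single nonzero
  coefficient.\<close>

lemma closed_vecs_span:
  assumes v: "v \<in> closed_vecs"
  obtains \<alpha> \<beta> \<gamma> \<epsilon> f where "f \<in> admissible"
    "v = \<alpha> *\<^sub>F theta_vec + \<beta> *\<^sub>F h1_vec + \<gamma> *\<^sub>F h2_vec + \<epsilon> *\<^sub>F n_vec + vec_d0 f"
proof -
  obtain f1 where f1: "f1 \<in> admissible" "kappa ((v - vec_d0 f1) Fa) = (v - vec_d0 f1) Fa"
    using gauge_a[OF v] by blast
  define v1 where "v1 = v - vec_d0 f1"
  have v1: "v1 \<in> closed_vecs"
    unfolding v1_def by (intro closed_vecs_diff vec_d0_closed v f1)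
  define \<alpha> where "\<alpha> = v1 Fa 0 0 0"
  have v1_a: "v1 Fa = \<alpha> *\<^sub>A mono 0 0 0"
    unfolding \<alpha>_def by (rule closed_a[OF v1]) (simp only: v1_def f1)
  define v2 where "v2 = v1 - \<alpha> *\<^sub>F n_vec"
  have v2: "v2 \<in> closed_vecs"
    unfolding v2_def by (intro closed_vecs_diff closed_vecs_scale v1 n_closed)
  have v2_a: "v2 Fa = 0"
    by (rule coeffs_eqI) (simp add: v2_def v1_a n_vec_def)
  obtain f2 where f2: "f2 \<in> admissible" "kappa f2 = f2"
      "\<And>m n k. k \<noteq> int r - 1 \<Longrightarrow> (v2 - vec_d0 f2) Fb m n k = 0"
    using gauge_b[OF v2 v2_a] by blast
  define v3 where "v3 = v2 - vec_d0 f2"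
  have v3: "v3 \<in> closed_vecs"
    unfolding v3_def by (intro closed_vecs_diff vec_d0_closed v2 f2)
  have v3_a: "v3 Fa = 0"
    by (rule coeffs_eqI) (simp add: v3_def v2_a vec_d0_Fa_eigen[OF f2(2)])
  define \<beta> where "\<beta> = v3 Fb 1 0 (int r - 1)"
  have v3_b: "v3 Fb = \<beta> *\<^sub>A mono 1 0 (int r - 1)"
    unfolding \<beta>_def by (rule closed_b[OF v3 v3_a]) (simp only: v3_def f2(3) not_False_eq_True)
  define v4 where "v4 = v3 - \<beta> *\<^sub>F h1_vec"
  have v4: "v4 \<in> closed_vecs"
    unfolding v4_def by (intro closed_vecs_diff closed_vecs_scale v3 h1_closed)
  have v4_a: "v4 Fa = 0"
    by (rule coeffs_eqI) (simp add: v4_def v3_a h1_vec_def)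
  have v4_b: "v4 Fb = 0"
    by (rule coeffs_eqI) (simp add: v4_def v3_b h1_vec_def)
  obtain f3 where f3: "f3 \<in> admissible" "kappa f3 = f3" "P f3 = 0"
      "\<And>m n. n \<noteq> int r - 1 \<Longrightarrow> (v4 - vec_d0 f3) Fc m n 0 = 0"
    using gauge_c[OF v4 v4_a v4_b] by blast
  define v5 where "v5 = v4 - vec_d0 f3"
  have v5: "v5 \<in> closed_vecs"
    unfolding v5_def by (intro closed_vecs_diff vec_d0_closed v4 f3)
  have v5_a: "v5 Fa = 0"
    by (rule coeffs_eqI) (simp add: v5_def v4_a vec_d0_Fa_eigen[OF f3(2)])
  define \<gamma> where "\<gamma> = v5 Fc (- 1) (int r - 1) 0"
  define v6 where "v6 = v5 - \<gamma> *\<^sub>F h2_vec"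
  have v6: "v6 \<in> closed_vecs"
    unfolding v6_def by (intro closed_vecs_diff closed_vecs_scale v5 h2_closed)
  have v6_a: "v6 Fa = 0"
    by (rule coeffs_eqI) (simp add: v6_def v5_a h2_vec_def)
  have v6_b: "v6 Fb = 0"
    by (rule coeffs_eqI) (simp add: v6_def v5_def v4_b h2_vec_def vec_d0_simps f3(3))
  have v6_c0: "v6 Fc m n 0 = 0" for m n
    unfolding v6_def \<gamma>_def by (rule closed_c[OF v5 v5_a]) (simp only: v5_def f3(4) not_False_eq_True)
  define \<epsilon> where "\<epsilon> = v6 Fc (- 1) 0 1"
  have "v6 Fc m n k = 0" if "k \<noteq> 1" for m n k
    using closed_c_support(1)[OF v6 v6_a v6_b _ that] v6_c0 by (cases "k = 0") simp_all
  then have v6_eq: "v6 = \<epsilon> *\<^sub>F (n_vec - theta_vec)"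
    unfolding \<epsilon>_def by (intro closed_d[OF v6 v6_a v6_b])
  have "v = v6 + \<gamma> *\<^sub>F h2_vec + vec_d0 f3 + \<beta> *\<^sub>F h1_vec + vec_d0 f2 + \<alpha> *\<^sub>F n_vec + vec_d0 f1"
    unfolding v6_def v5_def v4_def v3_def v2_def v1_def by (simp only: diff_add_cancel)
  also have "\<dots> = (- \<epsilon>) *\<^sub>F theta_vec + \<beta> *\<^sub>F h1_vec + \<gamma> *\<^sub>F h2_vec + (\<alpha> + \<epsilon>) *\<^sub>F n_vec
      + vec_d0 (f1 + f2 + f3)"
    unfolding v6_eq vec_d0_add by (rule vec_eqI, rule coeffs_eqI) (simp add: algebra_simps)
  finally show thesis
    by (rule that[rotated]) (intro admissible_closed f1 f2 f3)
qed

text \<open>The coefficients are compared where an exact form must vanish: \<kappa> f - f has no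
  constant term and P f no term with c^(r-1). Once P f = 0, the function f does not involve c, and Q
  f contains neither a^(-1) c nor a^(-1) b^(r-1).\<close>

lemma class_vecs_independent:
  assumes f: "f \<in> admissible"
    and eq: "\<alpha> *\<^sub>F theta_vec + \<beta> *\<^sub>F h1_vec + \<gamma> *\<^sub>F h2_vec + \<epsilon> *\<^sub>F n_vec = vec_d0 f"
  shows "\<alpha> = 0 \<and> \<beta> = 0 \<and> \<gamma> = 0 \<and> \<epsilon> = 0"
proof -
  have at: "(\<alpha> *\<^sub>F theta_vec + \<beta> *\<^sub>F h1_vec + \<gamma> *\<^sub>F h2_vec + \<epsilon> *\<^sub>F n_vec) i m n k = vec_d0 f i m n k" for i m n k
    by (simp only: eq)
  have "\<alpha> + \<epsilon> = 0"
    using at[of Fa 0 0 0] by (simp add: theta_vec_def h1_vec_def h2_vec_def n_vec_def vec_d0_simps kappa_def mono_eq_iff)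
  moreover have \<beta>: "\<beta> = 0"
    using at[of Fb 1 0 "int r - 1"] powi_dvd[of "int r"] powi_period_neg
    by (simp add: theta_vec_def h1_vec_def h2_vec_def n_vec_def vec_d0_simps P_def mono_eq_iff)
  have "P f = 0"
    by (rule coeffs_eqI)
      (use at[of Fb] in \<open>simp add: \<beta> theta_vec_def h1_vec_def h2_vec_def n_vec_def vec_d0_simps\<close>)
  then have f0: "f m n k = 0" if "k \<noteq> 0" for m n k
    using P_zero_support[OF f] that by blast
  have "\<epsilon> = 0"
  proof -
    have "Q f (0 - 1) 0 1 = 0"
      using Q_at[of 1 f 0 0] r_bounds f0 by simp
    then show ?thesis
      using at[of Fc "- 1" 0 1] r_bounds
      by (simp add: theta_vec_def h1_vec_def h2_vec_def n_vec_def vec_d0_simps mono_eq_iff)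
  qed
  moreover have "\<gamma> = 0"
  proof -
    have "Q f (0 - 1) (int r - 1) 0 = 0"
      using Q_at[of 0 f 0 "int r - 1"] r_bounds f0 powi_dvd[of "int r"] powi_period_neg by simp
    then show ?thesis
      using at[of Fc "- 1" "int r - 1" 0] r_bounds
      by (simp add: theta_vec_def h1_vec_def h2_vec_def n_vec_def vec_d0_simps mono_eq_iff)
  qed
  ultimately show ?thesis using \<beta> by simp
qed

lemma act_classes:
  "act theta_free unit_vec_A = theta_vec"
  "act (e\<^sub>b * x\<^sub>a * x\<^sub>c ^ (r - 1)) unit_vec_A = h1_vec"
  "act (e\<^sub>c * x\<^sub>a ^ (r - 1) * x\<^sub>b ^ (r - 1)) unit_vec_A = h2_vec"
  "act (e\<^sub>a + e\<^sub>c * x\<^sub>a ^ (r - 1) * x\<^sub>c) unit_vec_A = n_vec"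
proof -
  have r: "r - 1 < r" "int (r - 1) = int r - 1" "0 < r" "1 < r"
    using r_ge by (simp_all add: of_nat_diff)
  have period: "mono (int r - 1) n k = mono (- 1) n k" for n k
    by (rule mono_period) simp
  show "act theta_free unit_vec_A = theta_vec"
    unfolding act_theta_unit theta_vec_def
    by (rule vec_eqI, case_tac i) (simp_all only: twist.simps one_form_simps PQ_unit add_0_left)
  have "e\<^sub>b * x\<^sub>a * x\<^sub>c ^ (r - 1) = e\<^sub>b * (x\<^sub>a ^ 1 * (x\<^sub>b ^ 0 * x\<^sub>c ^ (r - 1)))"
    by (simp add: mult.assoc)
  then have "act (e\<^sub>b * x\<^sub>a * x\<^sub>c ^ (r - 1)) unit_vec_A = wedge_b (of_coeffs (mono 1 0 (int r - 1)))"
    by (simp only: act_mult[of "e\<^sub>b"] act_gen act_monomial[OF r(3,1)] r(2) rep.simps of_nat_1 of_nat_0)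
  then show "act (e\<^sub>b * x\<^sub>a * x\<^sub>c ^ (r - 1)) unit_vec_A = h1_vec"
    unfolding h1_vec_def by (intro vec_eqI coeffs_eqI, case_tac i) simp_all
  have "e\<^sub>c * x\<^sub>a ^ (r - 1) * x\<^sub>b ^ (r - 1) = e\<^sub>c * (x\<^sub>a ^ (r - 1) * (x\<^sub>b ^ (r - 1) * x\<^sub>c ^ 0))"
    by (simp add: mult.assoc)
  then have "act (e\<^sub>c * x\<^sub>a ^ (r - 1) * x\<^sub>b ^ (r - 1)) unit_vec_A = wedge_c (of_coeffs (mono (- 1) (int r - 1) 0))"
    by (simp only: act_mult[of "e\<^sub>c"] act_gen act_monomial[OF r(1,3)] r(2) rep.simps of_nat_0 period)
  then show "act (e\<^sub>c * x\<^sub>a ^ (r - 1) * x\<^sub>b ^ (r - 1)) unit_vec_A = h2_vec"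
    unfolding h2_vec_def by (intro vec_eqI coeffs_eqI, case_tac i) simp_all
  have "e\<^sub>c * x\<^sub>a ^ (r - 1) * x\<^sub>c = e\<^sub>c * (x\<^sub>a ^ (r - 1) * (x\<^sub>b ^ 0 * x\<^sub>c ^ 1))"
    by (simp add: mult.assoc)
  then have "act (e\<^sub>a + e\<^sub>c * x\<^sub>a ^ (r - 1) * x\<^sub>c) unit_vec_A = wedge_a unit_vec_A + wedge_c (of_coeffs (mono (- 1) 0 1))"
    by (simp only: act_add act_mult[of "e\<^sub>c"] act_gen act_monomial[OF r(3,4)] r(2) rep.simps of_nat_0 of_nat_1 period)
  then show "act (e\<^sub>a + e\<^sub>c * x\<^sub>a ^ (r - 1) * x\<^sub>c) unit_vec_A = n_vec"
    unfolding n_vec_def by (intro vec_eqI coeffs_eqI, case_tac i) simp_all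
qed

end

section \<open>The de Rham cohomology as a vector space\<close>

lemma to_Omega_image: "to_Omega q r x = (\<lambda>h. h + x) ` relation_ideal q r"
  by (auto simp: to_Omega_def a_r_coset_def')

lemma to_Omega_eq_iff: "to_Omega q r x = to_Omega q r y \<longleftrightarrow> cong q r x y"
proof
  assume "to_Omega q r x = to_Omega q r y"
  moreover have "x \<in> to_Omega q r x"
    unfolding to_Omega_image using relation_ideal_zero[of q r] by force
  ultimately show "cong q r x y"
    by (auto simp: to_Omega_image cong_def)
next
  assume xy: "cong q r x y"
  have "to_Omega q r x \<subseteq> to_Omega q r y" if "cong q r x y" for x y
  proof
    fix z assume "z \<in> to_Omega q r x"
    then obtain h where h: "h \<in> relation_ideal q r" "z = h + x" by (auto simp: to_Omega_image)
    have "h + (x - y) \<in> relation_ideal q r"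
      using that h by (intro relation_ideal_add) (simp_all add: cong_def)
    then show "z \<in> to_Omega q r y"
      unfolding to_Omega_image h(2) by (rule rev_image_eqI) simp
  qed
  then show "to_Omega q r x = to_Omega q r y"
    using xy cong_sym by blast
qed

lemma Omega_carrier: "carrier (Omega q r) = range (to_Omega q r)"
  by (auto simp: Omega_def Let_def FactRing_def A_RCOSETS_def' to_Omega_def)

lemma Omega_zero: "\<zero>\<^bsub>Omega q r\<^esub> = to_Omega q r 0"
  by (simp add: Omega_def Let_def FactRing_def to_Omega_image)

lemma Omega_add: "to_Omega q r x \<oplus>\<^bsub>Omega q r\<^esub> to_Omega q r y = to_Omega q r (x + y)"
proof -
  have "to_Omega q r x \<oplus>\<^bsub>Omega q r\<^esub> to_Omega q r y =
      (\<Union>h\<in>relation_ideal q r. \<Union>k\<in>relation_ideal q r. {h + x + (k + y)})"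
    by (simp add: Omega_def Let_def FactRing_def set_add_def' to_Omega_image)
  also have "\<dots> = to_Omega q r (x + y)"
  proof safe
    fix h k assume "h \<in> relation_ideal q r" "k \<in> relation_ideal q r"
    then show "h + x + (k + y) \<in> to_Omega q r (x + y)"
      unfolding to_Omega_image using relation_ideal_add[of h q r k]
      by (intro rev_image_eqI[of "h + k"]) (simp_all add: algebra_simps)
  next
    fix z assume "z \<in> to_Omega q r (x + y)"
    then obtain h where "h \<in> relation_ideal q r" "z = h + x + (0 + y)"
      by (auto simp: to_Omega_image algebra_simps)
    then show "z \<in> (\<Union>h\<in>relation_ideal q r. \<Union>k\<in>relation_ideal q r. {h + x + (k + y)})"
      using relation_ideal_zero[of q r] by blast
  qed
  finally show ?thesis .
qed

lemma Omega_mult: "to_Omega q r x \<otimes>\<^bsub>Omega q r\<^esub> to_Omega q r y = to_Omega q r (x * y)"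
  using ideal.rcoset_mult_add[OF relation_ideal_ideal, of x y q r]
  by (simp add: Omega_def Let_def FactRing_def to_Omega_def)

lemma Omega_smult: "z \<odot>\<^bsub>Omega q r\<^esub> to_Omega q r x = to_Omega q r (scalar z * x)"
  using ideal.rcoset_mult_add[OF relation_ideal_ideal, of "scalar z" x q r]
  by (simp add: Omega_def Let_def FactRing_def to_Omega_def)

lemma Omega_abelian_group: "abelian_group (Omega q r)"
proof (rule abelian_groupI)
  fix X assume "X \<in> carrier (Omega q r)"
  then obtain x where "X = to_Omega q r x" by (auto simp: Omega_carrier)
  then show "\<exists>Y\<in>carrier (Omega q r). Y \<oplus>\<^bsub>Omega q r\<^esub> X = \<zero>\<^bsub>Omega q r\<^esub>"
    by (intro bexI[of _ "to_Omega q r (- x)"]) (simp_all add: Omega_add Omega_zero Omega_carrier)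
qed (auto simp: Omega_carrier Omega_add Omega_zero algebra_simps)

lemma Omega_uminus: "\<ominus>\<^bsub>Omega q r\<^esub> to_Omega q r x = to_Omega q r (- x)"
  by (rule abelian_group.minus_equality[OF Omega_abelian_group])
    (simp_all add: Omega_add Omega_zero Omega_carrier)

lemma Omega_minus: "to_Omega q r x \<ominus>\<^bsub>Omega q r\<^esub> to_Omega q r y = to_Omega q r (x - y)"
  by (simp add: a_minus_def Omega_uminus Omega_add)

section \<open>Cocycles and coboundaries on representatives in the free algebra\<close>

context reduced_SL2
begin

definition closed_elements :: "free_algebra set" where
  "closed_elements = {x \<in> homogeneous 1. theta_free * x + x * theta_free \<approx>\<^sub>\<Omega> 0}"

definition exact_elements :: "free_algebra set" where
  "exact_elements = (\<lambda>y. y * theta_free - theta_free * y) ` homogeneous 0"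

lemma theta_eq: "theta q r = to_Omega q r theta_free"
  by (simp add: theta_def theta_free_def)

lemma Omega_deg_eq: "Omega_deg q r i = to_Omega q r ` homogeneous i"
  by (simp add: Omega_deg_def homogeneous_def)

lemma ext_d_0: "ext_d q r 0 (to_Omega q r y) = to_Omega q r (y * theta_free - theta_free * y)"
  by (simp add: ext_d_def theta_eq Omega_mult Omega_smult Omega_minus Omega_uminus)

lemma ext_d_1: "ext_d q r 1 (to_Omega q r x) = to_Omega q r (- (theta_free * x + x * theta_free))"
  by (simp add: ext_d_def theta_eq Omega_mult Omega_smult Omega_minus Omega_uminus scalar_uminus)

lemma closed_forms_eq: "closed_forms q r 1 = to_Omega q r ` closed_elements"
proof -
  have neg: "- t \<approx>\<^sub>\<Omega> 0 \<longleftrightarrow> t \<approx>\<^sub>\<Omega> 0" for t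
    using cong_uminus[of q r "- t" 0] cong_uminus[of q r t 0] by auto
  have "ext_d q r 1 (to_Omega q r x) = \<zero>\<^bsub>Omega q r\<^esub> \<longleftrightarrow> theta_free * x + x * theta_free \<approx>\<^sub>\<Omega> 0" for x
    by (simp only: ext_d_1 Omega_zero to_Omega_eq_iff neg)
  then show ?thesis
    by (auto simp: closed_forms_def Omega_deg_eq closed_elements_def)
qed

lemma exact_forms_eq: "exact_forms q r 1 = to_Omega q r ` exact_elements"
  by (auto simp: exact_forms_def Omega_deg_eq ext_d_0 exact_elements_def image_image)

lemma exact_elements_zero: "0 \<in> exact_elements"
  and exact_elements_add: "x \<in> exact_elements \<Longrightarrow> y \<in> exact_elements \<Longrightarrow> x + y \<in> exact_elements"
  and exact_elements_scale: "x \<in> exact_elements \<Longrightarrow> scalar z * x \<in> exact_elements"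
  and exact_elements_homogeneous: "x \<in> exact_elements \<Longrightarrow> x \<in> homogeneous 1"
proof -
  show "0 \<in> exact_elements"
    unfolding exact_elements_def by (rule rev_image_eqI[of 0]) simp_all
  show "x \<in> homogeneous 1" if x: "x \<in> exact_elements"
  proof -
    obtain y where y: "y \<in> homogeneous 0" "x = y * theta_free - theta_free * y"
      using x by (auto simp: exact_elements_def)
    show ?thesis
      unfolding y(2)
      by (intro homogeneous_diff homogeneous_mult_1(1)[OF theta_homogeneous y(1)]
          homogeneous_mult_1(2)[OF y(1) theta_homogeneous])
  qed
  show "x + y \<in> exact_elements" if "x \<in> exact_elements" "y \<in> exact_elements"
  proof -
    obtain x' y' where xy: "x' \<in> homogeneous 0" "y' \<in> homogeneous 0"
      "x = x' * theta_free - theta_free * x'" "y = y' * theta_free - theta_free * y'"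
      using \<open>x \<in> exact_elements\<close> \<open>y \<in> exact_elements\<close> by (auto simp: exact_elements_def)
    then show ?thesis
      unfolding exact_elements_def xy(3,4)
      by (intro rev_image_eqI[of "x' + y'"]) (simp_all add: xy(1,2) homogeneous_add algebra_simps)
  qed
  show "scalar z * x \<in> exact_elements" if x: "x \<in> exact_elements"
  proof -
    obtain x' where "x' \<in> homogeneous 0" "x = x' * theta_free - theta_free * x'"
      using x by (auto simp: exact_elements_def)
    then show ?thesis
      unfolding exact_elements_def
      by (intro rev_image_eqI[of "scalar z * x'"])
        (simp_all add: homogeneous_scale right_diff_distrib mult.assoc scalar_left_commute[of theta_free])
  qed
qed

lemma exact_elements_uminus: "x \<in> exact_elements \<Longrightarrow> - x \<in> exact_elements"
  using exact_elements_scale[of x "- 1"] by (simp add: scalar_uminus)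

definition cls :: "free_algebra \<Rightarrow> free_algebra set set" where
  "cls x = de_Rham_class q r 1 (to_Omega q r x)"

lemma cls_image: "cls x = (\<lambda>b. to_Omega q r (b + x)) ` exact_elements"
  by (auto simp: cls_def de_Rham_class_def a_r_coset_def' exact_forms_eq[unfolded One_nat_def] Omega_add)

lemma cls_eq_iff: "cls x = cls y \<longleftrightarrow> (\<exists>b\<in>exact_elements. x \<approx>\<^sub>\<Omega> b + y)"
proof
  assume "cls x = cls y"
  moreover have "to_Omega q r x \<in> cls x"
    unfolding cls_image using exact_elements_zero by (rule rev_image_eqI) simp
  ultimately show "\<exists>b\<in>exact_elements. x \<approx>\<^sub>\<Omega> b + y"
    by (auto simp: cls_image to_Omega_eq_iff)
next
  have sub: "cls x \<subseteq> cls y" if "b \<in> exact_elements" "x \<approx>\<^sub>\<Omega> b + y" for b x y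
  proof
    fix X assume "X \<in> cls x"
    then obtain c where c: "c \<in> exact_elements" "X = to_Omega q r (c + x)"
      by (auto simp: cls_image)
    have "c + x \<approx>\<^sub>\<Omega> c + (b + y)"
      by (intro cong_add cong_refl that)
    then have "X = to_Omega q r ((c + b) + y)"
      unfolding c(2) to_Omega_eq_iff by (simp add: add.assoc)
    then show "X \<in> cls y"
      unfolding cls_image using exact_elements_add[OF c(1) that(1)] by blast
  qed
  assume "\<exists>b\<in>exact_elements. x \<approx>\<^sub>\<Omega> b + y"
  then obtain b where b: "b \<in> exact_elements" "x \<approx>\<^sub>\<Omega> b + y" by blast
  have "y \<approx>\<^sub>\<Omega> - b + x"
    using cong_add[OF cong_refl[of q r "- b"] cong_sym[OF b(2)]] by simp
  then show "cls x = cls y"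
    using sub[OF b] sub[OF exact_elements_uminus[OF b(1)]] by blast
qed

definition H1 :: "(complex, free_algebra set set) module" where
  "H1 = de_Rham q r 1"

lemma H1_carrier: "carrier H1 = cls ` closed_elements"
  by (auto simp: H1_def de_Rham_def quotient_space_def A_RCOSETS_def' closed_forms_eq[unfolded One_nat_def] cls_def
      de_Rham_class_def a_r_coset_def')

lemma H1_zero: "\<zero>\<^bsub>H1\<^esub> = cls 0"
  by (simp add: H1_def de_Rham_def quotient_space_def cls_image exact_forms_eq[unfolded One_nat_def])

lemma H1_add: "cls x \<oplus>\<^bsub>H1\<^esub> cls y = cls (x + y)"
proof -
  have "cls x \<oplus>\<^bsub>H1\<^esub> cls y = (\<Union>X\<in>cls x. \<Union>Y\<in>cls y. {X \<oplus>\<^bsub>Omega q r\<^esub> Y})"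
    by (simp add: H1_def de_Rham_def quotient_space_def set_add_def')
  also have "\<dots> = (\<Union>b\<in>exact_elements. \<Union>c\<in>exact_elements. {to_Omega q r ((b + x) + (c + y))})"
    by (simp add: cls_image Omega_add)
  also have "\<dots> = cls (x + y)"
  proof safe
    fix b c assume "b \<in> exact_elements" "c \<in> exact_elements"
    then show "to_Omega q r ((b + x) + (c + y)) \<in> cls (x + y)"
      unfolding cls_image using exact_elements_add[of b c]
      by (intro rev_image_eqI[of "b + c"]) (simp_all add: algebra_simps)
  next
    fix X assume "X \<in> cls (x + y)"
    then obtain b where "b \<in> exact_elements" "X = to_Omega q r ((b + x) + (0 + y))"
      by (auto simp: cls_image algebra_simps)
    then show "X \<in> (\<Union>b\<in>exact_elements. \<Union>c\<in>exact_elements. {to_Omega q r ((b + x) + (c + y))})"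
      using exact_elements_zero by blast
  qed
  finally show ?thesis .
qed

text \<open>The scalar multiple in the quotient is a union over all representatives; the cosets in
  it coincide because exact elements are stable under scaling.\<close>

lemma H1_smult: "z \<odot>\<^bsub>H1\<^esub> cls x = cls (scalar z * x)"
proof -
  have "z \<odot>\<^bsub>H1\<^esub> cls x = (\<Union>b\<in>exact_elements. cls (scalar z * (b + x)))"
    by (simp add: H1_def de_Rham_def quotient_space_def cls_def[of "scalar _ * _"] de_Rham_class_def
        cls_image[of x] Omega_smult a_r_coset_def')
  also have "\<dots> = (\<Union>b\<in>exact_elements. cls (scalar z * x))"
  proof (intro SUP_cong refl)
    fix b assume "b \<in> exact_elements"
    then show "cls (scalar z * (b + x)) = cls (scalar z * x)"
      unfolding cls_eq_iff using exact_elements_scale[of b z]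
      by (intro bexI[of _ "scalar z * b"]) (simp_all add: distrib_left)
  qed
  also have "\<dots> = cls (scalar z * x)"
    using exact_elements_zero by auto
  finally show ?thesis .
qed

lemma closed_elements_zero: "0 \<in> closed_elements"
  and closed_elements_add: "x \<in> closed_elements \<Longrightarrow> y \<in> closed_elements \<Longrightarrow> x + y \<in> closed_elements"
  and closed_elements_scale: "x \<in> closed_elements \<Longrightarrow> scalar z * x \<in> closed_elements"
proof -
  show "0 \<in> closed_elements" by (simp add: closed_elements_def)
  show "x + y \<in> closed_elements" if "x \<in> closed_elements" "y \<in> closed_elements"
  proof -
    have "(theta_free * x + x * theta_free) + (theta_free * y + y * theta_free) \<approx>\<^sub>\<Omega> 0 + 0"
      using that by (intro cong_add) (simp_all add: closed_elements_def)
    then show ?thesis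
      using that homogeneous_add[of x 1 y] by (simp add: closed_elements_def algebra_simps)
  qed
  show "scalar z * x \<in> closed_elements" if "x \<in> closed_elements"
  proof -
    have "scalar z * (theta_free * x + x * theta_free) \<approx>\<^sub>\<Omega> scalar z * 0"
      using that by (intro cong_mult cong_refl) (simp add: closed_elements_def)
    then show ?thesis
      using that homogeneous_scale[of x 1 z]
      by (simp add: closed_elements_def distrib_left mult.assoc scalar_left_commute[of theta_free])
  qed
qed

lemma H1_vectorspace: "vectorspace class_ring H1"
proof -
  have "module class_ring H1"
  proof (rule module_criteria)
    show "cring (class_ring :: complex ring)"
      by (rule class_cring.cring_axioms)
    show "\<forall>v\<in>carrier H1. \<exists>w\<in>carrier H1. v \<oplus>\<^bsub>H1\<^esub> w = \<zero>\<^bsub>H1\<^esub>"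
    proof
      fix v assume "v \<in> carrier H1"
      then obtain x where x: "x \<in> closed_elements" "v = cls x" by (auto simp: H1_carrier)
      have "cls x \<oplus>\<^bsub>H1\<^esub> cls (scalar (- 1) * x) = \<zero>\<^bsub>H1\<^esub>"
        by (simp add: H1_add H1_zero scalar_uminus)
      then show "\<exists>w\<in>carrier H1. v \<oplus>\<^bsub>H1\<^esub> w = \<zero>\<^bsub>H1\<^esub>"
        unfolding x(2) H1_carrier using closed_elements_scale[OF x(1)] by blast
    qed
  qed (auto simp: H1_carrier H1_zero H1_add H1_smult closed_elements_zero closed_elements_add
      closed_elements_scale scalar_mult scalar_add algebra_simps intro!: imageI)
  then show ?thesis
    by (intro vectorspace.intro class_field)
qed

lemma act_scalar_mult: "act (scalar z * x) v = z *\<^sub>F act x v"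
  by (simp only: act_mult act_scalar)

lemma closed_elements_act: "x \<in> closed_elements \<longleftrightarrow> x \<in> homogeneous 1 \<and> act x unit_vec_A \<in> closed_vecs"
  using grade_1_admissible[of x] closed_iff[of x] by (auto simp: closed_elements_def closed_vecs_def)

text \<open>Transport of cohomology to coordinates. One direction needs only that the relations act
  by zero; the other uses faithfulness in degree one, with the coboundary of \<open>nf f\<close> as
  witness.\<close>

lemma cls_eq_act:
  assumes x: "x \<in> homogeneous 1" and y: "y \<in> homogeneous 1"
  shows "cls x = cls y \<longleftrightarrow> (\<exists>f\<in>admissible. act x unit_vec_A = act y unit_vec_A + vec_d0 f)"
proof
  assume "cls x = cls y"
  then obtain z where z: "z \<in> homogeneous 0" "x \<approx>\<^sub>\<Omega> (z * theta_free - theta_free * z) + y"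
    by (auto simp: cls_eq_iff exact_elements_def)
  have "act x unit_vec_A = act y unit_vec_A + vec_d0 (act z unit_vec_A F1)"
    using cong_act[OF z(2) unit_admissible] by (simp only: act_add act_d0[OF z(1)] add.commute)
  moreover have "act z unit_vec_A F1 \<in> admissible"
    using act_admissible[OF unit_admissible, of z] by (simp add: admissible_vec_def)
  ultimately show "\<exists>f\<in>admissible. act x unit_vec_A = act y unit_vec_A + vec_d0 f" by blast
next
  assume "\<exists>f\<in>admissible. act x unit_vec_A = act y unit_vec_A + vec_d0 f"
  then obtain f where f: "f \<in> admissible" "act x unit_vec_A = act y unit_vec_A + vec_d0 f" by blast
  let ?b = "nf f * theta_free - theta_free * nf f"
  have b: "?b \<in> exact_elements"
    unfolding exact_elements_def using nf_homogeneous by blast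
  have "act (?b + y) unit_vec_A = act x unit_vec_A"
    by (simp only: act_add act_d0[OF nf_homogeneous] act_nf[OF f(1)] of_coeffs_simps f(2) add.commute)
  then have "x \<approx>\<^sub>\<Omega> ?b + y"
    using cong_iff_act[OF x homogeneous_add[OF exact_elements_homogeneous[OF b] y]] by simp
  then show "cls x = cls y"
    using b by (auto simp: cls_eq_iff)
qed

section \<open>The isomorphism with four-dimensional coordinate space\<close>

definition class_rep :: "nat \<Rightarrow> free_algebra" where
  "class_rep i = (if i = 0 then theta_free
    else if i = 1 then e\<^sub>b * x\<^sub>a * x\<^sub>c ^ (r - 1)
    else if i = 2 then e\<^sub>c * x\<^sub>a ^ (r - 1) * x\<^sub>b ^ (r - 1)
    else e\<^sub>a + e\<^sub>c * x\<^sub>a ^ (r - 1) * x\<^sub>c)"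

lemma class_rep_homogeneous: "class_rep i \<in> homogeneous 1"
proof -
  have "x\<^sub>a ^ j \<in> homogeneous 0" "x\<^sub>b ^ j \<in> homogeneous 0" "x\<^sub>c ^ j \<in> homogeneous 0" for j
    by (intro homogeneous_power homogeneous_gens)+
  then show ?thesis
    unfolding class_rep_def
    by (auto intro!: homogeneous_add theta_homogeneous[unfolded One_nat_def] homogeneous_gens[unfolded One_nat_def]
        homogeneous_mult_1(1)[unfolded One_nat_def])
qed

lemma act_class_rep: "act (class_rep 0) unit_vec_A = theta_vec" "act (class_rep 1) unit_vec_A = h1_vec"
  "act (class_rep 2) unit_vec_A = h2_vec" "act (class_rep 3) unit_vec_A = n_vec"
  using act_classes by (simp_all only: class_rep_def) simp_all

lemma class_rep_closed: "i < 4 \<Longrightarrow> class_rep i \<in> closed_elements"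
proof -
  have "theta_free \<in> closed_elements"
    using cong_add[OF theta_square theta_square] theta_homogeneous by (simp add: closed_elements_def)
  then have "class_rep 0 \<in> closed_elements"
    by (simp add: class_rep_def)
  moreover have "class_rep 1 \<in> closed_elements" "class_rep 2 \<in> closed_elements" "class_rep 3 \<in> closed_elements"
    unfolding closed_elements_act act_class_rep
    by (intro conjI class_rep_homogeneous h1_closed h2_closed n_closed)+
  moreover assume "i < 4"
  then have "i = 0 \<or> i = 1 \<or> i = 2 \<or> i = 3" by linarith
  ultimately show ?thesis by blast
qed

definition combination :: "complex vec \<Rightarrow> free_algebra" where
  "combination v = (\<Sum>i<4. scalar (v $ i) * class_rep i)"

lemma combination_closed: "combination v \<in> closed_elements"
proof -
  have "(\<Sum>i\<in>A. scalar (v $ i) * class_rep i) \<in> closed_elements" if "A \<subseteq> {..<4}" for A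
    using finite_subset[OF that finite_lessThan] that
    by (induction A rule: finite_induct)
      (simp_all add: closed_elements_zero closed_elements_add closed_elements_scale class_rep_closed)
  then show ?thesis by (simp add: combination_def)
qed

lemma lessThan_4: "{..<4::nat} = {0, 1, 2, 3}"
  by auto

lemma act_combination: "act (combination v) unit_vec_A =
    v $ 0 *\<^sub>F theta_vec + v $ 1 *\<^sub>F h1_vec + v $ 2 *\<^sub>F h2_vec + v $ 3 *\<^sub>F n_vec"
proof -
  have "combination v = scalar (v $ 0) * class_rep 0 + scalar (v $ 1) * class_rep 1
      + scalar (v $ 2) * class_rep 2 + scalar (v $ 3) * class_rep 3"
    by (simp add: combination_def lessThan_4)
  then show ?thesis
    by (simp only: act_add act_scalar_mult act_class_rep)
qed

definition class_map :: "complex vec \<Rightarrow> free_algebra set set" where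
  "class_map v = cls (combination v)"

lemma combination_homogeneous: "combination v \<in> homogeneous 1"
  using combination_closed by (simp add: closed_elements_def)

lemma class_map_linear: "linear_map class_ring (module_vec TYPE(complex) 4) H1 class_map"
proof (intro linear_map.intro mod_hom.intro mod_hom_axioms.intro vec_vs H1_vectorspace)
  show "module class_ring (module_vec TYPE(complex) 4)" "module class_ring H1"
    using vec_module vectorspace.axioms(1)[OF H1_vectorspace] by blast+
  have "class_map (v + w) = class_map v \<oplus>\<^bsub>H1\<^esub> class_map w"
    if "v \<in> carrier_vec 4" "w \<in> carrier_vec 4" for v w
    using that by (simp add: class_map_def H1_add combination_def lessThan_4 scalar_add algebra_simps)
  moreover have "class_map (z \<cdot>\<^sub>v v) = z \<odot>\<^bsub>H1\<^esub> class_map v" if "v \<in> carrier_vec 4" for z v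
    using that by (simp add: class_map_def H1_smult combination_def lessThan_4 scalar_mult algebra_simps)
  ultimately show "class_map \<in> LinearCombinations.module_hom class_ring (module_vec TYPE(complex) 4) H1"
    by (auto simp: LinearCombinations.module_hom_def module_vec_simps H1_carrier class_map_def combination_closed)
qed

lemma class_map_inj: "inj_on class_map (carrier_vec 4)"
proof (rule inj_onI)
  fix v w :: "complex vec" assume v: "v \<in> carrier_vec 4" and w: "w \<in> carrier_vec 4"
    and "class_map v = class_map w"
  then obtain f where f: "f \<in> admissible" "act (combination v) unit_vec_A = act (combination w) unit_vec_A + vec_d0 f"
    unfolding class_map_def using cls_eq_act[OF combination_homogeneous combination_homogeneous] by blast
  have "(v $ 0 - w $ 0) *\<^sub>F theta_vec + (v $ 1 - w $ 1) *\<^sub>F h1_vec + (v $ 2 - w $ 2) *\<^sub>F h2_vec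
      + (v $ 3 - w $ 3) *\<^sub>F n_vec = vec_d0 f"
  proof -
    have eq: "vec_d0 f = act (combination v) unit_vec_A - act (combination w) unit_vec_A"
      by (simp only: f(2) add_diff_cancel_left')
    show ?thesis
      unfolding eq act_combination by (intro vec_eqI coeffs_eqI) (simp add: algebra_simps)
  qed
  from class_vecs_independent[OF f(1) this]
  have *: "v $ 0 = w $ 0" "v $ 1 = w $ 1" "v $ 2 = w $ 2" "v $ 3 = w $ 3"
    by simp_all
  have "v $ i = w $ i" if "i < 4" for i
  proof -
    have "i = 0 \<or> i = 1 \<or> i = 2 \<or> i = 3" using that by linarith
    then show ?thesis using * by blast
  qed
  then show "v = w"
    using v w by (intro eq_vecI) auto
qed

lemma class_map_surj: "class_map ` carrier_vec 4 = carrier H1"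
proof (intro equalityI subsetI)
  fix X assume "X \<in> carrier H1"
  then obtain x where x: "x \<in> closed_elements" "X = cls x"
    unfolding H1_carrier by blast
  have "act x unit_vec_A \<in> closed_vecs"
    using x(1) by (simp add: closed_elements_act)
  then obtain \<alpha> \<beta> \<gamma> \<epsilon> f where f: "f \<in> admissible"
    "act x unit_vec_A = \<alpha> *\<^sub>F theta_vec + \<beta> *\<^sub>F h1_vec + \<gamma> *\<^sub>F h2_vec + \<epsilon> *\<^sub>F n_vec + vec_d0 f"
    by (rule closed_vecs_span)
  define v where "v = vec 4 (\<lambda>i. if i = 0 then \<alpha> else if i = 1 then \<beta> else if i = 2 then \<gamma> else \<epsilon>)"
  have v: "v \<in> carrier_vec 4" "v $ 0 = \<alpha>" "v $ 1 = \<beta>" "v $ 2 = \<gamma>" "v $ 3 = \<epsilon>"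
    by (simp_all add: v_def)
  have "cls x = cls (combination v)"
    using f x(1) unfolding cls_eq_act[OF conjunct1[OF closed_elements_act[THEN iffD1, OF x(1)]] combination_homogeneous]
      act_combination v by blast
  then show "X \<in> class_map ` carrier_vec 4"
    unfolding x(2) class_map_def using v(1) by blast
qed (auto simp: H1_carrier class_map_def combination_closed)

lemma class_map_unit: "i < 4 \<Longrightarrow> class_map (unit_vec 4 i) = cls (class_rep i)"
proof -
  assume i: "i < 4"
  have "combination (unit_vec 4 i) = (\<Sum>j<4. if j = i then class_rep j else 0)"
    unfolding combination_def by (intro sum.cong) (use i in auto)
  then show ?thesis using i by (simp add: class_map_def)
qed

text \<open>The standard basis is carried along the linear isomorphism \<open>class_map\<close>; its
  injectivity also ensures that the four classes are distinct.\<close>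

lemma H1_basis:
  "vectorspace.basis class_ring H1 (cls ` (class_rep ` {..<4})) \<and> vectorspace.dim class_ring H1 = 4"
proof -
  interpret T: linear_map class_ring "module_vec TYPE(complex) 4" H1 class_map
    by (rule class_map_linear)
  interpret C: vec_space "TYPE(complex)" 4 .
  have surj: "class_map ` carrier (module_vec TYPE(complex) 4) = carrier H1"
    and inj: "inj_on class_map (carrier (module_vec TYPE(complex) 4))"
    using class_map_surj class_map_inj by (simp_all only: module_vec_simps)
  have basis: "T.W.basis (class_map ` set (unit_vecs 4))"
    by (rule T.linear_inj_image_is_basis[OF inj surj C.unit_vecs_basis C.fin_dim])
  have "class_map ` set (unit_vecs 4) = (\<lambda>i. class_map (unit_vec 4 i)) ` {..<4}"
    by (auto simp: unit_vecs_def)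
  also have "\<dots> = (\<lambda>i. cls (class_rep i)) ` {..<4}"
    by (intro image_cong refl class_map_unit) (simp only: lessThan_iff)
  finally have image: "class_map ` set (unit_vecs 4) = cls ` (class_rep ` {..<4})"
    by (simp only: image_image)
  have "T.W.dim = 4"
    using T.dim_eq[OF C.fin_dim inj surj] C.dim_is_n by (simp only:)
  then show ?thesis
    using basis by (simp only: image simp_thms)
qed

end

theorem proposition3p3:
  fixes r :: nat and q :: complex
  assumes "r \<in> {3, 5, 7}"
    and "q ^ r = 1" and "\<forall>k. 0 < k \<and> k < r \<longrightarrow> q ^ k \<noteq> 1"
  shows "vectorspace class_ring (de_Rham q r 1) \<and>
    vectorspace.dim class_ring (de_Rham q r 1) = 4 \<and>
    vectorspace.basis class_ring (de_Rham q r 1)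
      (de_Rham_class q r 1 `
        {theta q r,
         to_Omega q r (e\<^sub>b * x\<^sub>a * x\<^sub>c ^ (r - 1)),
         to_Omega q r (e\<^sub>c * x\<^sub>a ^ (r - 1) * x\<^sub>b ^ (r - 1)),
         to_Omega q r (e\<^sub>a + e\<^sub>c * x\<^sub>a ^ (r - 1) * x\<^sub>c)})"
proof -
  interpret reduced_SL2 q r
    using assms by unfold_locales auto
  have "cls ` (class_rep ` {..<4}) = de_Rham_class q r 1 ` to_Omega q r ` class_rep ` {..<4}"
    by (simp only: cls_def image_image)
  also have "to_Omega q r ` class_rep ` {..<4} = {theta q r,
         to_Omega q r (e\<^sub>b * x\<^sub>a * x\<^sub>c ^ (r - 1)),
         to_Omega q r (e\<^sub>c * x\<^sub>a ^ (r - 1) * x\<^sub>b ^ (r - 1)),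
         to_Omega q r (e\<^sub>a + e\<^sub>c * x\<^sub>a ^ (r - 1) * x\<^sub>c)}"
    by (simp add: lessThan_4 class_rep_def theta_eq insert_commute)
  finally show ?thesis
    using H1_basis H1_vectorspace by (simp only: H1_def)
qed

end
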